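(* Let $k\in\mathbb N\cup\{\infty\}$ and let the target language be interpreted with its $k$-semantics $[\![-]\!]_k$ (so the type $\mathbf{vect}$ implements the vector space $\mathbb R^k$). Assume that the AD macro $\mathcal D$ is sound for primitives. Then for every program $x:\tau\vdash t:\sigma$ of the source language, where $\tau,\sigma$ are data types (types not containing function types), the map $[\![t]\!]:[\![\tau]\!]\to[\![\sigma]\!]_\bot$ is differentiable and $$[\![\mathcal D(t)]\!]_k=\mathfrak d^k([\![t]\!]).$$
   Context: **Source language.** Fix a set $\mathtt R\subset\mathbb R$ with $0\in\mathtt R$ and, for each $n\in\mathbb N$, a set $\mathrm{Op}_n$ of $n$-ary primitive operations. Types: $\tau,\sigma::=\mathbf{real}\mid\mathbf 0\mid\mathbf 1\mid\tau\sqcup\sigma\mid\tau\times\sigma\mid\tau\to\sigma$. Terms (a call-by-value language; standard typing rules for the standard constructs): variables $x$; $\mathbf{let}\,x=t\,\mathbf{in}\,s$; constants $\underline c:\mathbf{real}$ ($c\in\mathtt R$); $op(t_1,\dots,t_n):\mathbf{real}$ for $op\in\mathrm{Op}_n$, $t_i:\mathbf{real}$; empty case $\mathbf{case}\,t\,\mathbf{of}\{\}$ for $t:\mathbf 0$; $\mathbf{inl}\,t$, $\mathbf{inr}\,t$; $\mathbf{case}\,r\,\mathbf{of}\{\mathbf{inl}\,x\to t\mid\mathbf{inr}\,y\to s\}$; $\langle\rangle$; $\langle t,s\rangle$; $\mathbf{case}\,r\,\mathbf{of}\langle x,y\rangle\to t$; $\lambda x.t$; $t\,s$; $\mathbf{sign}\,t:\mathbf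 1\sqcup\mathbf 1$ for $t:\mathbf{real}$; iteration $\Gamma\vdash\mathbf{iterate}\,t\,\mathbf{from}\,x=s:\tau$ when $\Gamma,x:\sigma\vdash t:\sigma\sqcup\tau$ and $\Gamma\vdash s:\sigma$; recursion $\Gamma\vdash\mu x.t:\tau$ when $\Gamma,x:\tau\vdash t:\tau$ and $\tau$ is a function type. **Target language.** The source language plus a type $\mathbf{vect}$ and terms $\overline e_i:\mathbf{vect}$ ($i\ge1$), $\overline 0:\mathbf{vect}$, $t+s:\mathbf{vect}$ (for $t,s:\mathbf{vect}$), $t*s:\mathbf{vect}$ (for $t:\mathbf{vect}$, $s:\mathbf{real}$), $\mathfrak h_i\,t:\mathbf{real}^i$ (for $t:\mathbf{vect}$, $i\geq 1$). **Semantics.** An $\omega$-cpo is a poset with suprema of $\omega$-chains; morphisms are monotone maps preserving these; $(-)_\bot$ is the monad freely adding a least element. Types denote $\omega$-cpos: $[\![\mathbf{real}]\!]=\mathbb R$ with the discrete order, $\mathbf 0,\mathbf 1,\sqcup,\times$ denote the initial object, terminal object, coproduct, product, and $[\![\tau\to\sigma]\!]$ is the exponential $[\![\tau]\!]\Rightarrow([\![\sigma]\!]_\bot)$. A term $\Gamma\vdash t:\tau$ denotes a morphism $[\![\Gamma]\!]\to[\![\tau]\!]_\bot$, using the standard call-by-value (Kleisli) interpretation for the standard constructs; $\underline c$ denotes $c$; $op\in\mathrm{Op}_n$ denotes a chosen map $[\![op]\!]:\mathbb R^n\to\mathbb R_\bot$, standingly assumed to be differentiable (definition below); $\mathbf{sign}$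 denotes $\mathbb R\to(\mathbf 1\sqcup\mathbf 1)_\bot$ sending negative reals to the left point, positive reals to the right point and $0$ to $\bot$. Iteration: $[\![\mathbf{iterate}\,t\,\mathbf{from}\,x=s]\!](\gamma)$ is $h$ applied (in the Kleisli sense) to $[\![s]\!](\gamma)$, where $h$ is the least map satisfying: $h(a)=h(a')$ if $[\![t]\!](\gamma,a)=\mathbf{inl}\,a'$, $h(a)=b$ if it is $\mathbf{inr}\,b$, $h(a)=\bot$ if it is $\bot$. Recursion: $[\![\mu x.t]\!](\gamma)$ is the (non-bottom) value given by the least $f\in[\![\tau]\!]$ such that $f(a)$ equals $\bot$ if $[\![t]\!](\gamma,f)=\bot$ and $g(a)$ if $[\![t]\!](\gamma,f)=g$. The $k$-semantics $[\![-]\!]_k$ of the target language, $k\in\mathbb N\cup\{\infty\}$, extends this with $[\![\mathbf{vect}]\!]_k=\mathbb R^k$ (discrete order; $\mathbb R^\infty$ is the vector space freely generated by $\{e_i:i\ge1\}$), $+,*,\overline 0$ the vector space operations, $\overline e_i$ denoting the $i$-th canonical basis vector if $i\le k$ (or $k=\infty$) and $0$ otherwise, and $\mathfrak h_i$ denoting the canonical projection $\mathbb R^k\to\mathbb R^i$ if $i\le k$ and the canonical coprojection (extension by zero) otherwise. **AD macro $\mathcal D$** (source to target). Fix, for every $op\in\mathrm{Op}_n$ and $1\le i\le n$, a term $x_1:\mathbf{real},\dots,x_n:\mathbf{real}\vdash\partial_i op(x_1,\dots,x_n):\mathbf{real}$. On types $\mathcal D(\mathbf{real})=\mathbf{real}\times\mathbf{vect}$,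 and $\mathcal D$ commutes with $\mathbf 0,\mathbf 1,\sqcup,\times,\to$. On terms $\mathcal D$ commutes with all constructs except: $\mathcal D(\underline c)=\langle\underline c,\overline0\rangle$; $\mathcal D(\mathbf{sign}\,r)=\mathbf{sign}(\mathbf{fst}\,\mathcal D(r))$; and $\mathcal D(op(r_1,\dots,r_n))$ evaluates $\mathcal D(r_1),\dots,\mathcal D(r_n)$ to pairs $\langle x_1,x_1'\rangle,\dots,\langle x_n,x_n'\rangle$, then lets $y=op(x_1,\dots,x_n)$ and $z_i=\partial_i op(x_1,\dots,x_n)$ and returns $\langle y,\;x_1'*z_1+\dots+x_n'*z_n\rangle$. If $\Gamma\vdash t:\tau$ then $\mathcal D(\Gamma)\vdash\mathcal D(t):\mathcal D(\tau)$. **Data types.** For a data type $\tau$, distributivity gives a canonical isomorphism $[\![\tau]\!]\cong\coprod_{r\in K}\mathbb R^{s_r}$ (with $K$ finite), and the same recipe gives $[\![\mathcal D(\tau)]\!]_k\cong\coprod_{r\in K}(\mathbb R\times\mathbb R^k)^{s_r}$; these identifications are used. **Differentiability and $\mathfrak d^k$.** A map $h:\coprod_{r\in K}\mathbb R^{n_r}\to\big(\coprod_{j\in L}\mathbb R^{m_j}\big)_\bot$ is differentiable if for all $i\in K$, $j\in L$, with $h_i$ the restriction of $h$ to $\mathbb R^{n_i}$, the set $W_{ij}=h_i^{-1}(\mathbb R^{m_j})$ is open in $\mathbb R^{n_i}$ and $h_i|_{W_{ij}}:W_{ij}\to\mathbb R^{m_j}$ is differentiable. Then $\mathfrak d^k(h):\coprod_{r\in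 K}(\mathbb R\times\mathbb R^k)^{n_r}\to\big(\coprod_{j\in L}(\mathbb R\times\mathbb R^k)^{m_j}\big)_\bot$ sends $\big((x_1,w_1),\dots,(x_{n_i},w_{n_i})\big)$ in the $i$-th summand to $\bot$ if $h_i(x)=\bot$, and, if $x\in W_{ij}$ and $h_i|_{W_{ij}}=(f_1,\dots,f_{m_j})$, to $\big((f_1(x),\sum_l\partial_lf_1(x)\,w_l),\dots,(f_{m_j}(x),\sum_l\partial_lf_{m_j}(x)\,w_l)\big)$ in the $j$-th summand. **Sound for primitives.** $\mathcal D$ is sound for primitives if for every $op\in\mathrm{Op}_n$, $n\in\mathbb N$, and every $k\in\mathbb N\cup\{\infty\}$, $[\![\mathcal D(op)]\!]_k=\mathfrak d^k([\![op]\!])$ as maps $(\mathbb R\times\mathbb R^k)^n\to(\mathbb R\times\mathbb R^k)_\bot$, where $\mathcal D(op)$ denotes $\mathcal D(op(y_1,\dots,y_n))$ in context $y_1,\dots,y_n:\mathcal D(\mathbf{real})$. *)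

theory Defs
  imports "HOL-Analysis.Analysis" "HOL-Library.Extended_Nat"
begin

section \<open>Syntax\<close>

text \<open>One datatype covers both languages: the target language has everything, the source language
  is carved out by \<open>src_ty\<close> and \<open>src_tm\<close> below.\<close>

datatype ty = Real | Zero | One | Sum ty ty | Prod ty ty | Fun ty ty | Vect

text \<open>Terms use de Bruijn indices and carry enough type annotations for a term to determine its
  typing derivation, so that the denotation of a derivation can be given by recursion on the term.
  \<open>TCasePair r t\<close> binds the first component to index 0 and the second to index 1.
  \<open>TInl \<sigma> t\<close> is annotated with the right summand, \<open>TInr \<tau> t\<close> with the left one,
  \<open>TLam \<tau> \<sigma> t\<close> and \<open>TMu \<tau> \<sigma> t\<close> with their function type \<open>Fun \<tau> \<sigma>\<close>, and
  \<open>TIterate \<sigma> \<tau> t s\<close> is ``iterate t from x = s'' with \<open>t : Sum \<sigma> \<tau>\<close>.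
  \<open>TBasis i\<close> and \<open>TProj i\<close> are used for \<open>i \<ge> 1\<close>.\<close>

datatype 'op tm =
    TVar nat
  | TLet "'op tm" "'op tm"
  | TConst real
  | TOp 'op "'op tm list"
  | TCaseZero ty "'op tm"
  | TInl ty "'op tm"
  | TInr ty "'op tm"
  | TCaseSum "'op tm" "'op tm" "'op tm"
  | TUnit
  | TPair "'op tm" "'op tm"
  | TCasePair "'op tm" "'op tm"
  | TLam ty ty "'op tm"
  | TApp "'op tm" "'op tm"
  | TSign "'op tm"
  | TIterate ty ty "'op tm" "'op tm"
  | TMu ty ty "'op tm"
  | TBasis nat
  | TVZero
  | TVAdd "'op tm" "'op tm"
  | TVScale "'op tm" "'op tm"
  | TProj nat "'op tm"

text \<open>\<open>Op\<^sub>n\<close> is \<open>{f. arity S f = n}\<close>. The term \<open>partial_op S f i\<close> (for \<open>i < arity S f\<close>) is the chosen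
  term for the partial derivative of \<open>f\<close> in its argument number \<open>i\<close>, counted from 0; its free
  variable \<open>TVar l\<close> stands for argument number \<open>l\<close>. It may use the target language.\<close>

record 'op signature =
  consts_of :: "real set"
  arity :: "'op \<Rightarrow> nat"
  op_sem :: "'op \<Rightarrow> real list \<Rightarrow> real option"
  partial_op :: "'op \<Rightarrow> nat \<Rightarrow> 'op tm"

fun real_pow :: "nat \<Rightarrow> ty" where
  "real_pow 0 = One"
| "real_pow (Suc 0) = Real"
| "real_pow (Suc (Suc n)) = Prod (real_pow (Suc n)) Real"

inductive has_type :: "'op signature \<Rightarrow> ty list \<Rightarrow> 'op tm \<Rightarrow> ty \<Rightarrow> bool" for S where
  "i < length \<Gamma> \<Longrightarrow> has_type S \<Gamma> (TVar i) (\<Gamma> ! i)"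
| "has_type S \<Gamma> t \<sigma> \<Longrightarrow> has_type S (\<sigma> # \<Gamma>) s \<tau> \<Longrightarrow> has_type S \<Gamma> (TLet t s) \<tau>"
| "c \<in> consts_of S \<Longrightarrow> has_type S \<Gamma> (TConst c) Real"
| "length ts = arity S f \<Longrightarrow> \<forall>t\<in>set ts. has_type S \<Gamma> t Real \<Longrightarrow> has_type S \<Gamma> (TOp f ts) Real"
| "has_type S \<Gamma> t Zero \<Longrightarrow> has_type S \<Gamma> (TCaseZero \<tau> t) \<tau>"
| "has_type S \<Gamma> t \<tau> \<Longrightarrow> has_type S \<Gamma> (TInl \<sigma> t) (Sum \<tau> \<sigma>)"
| "has_type S \<Gamma> t \<sigma> \<Longrightarrow> has_type S \<Gamma> (TInr \<tau> t) (Sum \<tau> \<sigma>)"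
| "has_type S \<Gamma> r (Sum \<sigma> \<rho>) \<Longrightarrow> has_type S (\<sigma> # \<Gamma>) t \<tau> \<Longrightarrow> has_type S (\<rho> # \<Gamma>) s \<tau> \<Longrightarrow>
    has_type S \<Gamma> (TCaseSum r t s) \<tau>"
| "has_type S \<Gamma> TUnit One"
| "has_type S \<Gamma> t \<tau> \<Longrightarrow> has_type S \<Gamma> s \<sigma> \<Longrightarrow> has_type S \<Gamma> (TPair t s) (Prod \<tau> \<sigma>)"
| "has_type S \<Gamma> r (Prod \<sigma> \<rho>) \<Longrightarrow> has_type S (\<sigma> # \<rho> # \<Gamma>) t \<tau> \<Longrightarrow> has_type S \<Gamma> (TCasePair r t) \<tau>"
| "has_type S (\<tau> # \<Gamma>) t \<sigma> \<Longrightarrow> has_type S \<Gamma> (TLam \<tau> \<sigma> t) (Fun \<tau> \<sigma>)"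
| "has_type S \<Gamma> t (Fun \<tau> \<sigma>) \<Longrightarrow> has_type S \<Gamma> s \<tau> \<Longrightarrow> has_type S \<Gamma> (TApp t s) \<sigma>"
| "has_type S \<Gamma> t Real \<Longrightarrow> has_type S \<Gamma> (TSign t) (Sum One One)"
| "has_type S (\<sigma> # \<Gamma>) t (Sum \<sigma> \<tau>) \<Longrightarrow> has_type S \<Gamma> s \<sigma> \<Longrightarrow> has_type S \<Gamma> (TIterate \<sigma> \<tau> t s) \<tau>"
| "has_type S (Fun \<tau> \<sigma> # \<Gamma>) t (Fun \<tau> \<sigma>) \<Longrightarrow> has_type S \<Gamma> (TMu \<tau> \<sigma> t) (Fun \<tau> \<sigma>)"
| "1 \<le> i \<Longrightarrow> has_type S \<Gamma> (TBasis i) Vect"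
| "has_type S \<Gamma> TVZero Vect"
| "has_type S \<Gamma> t Vect \<Longrightarrow> has_type S \<Gamma> s Vect \<Longrightarrow> has_type S \<Gamma> (TVAdd t s) Vect"
| "has_type S \<Gamma> t Vect \<Longrightarrow> has_type S \<Gamma> s Real \<Longrightarrow> has_type S \<Gamma> (TVScale t s) Vect"
| "1 \<le> i \<Longrightarrow> has_type S \<Gamma> t Vect \<Longrightarrow> has_type S \<Gamma> (TProj i t) (real_pow i)"

primrec src_ty :: "ty \<Rightarrow> bool" where
  "src_ty Real = True"
| "src_ty Zero = True"
| "src_ty One = True"
| "src_ty (Sum \<tau> \<sigma>) = (src_ty \<tau> \<and> src_ty \<sigma>)"
| "src_ty (Prod \<tau> \<sigma>) = (src_ty \<tau> \<and> src_ty \<sigma>)"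
| "src_ty (Fun \<tau> \<sigma>) = (src_ty \<tau> \<and> src_ty \<sigma>)"
| "src_ty Vect = False"

primrec src_tm :: "'op tm \<Rightarrow> bool" where
  "src_tm (TVar i) = True"
| "src_tm (TLet t s) = (src_tm t \<and> src_tm s)"
| "src_tm (TConst c) = True"
| "src_tm (TOp f ts) = list_all id (map src_tm ts)"
| "src_tm (TCaseZero \<tau> t) = (src_ty \<tau> \<and> src_tm t)"
| "src_tm (TInl \<sigma> t) = (src_ty \<sigma> \<and> src_tm t)"
| "src_tm (TInr \<tau> t) = (src_ty \<tau> \<and> src_tm t)"
| "src_tm (TCaseSum r t s) = (src_tm r \<and> src_tm t \<and> src_tm s)"
| "src_tm TUnit = True"
| "src_tm (TPair t s) = (src_tm t \<and> src_tm s)"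
| "src_tm (TCasePair r t) = (src_tm r \<and> src_tm t)"
| "src_tm (TLam \<tau> \<sigma> t) = (src_ty \<tau> \<and> src_ty \<sigma> \<and> src_tm t)"
| "src_tm (TApp t s) = (src_tm t \<and> src_tm s)"
| "src_tm (TSign t) = src_tm t"
| "src_tm (TIterate \<sigma> \<tau> t s) = (src_ty \<sigma> \<and> src_ty \<tau> \<and> src_tm t \<and> src_tm s)"
| "src_tm (TMu \<tau> \<sigma> t) = (src_ty \<tau> \<and> src_ty \<sigma> \<and> src_tm t)"
| "src_tm (TBasis i) = False"
| "src_tm TVZero = False"
| "src_tm (TVAdd t s) = False"
| "src_tm (TVScale t s) = False"
| "src_tm (TProj i t) = False"

primrec data_ty :: "ty \<Rightarrow> bool" where
  "data_ty Real = True"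
| "data_ty Zero = True"
| "data_ty One = True"
| "data_ty (Sum \<tau> \<sigma>) = (data_ty \<tau> \<and> data_ty \<sigma>)"
| "data_ty (Prod \<tau> \<sigma>) = (data_ty \<tau> \<and> data_ty \<sigma>)"
| "data_ty (Fun \<tau> \<sigma>) = False"
| "data_ty Vect = False"


section \<open>The AD macro\<close>

definition up :: "(nat \<Rightarrow> nat) \<Rightarrow> nat \<Rightarrow> nat" where
  "up \<rho> i = (case i of 0 \<Rightarrow> 0 | Suc j \<Rightarrow> Suc (\<rho> j))"

primrec ren :: "(nat \<Rightarrow> nat) \<Rightarrow> 'op tm \<Rightarrow> 'op tm" where
  "ren \<rho> (TVar i) = TVar (\<rho> i)"
| "ren \<rho> (TLet t s) = TLet (ren \<rho> t) (ren (up \<rho>) s)"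
| "ren \<rho> (TConst c) = TConst c"
| "ren \<rho> (TOp f ts) = TOp f (map (ren \<rho>) ts)"
| "ren \<rho> (TCaseZero \<tau> t) = TCaseZero \<tau> (ren \<rho> t)"
| "ren \<rho> (TInl \<sigma> t) = TInl \<sigma> (ren \<rho> t)"
| "ren \<rho> (TInr \<tau> t) = TInr \<tau> (ren \<rho> t)"
| "ren \<rho> (TCaseSum r t s) = TCaseSum (ren \<rho> r) (ren (up \<rho>) t) (ren (up \<rho>) s)"
| "ren \<rho> TUnit = TUnit"
| "ren \<rho> (TPair t s) = TPair (ren \<rho> t) (ren \<rho> s)"
| "ren \<rho> (TCasePair r t) = TCasePair (ren \<rho> r) (ren (up (up \<rho>)) t)"
| "ren \<rho> (TLam \<tau> \<sigma> t) = TLam \<tau> \<sigma> (ren (up \<rho>) t)"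
| "ren \<rho> (TApp t s) = TApp (ren \<rho> t) (ren \<rho> s)"
| "ren \<rho> (TSign t) = TSign (ren \<rho> t)"
| "ren \<rho> (TIterate \<sigma> \<tau> t s) = TIterate \<sigma> \<tau> (ren (up \<rho>) t) (ren \<rho> s)"
| "ren \<rho> (TMu \<tau> \<sigma> t) = TMu \<tau> \<sigma> (ren (up \<rho>) t)"
| "ren \<rho> (TBasis i) = TBasis i"
| "ren \<rho> TVZero = TVZero"
| "ren \<rho> (TVAdd t s) = TVAdd (ren \<rho> t) (ren \<rho> s)"
| "ren \<rho> (TVScale t s) = TVScale (ren \<rho> t) (ren \<rho> s)"
| "ren \<rho> (TProj i t) = TProj i (ren \<rho> t)"

definition shift :: "nat \<Rightarrow> 'op tm \<Rightarrow> 'op tm" where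
  "shift m = ren (\<lambda>i. i + m)"

definition vect_sum :: "'op tm list \<Rightarrow> 'op tm" where
  "vect_sum ts = (case ts of [] \<Rightarrow> TVZero | t # ts' \<Rightarrow> foldl TVAdd t ts')"

text \<open>\<open>AD_op S f ds\<close> is \<open>\<D>(f(r\<^sub>0,\<dots>,r\<^sub>n\<^sub>-\<^sub>1))\<close> where \<open>ds = [\<D>(r\<^sub>0),\<dots>,\<D>(r\<^sub>n\<^sub>-\<^sub>1)]\<close>:
  \<open>case \<D>(r\<^sub>0) of \<langle>x\<^sub>0,x'\<^sub>0\<rangle> \<rightarrow> \<dots> case \<D>(r\<^sub>n\<^sub>-\<^sub>1) of \<langle>x\<^sub>n\<^sub>-\<^sub>1,x'\<^sub>n\<^sub>-\<^sub>1\<rangle> \<rightarrow>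
   let y = f(x\<^sub>0,\<dots>) in let z\<^sub>0 = \<partial>\<^sub>0f(x\<^sub>0,\<dots>) in \<dots> let z\<^sub>n\<^sub>-\<^sub>1 = \<dots> in \<langle>y, x'\<^sub>0*z\<^sub>0 + \<dots> + x'\<^sub>n\<^sub>-\<^sub>1*z\<^sub>n\<^sub>-\<^sub>1\<rangle>\<close>.
  After the case bindings, \<open>x\<^sub>l\<close> has index \<open>2(n-1-l)\<close> and \<open>x'\<^sub>l\<close> the next one; every let adds 1.\<close>

definition AD_op :: "'op signature \<Rightarrow> 'op \<Rightarrow> 'op tm list \<Rightarrow> 'op tm" where
  "AD_op S f ds =
    (let n = length ds; x = (\<lambda>l. 2 * (n - 1 - l)) in
     foldr TCasePair (map (\<lambda>i. shift (2 * i) (ds ! i)) [0..<n])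
      (TLet (TOp f (map (\<lambda>l. TVar (x l)) [0..<n]))
        (foldr TLet (map (\<lambda>i. ren (\<lambda>l. x l + 1 + i) (partial_op S f i)) [0..<n])
          (TPair (TVar n)
            (vect_sum (map (\<lambda>i. TVScale (TVar (x i + 1 + (n + 1))) (TVar (n - 1 - i))) [0..<n]))))))"

text \<open>The values of \<open>AD_ty\<close> and \<open>AD\<close> on constructs that are not in the source language are
  irrelevant and left unspecified.\<close>

primrec (nonexhaustive) AD_ty :: "ty \<Rightarrow> ty" where
  "AD_ty Real = Prod Real Vect"
| "AD_ty Zero = Zero"
| "AD_ty One = One"
| "AD_ty (Sum \<tau> \<sigma>) = Sum (AD_ty \<tau>) (AD_ty \<sigma>)"
| "AD_ty (Prod \<tau> \<sigma>) = Prod (AD_ty \<tau>) (AD_ty \<sigma>)"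
| "AD_ty (Fun \<tau> \<sigma>) = Fun (AD_ty \<tau>) (AD_ty \<sigma>)"

primrec (nonexhaustive) AD :: "'op signature \<Rightarrow> 'op tm \<Rightarrow> 'op tm" where
  "AD S (TVar i) = TVar i"
| "AD S (TLet t s) = TLet (AD S t) (AD S s)"
| "AD S (TConst c) = TPair (TConst c) TVZero"
| "AD S (TOp f ts) = AD_op S f (map (AD S) ts)"
| "AD S (TCaseZero \<tau> t) = TCaseZero (AD_ty \<tau>) (AD S t)"
| "AD S (TInl \<sigma> t) = TInl (AD_ty \<sigma>) (AD S t)"
| "AD S (TInr \<tau> t) = TInr (AD_ty \<tau>) (AD S t)"
| "AD S (TCaseSum r t s) = TCaseSum (AD S r) (AD S t) (AD S s)"
| "AD S TUnit = TUnit"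
| "AD S (TPair t s) = TPair (AD S t) (AD S s)"
| "AD S (TCasePair r t) = TCasePair (AD S r) (AD S t)"
| "AD S (TLam \<tau> \<sigma> t) = TLam (AD_ty \<tau>) (AD_ty \<sigma>) (AD S t)"
| "AD S (TApp t s) = TApp (AD S t) (AD S s)"
| "AD S (TSign t) = TSign (TCasePair (AD S t) (TVar 0))"
| "AD S (TIterate \<sigma> \<tau> t s) = TIterate (AD_ty \<sigma>) (AD_ty \<tau>) (AD S t) (AD S s)"
| "AD S (TMu \<tau> \<sigma> t) = TMu (AD_ty \<tau>) (AD_ty \<sigma>) (AD S t)"


section \<open>\<omega>-cpos\<close>

record 'a poset =
  carr :: "'a set"
  leq :: "'a \<Rightarrow> 'a \<Rightarrow> bool"

definition discrete :: "'a set \<Rightarrow> 'a poset" where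
  "discrete A = \<lparr>carr = A, leq = (=)\<rparr>"

text \<open>The monad freely adding a least element, which is \<open>None\<close>.\<close>

definition lift :: "'a poset \<Rightarrow> 'a option poset" where
  "lift P = \<lparr>carr = insert None (Some ` carr P),
     leq = (\<lambda>u v. case u of None \<Rightarrow> True
                  | Some a \<Rightarrow> (case v of None \<Rightarrow> False | Some b \<Rightarrow> leq P a b))\<rparr>"

definition omega_chain :: "'a poset \<Rightarrow> (nat \<Rightarrow> 'a) \<Rightarrow> bool" where
  "omega_chain P X \<longleftrightarrow> range X \<subseteq> carr P \<and> (\<forall>n. leq P (X n) (X (Suc n)))"

definition is_sup :: "'a poset \<Rightarrow> (nat \<Rightarrow> 'a) \<Rightarrow> 'a \<Rightarrow> bool" where
  "is_sup P X s \<longleftrightarrow> s \<in> carr P \<and> (\<forall>n. leq P (X n) s) \<and>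
     (\<forall>u\<in>carr P. (\<forall>n. leq P (X n) u) \<longrightarrow> leq P s u)"

definition morphism :: "'a poset \<Rightarrow> 'b poset \<Rightarrow> ('a \<Rightarrow> 'b) \<Rightarrow> bool" where
  "morphism P Q \<phi> \<longleftrightarrow> \<phi> ` carr P \<subseteq> carr Q \<and> monotone_on (carr P) (leq P) (leq Q) \<phi> \<and>
     (\<forall>X s. omega_chain P X \<longrightarrow> is_sup P X s \<longrightarrow> is_sup Q (\<phi> \<circ> X) (\<phi> s))"

text \<open>The exponential \<open>P \<Rightarrow> Q\<^sub>\<bottom>\<close>; a map on \<open>carr P\<close> is represented by its extension with \<open>None\<close>.\<close>

definition kleisli_exp :: "'a poset \<Rightarrow> 'b poset \<Rightarrow> ('a \<Rightarrow> 'b option) poset" where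
  "kleisli_exp P Q = \<lparr>carr = {\<phi>. morphism P (lift Q) \<phi> \<and> (\<forall>a. a \<notin> carr P \<longrightarrow> \<phi> a = None)},
     leq = (\<lambda>\<phi> \<psi>. \<forall>a\<in>carr P. leq (lift Q) (\<phi> a) (\<psi> a))\<rparr>"

definition least_in :: "'a poset \<Rightarrow> 'a set \<Rightarrow> 'a" where
  "least_in P A = (THE a. a \<in> A \<and> (\<forall>b\<in>A. leq P a b))"


section \<open>Semantic domains\<close>

text \<open>Elements of all the \<omega>-cpos \<open>\<lbrakk>\<tau>\<rbrakk>\<^sub>k\<close> live in one type. Since a HOL type cannot contain its own
  function space, elements of \<open>\<lbrakk>\<tau> \<rightarrow> \<sigma>\<rbrakk>\<close> are represented by codes from a parameter type \<open>'f\<close>.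
  The predicate \<open>codes\<close> below says that a given coding is faithful for all function types of
  nesting depth at most \<open>N\<close>; under it, \<open>ty_cpo\<close> at these types is the hierarchy of exponentials of
  \<omega>-cpos. For every \<open>N\<close> there is a type \<open>'f\<close> with such a coding (lemmas \<open>codes_0\<close> and
  \<open>codes_Suc\<close>), but no single HOL type has one for all \<open>N\<close>.

  Vectors are functions of their coordinates, with the coordinate of \<open>e\<^sub>i\<close> at argument \<open>i \<ge> 1\<close>.\<close>

datatype 'f val =
    VReal real
  | VUnit
  | VInl "'f val"
  | VInr "'f val"
  | VPair "'f val" "'f val"
  | VFun 'f
  | VVect "nat \<Rightarrow> real"

record 'f coding =
  enc :: "('f val \<Rightarrow> 'f val option) \<Rightarrow> 'f"
  dec :: "'f \<Rightarrow> 'f val \<Rightarrow> 'f val option"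

text \<open>\<open>\<real>\<^sup>k\<close>, for \<open>k = \<infinity>\<close> the space freely generated by all \<open>e\<^sub>i\<close>.\<close>

definition vect_space :: "enat \<Rightarrow> (nat \<Rightarrow> real) set" where
  "vect_space k = {w. finite {i. w i \<noteq> 0} \<and> (\<forall>i. w i \<noteq> 0 \<longrightarrow> 1 \<le> i \<and> enat i \<le> k)}"

definition sum_poset :: "'f val poset \<Rightarrow> 'f val poset \<Rightarrow> 'f val poset" where
  "sum_poset P Q = \<lparr>carr = VInl ` carr P \<union> VInr ` carr Q,
     leq = (\<lambda>u v. (\<exists>a b. u = VInl a \<and> v = VInl b \<and> leq P a b) \<or>
                  (\<exists>a b. u = VInr a \<and> v = VInr b \<and> leq Q a b))\<rparr>"

definition prod_poset :: "'f val poset \<Rightarrow> 'f val poset \<Rightarrow> 'f val poset" where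
  "prod_poset P Q = \<lparr>carr = {VPair a b | a b. a \<in> carr P \<and> b \<in> carr Q},
     leq = (\<lambda>u v. \<exists>a b a' b'. u = VPair a b \<and> v = VPair a' b' \<and> leq P a a' \<and> leq Q b b')\<rparr>"

definition fun_poset :: "'f coding \<Rightarrow> 'f val poset \<Rightarrow> 'f val poset \<Rightarrow> 'f val poset" where
  "fun_poset C P Q = \<lparr>carr = (\<lambda>\<phi>. VFun (enc C \<phi>)) ` carr (kleisli_exp P Q),
     leq = (\<lambda>u v. \<exists>c d. u = VFun c \<and> v = VFun d \<and> leq (kleisli_exp P Q) (dec C c) (dec C d))\<rparr>"

primrec ty_cpo :: "'f coding \<Rightarrow> enat \<Rightarrow> ty \<Rightarrow> 'f val poset" where
  "ty_cpo C k Real = discrete (range VReal)"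
| "ty_cpo C k Zero = discrete {}"
| "ty_cpo C k One = discrete {VUnit}"
| "ty_cpo C k (Sum \<tau> \<sigma>) = sum_poset (ty_cpo C k \<tau>) (ty_cpo C k \<sigma>)"
| "ty_cpo C k (Prod \<tau> \<sigma>) = prod_poset (ty_cpo C k \<tau>) (ty_cpo C k \<sigma>)"
| "ty_cpo C k (Fun \<tau> \<sigma>) = fun_poset C (ty_cpo C k \<tau>) (ty_cpo C k \<sigma>)"
| "ty_cpo C k Vect = discrete (VVect ` vect_space k)"

primrec fun_depth :: "ty \<Rightarrow> nat" where
  "fun_depth Real = 0"
| "fun_depth Zero = 0"
| "fun_depth One = 0"
| "fun_depth (Sum \<tau> \<sigma>) = max (fun_depth \<tau>) (fun_depth \<sigma>)"
| "fun_depth (Prod \<tau> \<sigma>) = max (fun_depth \<tau>) (fun_depth \<sigma>)"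
| "fun_depth (Fun \<tau> \<sigma>) = Suc (max (fun_depth \<tau>) (fun_depth \<sigma>))"
| "fun_depth Vect = 0"

definition codes :: "nat \<Rightarrow> 'f coding \<Rightarrow> bool" where
  "codes N C \<longleftrightarrow> (\<forall>k \<tau> \<sigma>. fun_depth (Fun \<tau> \<sigma>) \<le> N \<longrightarrow>
     (\<forall>\<phi>\<in>carr (kleisli_exp (ty_cpo C k \<tau>) (ty_cpo C k \<sigma>)). dec C (enc C \<phi>) = \<phi>))"

text \<open>Existence of faithful codings for every bound on the depth, by iterating \<open>codes_Suc\<close>.\<close>

lemma codes_0: "codes 0 C"
  by (simp add: codes_def)

definition embeds :: "('a \<Rightarrow> 'b) \<Rightarrow> 'a poset \<Rightarrow> 'b poset \<Rightarrow> bool" where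
  "embeds \<iota> P P' \<longleftrightarrow> carr P' = \<iota> ` carr P \<and> (\<forall>a\<in>carr P. \<forall>b\<in>carr P. leq P' (\<iota> a) (\<iota> b) = leq P a b)"

definition push :: "('a \<Rightarrow> 'b) \<Rightarrow> ('a \<Rightarrow> 'a option) \<Rightarrow> 'b \<Rightarrow> 'b option" where
  "push \<iota> G b = (if b \<in> range \<iota> then map_option \<iota> (G (inv \<iota> b)) else None)"

definition pull :: "('a \<Rightarrow> 'b) \<Rightarrow> ('b \<Rightarrow> 'b option) \<Rightarrow> 'a \<Rightarrow> 'a option" where
  "pull \<iota> F a = map_option (inv \<iota>) (F (\<iota> a))"

lemma push_app: "inj \<iota> \<Longrightarrow> push \<iota> G (\<iota> a) = map_option \<iota> (G a)"
  by (simp add: push_def)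

lemma pull_push: "inj \<iota> \<Longrightarrow> pull \<iota> (push \<iota> G) = G"
  by (rule ext) (simp add: pull_def push_app option.map_comp o_def option.map_ident)

lemma embeds_lift: "embeds \<iota> P P' \<Longrightarrow> embeds (map_option \<iota>) (lift P) (lift P')"
  by (auto simp: embeds_def lift_def image_image)

lemma embeds_is_sup:
  assumes "embeds \<iota> P P'" "inj \<iota>" "range X \<subseteq> carr P"
  shows "is_sup P' (\<lambda>n. \<iota> (X n)) (\<iota> s) = is_sup P X s"
proof -
  have X: "X n \<in> carr P" for n using assms(3) by auto
  have s: "\<iota> s \<in> carr P' \<longleftrightarrow> s \<in> carr P"
    using assms(1,2) by (auto simp: embeds_def dest: injD)
  show ?thesis
    using assms(1) X unfolding is_sup_def s by (auto simp: embeds_def)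
qed

lemma embeds_chain:
  assumes "embeds \<iota> P P'"
  shows "omega_chain P' X' \<longleftrightarrow> (\<exists>X. X' = (\<lambda>n. \<iota> (X n)) \<and> omega_chain P X)"
proof
  assume c: "omega_chain P' X'"
  then have "\<forall>n. X' n \<in> \<iota> ` carr P"
    using assms by (auto simp: omega_chain_def embeds_def)
  then have "\<forall>n. \<exists>a. a \<in> carr P \<and> X' n = \<iota> a"
    by (simp add: image_iff) blast
  then obtain X where X: "\<And>n. X n \<in> carr P" "\<And>n. X' n = \<iota> (X n)"
    by metis
  then have "X' = (\<lambda>n. \<iota> (X n))" by auto
  moreover have "omega_chain P X"
    using c X assms by (auto simp: omega_chain_def embeds_def)
  ultimately show "\<exists>X. X' = (\<lambda>n. \<iota> (X n)) \<and> omega_chain P X" by blast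
next
  assume "\<exists>X. X' = (\<lambda>n. \<iota> (X n)) \<and> omega_chain P X"
  then show "omega_chain P' X'"
    using assms by (auto simp: omega_chain_def embeds_def image_subset_iff)
qed

lemma embeds_morphism:
  assumes P: "embeds \<iota> P P'" "inj \<iota>" and R: "embeds \<kappa> R R'" "inj \<kappa>"
    and F: "\<And>a. F (\<iota> a) = \<kappa> (G a)"
  shows "morphism P' R' F = morphism P R G"
proof -
  have c': "carr P' = \<iota> ` carr P" using P by (simp add: embeds_def)
  have im: "F ` carr P' \<subseteq> carr R' \<longleftrightarrow> G ` carr P \<subseteq> carr R"
    using R unfolding c' by (auto simp: embeds_def F image_subset_iff dest: injD)
  have mo: "monotone_on (carr P') (leq P') (leq R') F \<longleftrightarrow> monotone_on (carr P) (leq P) (leq R) G"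
    if "G ` carr P \<subseteq> carr R"
    using P R that unfolding c' monotone_on_def embeds_def by (auto simp: F image_subset_iff)
  have su: "(\<forall>X s. omega_chain P' X \<longrightarrow> is_sup P' X s \<longrightarrow> is_sup R' (F \<circ> X) (F s)) \<longleftrightarrow>
            (\<forall>X s. omega_chain P X \<longrightarrow> is_sup P X s \<longrightarrow> is_sup R (G \<circ> X) (G s))" (is "?l \<longleftrightarrow> ?r")
    if g: "G ` carr P \<subseteq> carr R"
  proof -
    have key: "is_sup R' (F \<circ> (\<lambda>n. \<iota> (X n))) (F (\<iota> s)) \<longleftrightarrow> is_sup R (G \<circ> X) (G s)"
      if "omega_chain P X" for X s
    proof -
      have "range (G \<circ> X) \<subseteq> carr R" using that g by (auto simp: omega_chain_def)
      from embeds_is_sup[OF R this, of "G s"] show ?thesis by (simp add: o_def F)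
    qed
    have supP: "is_sup P' (\<lambda>n. \<iota> (X n)) (\<iota> s) \<longleftrightarrow> is_sup P X s" if "omega_chain P X" for X s
      using that embeds_is_sup[OF P] by (auto simp: omega_chain_def)
    show ?thesis
    proof
      assume l: ?l
      show ?r
      proof (intro allI impI)
        fix X s assume a: "omega_chain P X" "is_sup P X s"
        then have "omega_chain P' (\<lambda>n. \<iota> (X n))" "is_sup P' (\<lambda>n. \<iota> (X n)) (\<iota> s)"
          using embeds_chain[OF P(1)] supP by blast+
        with l key[OF a(1)] show "is_sup R (G \<circ> X) (G s)" by blast
      qed
    next
      assume r: ?r
      show ?l
      proof (intro allI impI)
        fix X' s' assume a: "omega_chain P' X'" "is_sup P' X' s'"
        then obtain X s where X: "X' = (\<lambda>n. \<iota> (X n))" "omega_chain P X" and s: "s' = \<iota> s"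
          using embeds_chain[OF P(1)] c' by (auto simp: is_sup_def)
        with a r key[OF X(2)] supP[OF X(2)] show "is_sup R' (F \<circ> X') (F s')" by blast
      qed
    qed
  qed
  show ?thesis unfolding morphism_def using im mo su by blast
qed

lemma embeds_kleisli_exp:
  assumes P: "embeds \<iota> P P'" and Q: "embeds \<iota> Q Q'" and \<iota>: "inj \<iota>"
  shows "embeds (push \<iota>) (kleisli_exp P Q) (kleisli_exp P' Q')"
proof -
  have c': "carr P' = \<iota> ` carr P" using P by (simp add: embeds_def)
  have i2: "inj (map_option \<iota>)" using \<iota> by (rule option.inj_map)
  have mor: "morphism P' (lift Q') (push \<iota> G) = morphism P (lift Q) G" for G
    by (rule embeds_morphism[OF P \<iota> embeds_lift[OF Q] i2]) (simp add: push_app \<iota>)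
  have ex: "(\<forall>b. b \<notin> carr P' \<longrightarrow> push \<iota> G b = None) \<longleftrightarrow> (\<forall>a. a \<notin> carr P \<longrightarrow> G a = None)" for G
    unfolding c'
  proof
    assume "\<forall>b. b \<notin> \<iota> ` carr P \<longrightarrow> push \<iota> G b = None"
    then show "\<forall>a. a \<notin> carr P \<longrightarrow> G a = None"
      using \<iota> by (metis inj_image_mem_iff option.map_disc_iff push_app)
  next
    assume "\<forall>a. a \<notin> carr P \<longrightarrow> G a = None"
    then show "\<forall>b. b \<notin> \<iota> ` carr P \<longrightarrow> push \<iota> G b = None"
      using \<iota> by (auto simp: push_def)
  qed
  have pp: "push \<iota> (pull \<iota> F) = F" if F: "F \<in> carr (kleisli_exp P' Q')" for F
  proof
    fix b
    show "push \<iota> (pull \<iota> F) b = F b"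
    proof (cases "b \<in> carr P'")
      case True
      then obtain a where b: "b = \<iota> a" using c' by auto
      have "F b \<in> carr (lift Q')" using F True by (auto simp: kleisli_exp_def morphism_def)
      then have "F b = None \<or> (\<exists>c. F b = Some (\<iota> c))"
        using Q by (auto simp: lift_def embeds_def)
      then show ?thesis using \<iota> by (auto simp: b push_app pull_def)
    next
      case False
      then have "F b = None" using F by (auto simp: kleisli_exp_def)
      then show ?thesis by (auto simp: push_def pull_def f_inv_into_f)
    qed
  qed
  have mem: "push \<iota> G \<in> carr (kleisli_exp P' Q') \<longleftrightarrow> G \<in> carr (kleisli_exp P Q)" for G
    by (simp add: kleisli_exp_def mor ex)
  have "carr (kleisli_exp P' Q') = push \<iota> ` carr (kleisli_exp P Q)"
    using mem pp by (metis (no_types, lifting) image_iff subsetI subset_antisym)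
  moreover have "leq (kleisli_exp P' Q') (push \<iota> G) (push \<iota> H) = leq (kleisli_exp P Q) G H"
    if "G \<in> carr (kleisli_exp P Q)" "H \<in> carr (kleisli_exp P Q)" for G H
  proof -
    have "G a \<in> carr (lift Q)" "H a \<in> carr (lift Q)" if "a \<in> carr P" for a
      using that \<open>G \<in> _\<close> \<open>H \<in> _\<close> by (auto simp: kleisli_exp_def morphism_def)
    then show ?thesis
      using embeds_lift[OF Q] unfolding kleisli_exp_def by (auto simp: c' push_app \<iota> embeds_def)
  qed
  ultimately show ?thesis by (simp add: embeds_def)
qed

definition next_coding :: "'f coding \<Rightarrow> ('f + ('f val \<Rightarrow> 'f val option)) coding" where
  "next_coding C = \<lparr>
     enc = (\<lambda>F. let G = pull (map_val Inl) F in if dec C (enc C G) = G then Inl (enc C G) else Inr G),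
     dec = (\<lambda>c. push (map_val Inl) (case c of Inl c' \<Rightarrow> dec C c' | Inr G \<Rightarrow> G))\<rparr>"

lemma codes_Suc:
  assumes "codes N C"
  shows "codes (Suc N) (next_coding C)"
proof -
  let ?\<iota> = "map_val Inl :: 'a val \<Rightarrow> ('a + ('a val \<Rightarrow> 'a val option)) val"
  have \<iota>: "inj ?\<iota>" by (rule val.inj_map) simp
  have de: "dec (next_coding C) (enc (next_coding C) F) = push ?\<iota> (pull ?\<iota> F)" for F
    by (simp add: next_coding_def Let_def)
  have emb: "embeds ?\<iota> (ty_cpo C k \<tau>) (ty_cpo (next_coding C) k \<tau>)" if "fun_depth \<tau> \<le> N" for k \<tau>
    using that
  proof (induction \<tau>)
    case Real
    then show ?case by (auto simp: embeds_def discrete_def image_image)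
  next
    case Zero
    then show ?case by (simp add: embeds_def discrete_def)
  next
    case One
    then show ?case by (simp add: embeds_def discrete_def)
  next
    case (Sum \<tau> \<sigma>)
    then show ?case
      by (auto simp: embeds_def sum_poset_def image_Un image_image)
  next
    case (Prod \<tau> \<sigma>)
    then have \<tau>: "embeds ?\<iota> (ty_cpo C k \<tau>) (ty_cpo (next_coding C) k \<tau>)"
      and \<sigma>: "embeds ?\<iota> (ty_cpo C k \<sigma>) (ty_cpo (next_coding C) k \<sigma>)" by auto
    have "carr (ty_cpo (next_coding C) k (Prod \<tau> \<sigma>)) = ?\<iota> ` carr (ty_cpo C k (Prod \<tau> \<sigma>))"
    proof (intro subset_antisym subsetI)
      fix x assume "x \<in> carr (ty_cpo (next_coding C) k (Prod \<tau> \<sigma>))"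
      then obtain a b where "x = VPair (?\<iota> a) (?\<iota> b)" "a \<in> carr (ty_cpo C k \<tau>)" "b \<in> carr (ty_cpo C k \<sigma>)"
        using \<tau> \<sigma> by (auto simp: prod_poset_def embeds_def)
      then have "x = ?\<iota> (VPair a b)" "VPair a b \<in> carr (ty_cpo C k (Prod \<tau> \<sigma>))"
        by (auto simp: prod_poset_def)
      then show "x \<in> ?\<iota> ` carr (ty_cpo C k (Prod \<tau> \<sigma>))" by blast
    next
      fix x assume "x \<in> ?\<iota> ` carr (ty_cpo C k (Prod \<tau> \<sigma>))"
      then show "x \<in> carr (ty_cpo (next_coding C) k (Prod \<tau> \<sigma>))"
        using \<tau> \<sigma> by (auto simp: prod_poset_def embeds_def)
    qed
    moreover have "leq (ty_cpo (next_coding C) k (Prod \<tau> \<sigma>)) (?\<iota> u) (?\<iota> v) = leq (ty_cpo C k (Prod \<tau> \<sigma>)) u v"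
      if "u \<in> carr (ty_cpo C k (Prod \<tau> \<sigma>))" "v \<in> carr (ty_cpo C k (Prod \<tau> \<sigma>))" for u v
      using that \<tau> \<sigma> by (auto simp: prod_poset_def embeds_def)
    ultimately show ?case by (simp add: embeds_def)
  next
    case (Fun \<tau> \<sigma>)
    let ?K = "kleisli_exp (ty_cpo C k \<tau>) (ty_cpo C k \<sigma>)"
    let ?K' = "kleisli_exp (ty_cpo (next_coding C) k \<tau>) (ty_cpo (next_coding C) k \<sigma>)"
    have K: "embeds (push ?\<iota>) ?K ?K'"
      using Fun by (intro embeds_kleisli_exp \<iota>) auto
    have cd: "dec C (enc C G) = G" if "G \<in> carr ?K" for G
      using assms Fun.prems that by (auto simp: codes_def)
    have e: "enc (next_coding C) (push ?\<iota> G) = Inl (enc C G)" if "G \<in> carr ?K" for G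
      using cd[OF that] by (simp add: next_coding_def pull_push[OF \<iota>])
    have d: "dec (next_coding C) (Inl c) = push ?\<iota> (dec C c)" for c
      by (simp add: next_coding_def)
    have "carr ?K' = push ?\<iota> ` carr ?K" using K by (simp add: embeds_def)
    then have "carr (ty_cpo (next_coding C) k (Fun \<tau> \<sigma>)) = ?\<iota> ` carr (ty_cpo C k (Fun \<tau> \<sigma>))"
      by (auto simp: fun_poset_def image_image e cong: image_cong)
    moreover have "leq (ty_cpo (next_coding C) k (Fun \<tau> \<sigma>)) (?\<iota> u) (?\<iota> v) = leq (ty_cpo C k (Fun \<tau> \<sigma>)) u v"
      if "u \<in> carr (ty_cpo C k (Fun \<tau> \<sigma>))" "v \<in> carr (ty_cpo C k (Fun \<tau> \<sigma>))" for u v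
      using that K by (auto simp: fun_poset_def d cd embeds_def)
    ultimately show ?case by (simp add: embeds_def)
  next
    case Vect
    then show ?case by (auto simp: embeds_def discrete_def image_image)
  qed
  show ?thesis
    unfolding codes_def
  proof (intro allI impI ballI)
    fix k \<tau> \<sigma> F
    assume "fun_depth (Fun \<tau> \<sigma>) \<le> Suc N"
      and F: "F \<in> carr (kleisli_exp (ty_cpo (next_coding C) k \<tau>) (ty_cpo (next_coding C) k \<sigma>))"
    then have "embeds (push ?\<iota>) (kleisli_exp (ty_cpo C k \<tau>) (ty_cpo C k \<sigma>))
        (kleisli_exp (ty_cpo (next_coding C) k \<tau>) (ty_cpo (next_coding C) k \<sigma>))"
      by (intro embeds_kleisli_exp emb \<iota>) auto
    with F obtain G where "F = push ?\<iota> G" by (auto simp: embeds_def)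
    then show "dec (next_coding C) (enc (next_coding C) F) = F"
      by (simp add: de pull_push[OF \<iota>])
  qed
qed

text \<open>All types occurring in the typing derivation of \<open>t\<close> in a context of types without function
  types have \<open>fun_depth\<close> at most \<open>tm_depth t\<close>.\<close>

primrec tm_depth :: "'op tm \<Rightarrow> nat" where
  "tm_depth (TVar i) = 0"
| "tm_depth (TLet t s) = max (tm_depth t) (tm_depth s)"
| "tm_depth (TConst c) = 0"
| "tm_depth (TOp f ts) = foldr max (map tm_depth ts) 0"
| "tm_depth (TCaseZero \<tau> t) = max (fun_depth \<tau>) (tm_depth t)"
| "tm_depth (TInl \<sigma> t) = max (fun_depth \<sigma>) (tm_depth t)"
| "tm_depth (TInr \<tau> t) = max (fun_depth \<tau>) (tm_depth t)"
| "tm_depth (TCaseSum r t s) = max (tm_depth r) (max (tm_depth t) (tm_depth s))"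
| "tm_depth TUnit = 0"
| "tm_depth (TPair t s) = max (tm_depth t) (tm_depth s)"
| "tm_depth (TCasePair r t) = max (tm_depth r) (tm_depth t)"
| "tm_depth (TLam \<tau> \<sigma> t) = max (fun_depth (Fun \<tau> \<sigma>)) (tm_depth t)"
| "tm_depth (TApp t s) = max (tm_depth t) (tm_depth s)"
| "tm_depth (TSign t) = tm_depth t"
| "tm_depth (TIterate \<sigma> \<tau> t s) = max (fun_depth (Sum \<sigma> \<tau>)) (max (tm_depth t) (tm_depth s))"
| "tm_depth (TMu \<tau> \<sigma> t) = max (fun_depth (Fun \<tau> \<sigma>)) (tm_depth t)"
| "tm_depth (TBasis i) = 0"
| "tm_depth TVZero = 0"
| "tm_depth (TVAdd t s) = max (tm_depth t) (tm_depth s)"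
| "tm_depth (TVScale t s) = max (tm_depth t) (tm_depth s)"
| "tm_depth (TProj i t) = tm_depth t"


section \<open>Denotational semantics\<close>

primrec (nonexhaustive) un_real :: "'f val \<Rightarrow> real" where
  "un_real (VReal x) = x"

primrec (nonexhaustive) un_vect :: "'f val \<Rightarrow> nat \<Rightarrow> real" where
  "un_vect (VVect w) = w"

fun apply_val :: "'f coding \<Rightarrow> 'f val \<Rightarrow> 'f val \<Rightarrow> 'f val option" where
  "apply_val C (VFun c) a = dec C c a"
| "apply_val C _ a = None"

text \<open>The canonical (co)projection \<open>\<real>\<^sup>k \<rightarrow> \<real>\<^sup>i\<close>: coordinates of \<open>w \<in> vect_space k\<close> beyond \<open>k\<close> are 0, so
  the same formula serves \<open>i \<le> k\<close> and \<open>i > k\<close>.\<close>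

fun vect_tuple :: "nat \<Rightarrow> (nat \<Rightarrow> real) \<Rightarrow> 'f val" where
  "vect_tuple 0 w = VUnit"
| "vect_tuple (Suc 0) w = VReal (w 1)"
| "vect_tuple (Suc (Suc n)) w = VPair (vect_tuple (Suc n) w) (VReal (w (Suc (Suc n))))"

text \<open>The least map \<open>P \<rightarrow> Q\<^sub>\<bottom>\<close> solving the iteration equations for the body \<open>b : P \<rightarrow> (P \<squnion> Q)\<^sub>\<bottom>\<close>.\<close>

definition iteration ::
    "'f val poset \<Rightarrow> 'f val poset \<Rightarrow> ('f val \<Rightarrow> 'f val option) \<Rightarrow> 'f val \<Rightarrow> 'f val option" where
  "iteration P Q b = least_in (kleisli_exp P Q)
     {h \<in> carr (kleisli_exp P Q). \<forall>a\<in>carr P.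
        h a = (case b a of Some (VInl a') \<Rightarrow> h a' | Some (VInr v) \<Rightarrow> Some v | _ \<Rightarrow> None)}"

definition fixpoint ::
    "'f coding \<Rightarrow> 'f val poset \<Rightarrow> 'f val poset \<Rightarrow> ('f val \<Rightarrow> 'f val option) \<Rightarrow> 'f val" where
  "fixpoint C P Q b = least_in (fun_poset C P Q)
     {f \<in> carr (fun_poset C P Q). \<forall>a\<in>carr P.
        apply_val C f a = (case b f of None \<Rightarrow> None | Some g \<Rightarrow> apply_val C g a)}"

text \<open>The \<open>k\<close>-semantics. On source terms it does not depend on \<open>k\<close> and is the semantics of the
  source language. An environment lists the values of the variables by index.\<close>

primrec sem ::
    "'op signature \<Rightarrow> 'f coding \<Rightarrow> enat \<Rightarrow> 'op tm \<Rightarrow> 'f val list \<Rightarrow> 'f val option" where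
  "sem S C k (TVar i) = (\<lambda>\<gamma>. Some (\<gamma> ! i))"
| "sem S C k (TLet t s) = (\<lambda>\<gamma>. Option.bind (sem S C k t \<gamma>) (\<lambda>a. sem S C k s (a # \<gamma>)))"
| "sem S C k (TConst c) = (\<lambda>\<gamma>. Some (VReal c))"
| "sem S C k (TOp f ts) = (\<lambda>\<gamma>. Option.bind (those (map (\<lambda>d. d \<gamma>) (map (sem S C k) ts)))
      (\<lambda>vs. map_option VReal (op_sem S f (map un_real vs))))"
| "sem S C k (TCaseZero \<tau> t) = (\<lambda>\<gamma>. Option.bind (sem S C k t \<gamma>) (\<lambda>_. None))"
| "sem S C k (TInl \<sigma> t) = (\<lambda>\<gamma>. map_option VInl (sem S C k t \<gamma>))"
| "sem S C k (TInr \<tau> t) = (\<lambda>\<gamma>. map_option VInr (sem S C k t \<gamma>))"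
| "sem S C k (TCaseSum r t s) = (\<lambda>\<gamma>. Option.bind (sem S C k r \<gamma>)
      (\<lambda>v. case v of VInl a \<Rightarrow> sem S C k t (a # \<gamma>) | VInr a \<Rightarrow> sem S C k s (a # \<gamma>) | _ \<Rightarrow> None))"
| "sem S C k TUnit = (\<lambda>\<gamma>. Some VUnit)"
| "sem S C k (TPair t s) = (\<lambda>\<gamma>. Option.bind (sem S C k t \<gamma>)
      (\<lambda>a. map_option (VPair a) (sem S C k s \<gamma>)))"
| "sem S C k (TCasePair r t) = (\<lambda>\<gamma>. Option.bind (sem S C k r \<gamma>)
      (\<lambda>v. case v of VPair a b \<Rightarrow> sem S C k t (a # b # \<gamma>) | _ \<Rightarrow> None))"
| "sem S C k (TLam \<tau> \<sigma> t) = (\<lambda>\<gamma>. Some (VFun (enc C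
      (\<lambda>a. if a \<in> carr (ty_cpo C k \<tau>) then sem S C k t (a # \<gamma>) else None))))"
| "sem S C k (TApp t s) = (\<lambda>\<gamma>. Option.bind (sem S C k t \<gamma>)
      (\<lambda>g. Option.bind (sem S C k s \<gamma>) (apply_val C g)))"
| "sem S C k (TSign t) = (\<lambda>\<gamma>. Option.bind (sem S C k t \<gamma>)
      (\<lambda>v. if un_real v < 0 then Some (VInl VUnit)
           else if un_real v > 0 then Some (VInr VUnit) else None))"
| "sem S C k (TIterate \<sigma> \<tau> t s) = (\<lambda>\<gamma>. Option.bind (sem S C k s \<gamma>)
      (iteration (ty_cpo C k \<sigma>) (ty_cpo C k \<tau>) (\<lambda>a. sem S C k t (a # \<gamma>))))"
| "sem S C k (TMu \<tau> \<sigma> t) = (\<lambda>\<gamma>. Some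
      (fixpoint C (ty_cpo C k \<tau>) (ty_cpo C k \<sigma>) (\<lambda>f. sem S C k t (f # \<gamma>))))"
| "sem S C k (TBasis i) = (\<lambda>\<gamma>. Some (VVect (\<lambda>j. if j = i \<and> enat i \<le> k then 1 else 0)))"
| "sem S C k TVZero = (\<lambda>\<gamma>. Some (VVect (\<lambda>j. 0)))"
| "sem S C k (TVAdd t s) = (\<lambda>\<gamma>. Option.bind (sem S C k t \<gamma>)
      (\<lambda>u. map_option (\<lambda>v. VVect (\<lambda>j. un_vect u j + un_vect v j)) (sem S C k s \<gamma>)))"
| "sem S C k (TVScale t s) = (\<lambda>\<gamma>. Option.bind (sem S C k t \<gamma>)
      (\<lambda>u. map_option (\<lambda>r. VVect (\<lambda>j. un_vect u j * un_real r)) (sem S C k s \<gamma>)))"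
| "sem S C k (TProj i t) = (\<lambda>\<gamma>. map_option (\<lambda>u. vect_tuple i (un_vect u)) (sem S C k t \<gamma>))"


section \<open>Differentiable maps between coproducts of Euclidean spaces\<close>

text \<open>\<open>\<real>\<^sup>n\<close> is the set of lists of length \<open>n\<close>. An element of a coproduct \<open>\<Coprod>\<^bsub>r\<in>K\<^esub> A\<^bsup>n r\<^esup>\<close> is a pair of
  an index and a list.\<close>

definition coprod :: "'i set \<Rightarrow> ('i \<Rightarrow> nat) \<Rightarrow> 'a set \<Rightarrow> ('i \<times> 'a list) set" where
  "coprod K n A = {(r, xs). r \<in> K \<and> length xs = n r \<and> set xs \<subseteq> A}"

definition eucl_dist :: "real list \<Rightarrow> real list \<Rightarrow> real" where
  "eucl_dist x y = L2_set (\<lambda>l. y ! l - x ! l) {..<length x}"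

definition open_Rn :: "nat \<Rightarrow> real list set \<Rightarrow> bool" where
  "open_Rn n W \<longleftrightarrow> W \<subseteq> {x. length x = n} \<and>
     (\<forall>x\<in>W. \<exists>e>0. \<forall>y. length y = n \<and> eucl_dist x y < e \<longrightarrow> y \<in> W)"

text \<open>Frechet differentiability at each point of \<open>W\<close>, with derivative the matrix \<open>A\<close>.\<close>

definition differentiable_Rn :: "nat \<Rightarrow> nat \<Rightarrow> real list set \<Rightarrow> (real list \<Rightarrow> real list) \<Rightarrow> bool" where
  "differentiable_Rn n m W f \<longleftrightarrow> (\<forall>x\<in>W. \<exists>A :: nat \<Rightarrow> nat \<Rightarrow> real. \<forall>e>0. \<exists>d>0. \<forall>y\<in>W.
     eucl_dist x y < d \<longrightarrow>
     L2_set (\<lambda>q. f y ! q - f x ! q - (\<Sum>l<n. A q l * (y ! l - x ! l))) {..<m} \<le> e * eucl_dist x y)"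

definition differentiable_map ::
    "'i set \<Rightarrow> ('i \<Rightarrow> nat) \<Rightarrow> 'j set \<Rightarrow> ('j \<Rightarrow> nat) \<Rightarrow>
     ('i \<times> real list \<Rightarrow> ('j \<times> real list) option) \<Rightarrow> bool" where
  "differentiable_map K n L m h \<longleftrightarrow>
     h ` coprod K n UNIV \<subseteq> insert None (Some ` coprod L m UNIV) \<and>
     (\<forall>i\<in>K. \<forall>j\<in>L. let W = {x. length x = n i \<and> (\<exists>y. h (i, x) = Some (j, y))} in
        open_Rn (n i) W \<and> differentiable_Rn (n i) (m j) W (\<lambda>x. snd (the (h (i, x)))))"

text \<open>\<open>\<partial>\<^sub>l f\<^sub>q (x)\<close> for \<open>f = h\<^sub>i\<close>. Where \<open>h\<close> is differentiable, the function under \<open>deriv\<close> is, near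
  \<open>x ! l\<close>, the \<open>q\<close>-th component of \<open>h\<close> in the summand of \<open>h (i, x)\<close>.\<close>

definition partial_deriv ::
    "('i \<times> real list \<Rightarrow> ('j \<times> real list) option) \<Rightarrow> 'i \<Rightarrow> nat \<Rightarrow> nat \<Rightarrow> real list \<Rightarrow> real" where
  "partial_deriv h i q l x = deriv (\<lambda>u. snd (the (h (i, x[l := u]))) ! q) (x ! l)"

text \<open>\<open>\<dd>\<^sup>k(h)\<close>; the index \<open>k\<close> only enters through the domain, which consists of the \<open>(i, ps)\<close> in
  \<open>coprod K n (UNIV \<times> vect_space k)\<close>.\<close>

definition dual_deriv ::
    "('i \<times> real list \<Rightarrow> ('j \<times> real list) option) \<Rightarrow>
     'i \<times> (real \<times> (nat \<Rightarrow> real)) list \<Rightarrow> ('j \<times> (real \<times> (nat \<Rightarrow> real)) list) option" where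
  "dual_deriv h = (\<lambda>(i, ps). let x = map fst ps in
     map_option (\<lambda>(j, y). (j, map (\<lambda>q. (y ! q,
         \<lambda>c. \<Sum>l<length ps. partial_deriv h i q l x * snd (ps ! l) c)) [0..<length y]))
       (h (i, x)))"


section \<open>Data types as coproducts\<close>

text \<open>Index sets \<open>K\<close> and exponents \<open>s\<^sub>r\<close> of the decomposition obtained from distributivity.\<close>

datatype shape = SAtom | SUnit | SInl shape | SInr shape | SPair shape shape

primrec (nonexhaustive) summands :: "ty \<Rightarrow> shape set" where
  "summands Real = {SAtom}"
| "summands Zero = {}"
| "summands One = {SUnit}"
| "summands (Sum \<tau> \<sigma>) = SInl ` summands \<tau> \<union> SInr ` summands \<sigma>"
| "summands (Prod \<tau> \<sigma>) = {SPair r s | r s. r \<in> summands \<tau> \<and> s \<in> summands \<sigma>}"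

primrec atoms :: "shape \<Rightarrow> nat" where
  "atoms SAtom = 1"
| "atoms SUnit = 0"
| "atoms (SInl r) = atoms r"
| "atoms (SInr r) = atoms r"
| "atoms (SPair r s) = atoms r + atoms s"

text \<open>The two directions of the canonical isomorphism. They are parametrised by how an atom, that is
  an element of the interpretation of \<open>Real\<close>, is read off from or turned into a value; thus one
  recipe serves \<open>\<lbrakk>\<tau>\<rbrakk>\<close> (atoms in \<open>\<real>\<close>) and \<open>\<lbrakk>\<D>(\<tau>)\<rbrakk>\<^sub>k\<close> (atoms in \<open>\<real> \<times> \<real>\<^sup>k\<close>).\<close>

primrec (nonexhaustive) to_coprod :: "('f val \<Rightarrow> 'a) \<Rightarrow> ty \<Rightarrow> 'f val \<Rightarrow> shape \<times> 'a list" where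
  "to_coprod rd Real v = (SAtom, [rd v])"
| "to_coprod rd One v = (SUnit, [])"
| "to_coprod rd (Sum \<tau> \<sigma>) v = (case v of
      VInl a \<Rightarrow> apfst SInl (to_coprod rd \<tau> a)
    | VInr b \<Rightarrow> apfst SInr (to_coprod rd \<sigma> b))"
| "to_coprod rd (Prod \<tau> \<sigma>) v = (case v of VPair a b \<Rightarrow>
      (case to_coprod rd \<tau> a of (r, xs) \<Rightarrow>
       case to_coprod rd \<sigma> b of (s, ys) \<Rightarrow> (SPair r s, xs @ ys)))"

primrec from_coprod :: "('a \<Rightarrow> 'f val) \<Rightarrow> shape \<Rightarrow> 'a list \<Rightarrow> 'f val" where
  "from_coprod mk SAtom xs = mk (hd xs)"
| "from_coprod mk SUnit xs = VUnit"
| "from_coprod mk (SInl r) xs = VInl (from_coprod mk r xs)"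
| "from_coprod mk (SInr r) xs = VInr (from_coprod mk r xs)"
| "from_coprod mk (SPair r s) xs =
     VPair (from_coprod mk r (take (atoms r) xs)) (from_coprod mk s (drop (atoms r) xs))"

definition mk_dual :: "real \<times> (nat \<Rightarrow> real) \<Rightarrow> 'f val" where
  "mk_dual = (\<lambda>(x, w). VPair (VReal x) (VVect w))"

definition un_dual :: "'f val \<Rightarrow> real \<times> (nat \<Rightarrow> real)" where
  "un_dual v = (case v of VPair a b \<Rightarrow> (un_real a, un_vect b))"

text \<open>A map \<open>\<lbrakk>\<tau>\<rbrakk> \<rightarrow> \<lbrakk>\<sigma>\<rbrakk>\<^sub>\<bottom>\<close>, respectively \<open>\<lbrakk>\<D>(\<tau>)\<rbrakk>\<^sub>k \<rightarrow> (\<lbrakk>\<D>(\<sigma>)\<rbrakk>\<^sub>k)\<^sub>\<bottom>\<close>, seen as a map between coproducts.\<close>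

definition real_map ::
    "ty \<Rightarrow> ('f val \<Rightarrow> 'f val option) \<Rightarrow> shape \<times> real list \<Rightarrow> (shape \<times> real list) option" where
  "real_map \<sigma> g = (\<lambda>(r, xs). map_option (to_coprod un_real \<sigma>) (g (from_coprod VReal r xs)))"

definition dual_map ::
    "ty \<Rightarrow> ('f val \<Rightarrow> 'f val option) \<Rightarrow>
     shape \<times> (real \<times> (nat \<Rightarrow> real)) list \<Rightarrow> (shape \<times> (real \<times> (nat \<Rightarrow> real)) list) option" where
  "dual_map \<sigma> g = (\<lambda>(r, ps). map_option (to_coprod un_dual \<sigma>) (g (from_coprod mk_dual r ps)))"


section \<open>Assumptions on the primitives\<close>

text \<open>\<open>\<lbrakk>f\<rbrakk>\<close> as a map between one-summand coproducts.\<close>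

definition op_map :: "'op signature \<Rightarrow> 'op \<Rightarrow> unit \<times> real list \<Rightarrow> (unit \<times> real list) option" where
  "op_map S f = (\<lambda>(_, xs). map_option (\<lambda>y. ((), [y])) (op_sem S f xs))"

definition wf_signature :: "'op signature \<Rightarrow> bool" where
  "wf_signature S \<longleftrightarrow> 0 \<in> consts_of S \<and>
     (\<forall>f. differentiable_map {()} (\<lambda>_. arity S f) {()} (\<lambda>_. 1) (op_map S f)) \<and>
     (\<forall>f. \<forall>i<arity S f. has_type S (replicate (arity S f) Real) (partial_op S f i) Real)"

definition AD_prim :: "'op signature \<Rightarrow> 'op \<Rightarrow> 'op tm" where
  "AD_prim S f = AD S (TOp f (map TVar [0..<arity S f]))"

text \<open>Soundness for primitives, for the primitives whose AD transform can be interpreted by means of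
  the coding, that is, only uses types of depth at most \<open>N\<close>.\<close>

definition sound_for_primitives :: "'op signature \<Rightarrow> 'f coding \<Rightarrow> nat \<Rightarrow> bool" where
  "sound_for_primitives S C N \<longleftrightarrow> (\<forall>f k. tm_depth (AD_prim S f) \<le> N \<longrightarrow>
     (\<forall>ps. length ps = arity S f \<and> set ps \<subseteq> UNIV \<times> vect_space k \<longrightarrow>
        map_option (\<lambda>v. ((), [un_dual v])) (sem S C k (AD_prim S f) (map mk_dual ps)) =
        dual_deriv (op_map S f) ((), ps)))"

end

theory Submission
  imports Defs
begin

text \<open>The proof is by a logical relation. Fix a point \<open>x\<close> of \<open>\<real>\<^sup>n\<close> and tangent vectors \<open>w\<^sub>1, \<dots>, w\<^sub>n\<close>. At
  every source type, relate the germs at \<open>x\<close> of families of elements of \<open>\<lbrakk>\<tau>\<rbrakk>\<close> to elements of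
  \<open>\<lbrakk>\<D>(\<tau>)\<rbrakk>\<^sub>k\<close>: at \<open>Real\<close> the germ is differentiable at \<open>x\<close> and the element is the pair of its value and
  of its derivative applied to the tangent vectors. At \<open>\<tau>\<^sub>\<bottom>\<close>, either both sides are \<open>\<bottom>\<close> at \<open>x\<close>, or the
  germ avoids \<open>\<bottom>\<close>. A germ can be shrunk freely, so the relation needs neither Kripke worlds nor
  gluing, and it is closed under suprema of \<open>\<omega>\<close>-chains because the first defined member of a
  chain fixes a neighbourhood that works for all later ones. Hence it is respected by iteration and
  recursion, which are Kleene suprema; at data types it says what the theorem claims.

  Kleene iteration needs that all denotations are continuous. Monotonicity and preservation of
  suprema are treated together: a map is a morphism iff it sends chains with their suprema to
  chains with their suprema.\<close>

section \<open>Suprema of chains\<close>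

text \<open>Two obstacles shape the details. A fixed coding represents function spaces only up to
  depth \<open>N\<close>, so everything is carried out for derivations whose types, before and after
  the transform, stay below that bound; soundness of a primitive is likewise available only below
  it. And the terms \<open>partial_op\<close> are arbitrary target terms: neither their continuity
  nor any relation for them is established. Soundness describes a primitive only when it is applied
  to variables, but the body of its transform has a value independent of the rest of the
  environment. This value is a semantic function, \<open>op_dual\<close>, and from then on the
  syntax of \<open>partial_op\<close> has disappeared.

  At \<open>Real\<close> the relation asks for some gradient \<open>A\<close>, not for partial
  derivatives, because gradients compose well under the chain rule; uniqueness of derivatives
  recovers the partial derivatives at the very end. Bottom at the point imposes nothing nearby
  because the domain of a differentiable map is open while its complement need not be.
  Differentiability itself does not mention tangent vectors and is read off from the relation for
  zero tangents.\<close>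

definition porder :: "'a poset \<Rightarrow> bool" where
  "porder P \<longleftrightarrow> (\<forall>a\<in>carr P. leq P a a) \<and>
     (\<forall>a\<in>carr P. \<forall>b\<in>carr P. leq P a b \<longrightarrow> leq P b a \<longrightarrow> a = b) \<and>
     (\<forall>a\<in>carr P. \<forall>b\<in>carr P. \<forall>c\<in>carr P. leq P a b \<longrightarrow> leq P b c \<longrightarrow> leq P a c)"

definition chain_sup :: "'a poset \<Rightarrow> (nat \<Rightarrow> 'a) \<Rightarrow> 'a \<Rightarrow> bool" where
  "chain_sup P X s \<longleftrightarrow> omega_chain P X \<and> is_sup P X s"

definition omega_cpo :: "'a poset \<Rightarrow> bool" where
  "omega_cpo P \<longleftrightarrow> porder P \<and> (\<forall>X. omega_chain P X \<longrightarrow> (\<exists>s. chain_sup P X s))"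

lemma porder_refl: "porder P \<Longrightarrow> a \<in> carr P \<Longrightarrow> leq P a a"
  and porder_antisym: "porder P \<Longrightarrow> leq P a b \<Longrightarrow> leq P b a \<Longrightarrow> a \<in> carr P \<Longrightarrow> b \<in> carr P \<Longrightarrow> a = b"
  and porder_trans: "porder P \<Longrightarrow> leq P a b \<Longrightarrow> leq P b c \<Longrightarrow> a \<in> carr P \<Longrightarrow> b \<in> carr P \<Longrightarrow> c \<in> carr P \<Longrightarrow> leq P a c"
  unfolding porder_def by blast+

lemma omega_cpo_porder: "omega_cpo P \<Longrightarrow> porder P"
  by (simp add: omega_cpo_def)

lemma chain_supI:
  assumes "\<And>n. X n \<in> carr P" "\<And>n. leq P (X n) (X (Suc n))" "s \<in> carr P" "\<And>n. leq P (X n) s"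
    "\<And>u. u \<in> carr P \<Longrightarrow> (\<And>n. leq P (X n) u) \<Longrightarrow> leq P s u"
  shows "chain_sup P X s"
  using assms by (auto simp: chain_sup_def omega_chain_def is_sup_def)

lemma chain_sup_in: "chain_sup P X s \<Longrightarrow> X n \<in> carr P"
  and chain_sup_carr: "chain_sup P X s \<Longrightarrow> s \<in> carr P"
  and chain_sup_step: "chain_sup P X s \<Longrightarrow> leq P (X n) (X (Suc n))"
  and chain_sup_upper: "chain_sup P X s \<Longrightarrow> leq P (X n) s"
  and chain_sup_least: "chain_sup P X s \<Longrightarrow> u \<in> carr P \<Longrightarrow> (\<And>n. leq P (X n) u) \<Longrightarrow> leq P s u"
  by (auto simp: chain_sup_def omega_chain_def is_sup_def)

lemmas chain_supD = chain_sup_in chain_sup_step chain_sup_carr chain_sup_upper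

lemma omega_chain_mono:
  assumes "porder P" "omega_chain P X" "m \<le> n"
  shows "leq P (X m) (X n)"
  using assms(3)
proof (induction rule: dec_induct)
  case base
  then show ?case using assms by (auto simp: omega_chain_def intro: porder_refl)
next
  case (step n)
  then show ?case using assms
    by (auto simp: omega_chain_def intro!: porder_trans[OF assms(1), of "X m" "X n" "X (Suc n)"])
qed

lemma chain_sup_mono: "porder P \<Longrightarrow> chain_sup P X s \<Longrightarrow> m \<le> n \<Longrightarrow> leq P (X m) (X n)"
  by (rule omega_chain_mono) (auto simp: chain_sup_def)

lemma chain_sup_unique:
  assumes "porder P" "chain_sup P X s" "chain_sup P X t"
  shows "s = t"
proof (rule porder_antisym[OF assms(1)])
  show "leq P s t" by (rule chain_sup_least[OF assms(2) chain_sup_carr[OF assms(3)] chain_sup_upper[OF assms(3)]])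
  show "leq P t s" by (rule chain_sup_least[OF assms(3) chain_sup_carr[OF assms(2)] chain_sup_upper[OF assms(2)]])
qed (use chain_sup_carr[OF assms(2)] chain_sup_carr[OF assms(3)] in auto)

lemma chain_sup_const: "porder P \<Longrightarrow> a \<in> carr P \<Longrightarrow> chain_sup P (\<lambda>_. a) a"
  by (rule chain_supI) (auto intro: porder_refl)

text \<open>A comparable pair counts as a chain with a supremum. This is how monotonicity follows
  from preservation of suprema alone, in \<open>sup_cont_mono\<close>.\<close>

lemma chain_sup_step_up:
  assumes "porder P" "a \<in> carr P" "b \<in> carr P" "leq P a b"
  shows "chain_sup P (\<lambda>n. if n = 0 then a else b) b"
proof (rule chain_supI)
  fix u assume "\<And>n::nat. leq P (if n = 0 then a else b) u"
  from this[of 1] show "leq P b u" by simp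
qed (use assms in \<open>auto intro: porder_refl\<close>)

lemma chain_sup_shift:
  assumes "porder P" "chain_sup P X s"
  shows "chain_sup P (\<lambda>n. X (n + N)) s"
proof (rule chain_supI)
  fix u assume u: "u \<in> carr P" "\<And>n. leq P (X (n + N)) u"
  have "leq P (X n) u" for n
    using porder_trans[OF assms(1) chain_sup_mono[OF assms, of n "n + N"] u(2)]
      chain_sup_in[OF assms(2)] u(1) by simp
  then show "leq P s u" using assms(2) u(1) by (rule chain_sup_least[rotated 2])
qed (use chain_supD[OF assms(2)] in simp_all)

text \<open>Truncated subtraction repeats \<open>X 0\<close> at the start. Delaying by
  \<open>N\<close> and then dropping \<open>N\<close> members gives back the chain, which lets two
  sequences be evaluated with indices that differ by \<open>N\<close>.\<close>

lemma chain_sup_delay: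
  assumes "porder P" "chain_sup P X s"
  shows "chain_sup P (\<lambda>n. X (n - N)) s"
proof (rule chain_supI)
  fix u assume u: "u \<in> carr P" "\<And>n. leq P (X (n - N)) u"
  show "leq P s u" using assms(2) u(1)
    by (rule chain_sup_least) (use u(2)[of "_ + N"] in simp)
next
  show "leq P (X (n - N)) (X (Suc n - N))" for n
    by (rule chain_sup_mono[OF assms]) simp
qed (use chain_sup_in[OF assms(2)] chain_sup_upper[OF assms(2)] chain_sup_carr[OF assms(2)] in simp_all)

text \<open>Iterated suprema commute. That \<open>Z\<close> increases is part of the conclusion: it
  is inherited from the chains in the first index. Both the continuity of pointwise suprema and the
  continuity of least fixed points rest on this.\<close>

lemma chain_sup_interchange:
  assumes P: "porder P" and Y: "\<And>m. chain_sup P (\<lambda>n. X n m) (Y m)"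
    and Z: "\<And>n. chain_sup P (\<lambda>m. X n m) (Z n)" and y: "chain_sup P Y y"
  shows "chain_sup P Z y"
proof (rule chain_supI)
  note c = chain_sup_carr[OF Y] chain_sup_carr[OF Z] chain_sup_carr[OF y] chain_sup_in[OF Z]
  show "leq P (Z n) (Z (Suc n))" for n
    by (rule chain_sup_least[OF Z c(2)],
        rule porder_trans[OF P chain_sup_step[OF Y] chain_sup_upper[OF Z]]) (use c in auto)
  show "leq P (Z n) y" for n
    by (rule chain_sup_least[OF Z c(3)],
        rule porder_trans[OF P chain_sup_upper[OF Y] chain_sup_upper[OF y]]) (use c in auto)
  show "leq P y u" if u: "u \<in> carr P" "\<And>n. leq P (Z n) u" for u
    by (rule chain_sup_least[OF y u(1)], rule chain_sup_least[OF Y u(1)],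
        rule porder_trans[OF P chain_sup_upper[OF Z] u(2)]) (use c u in auto)
qed (use chain_sup_carr[OF Z] chain_sup_carr[OF y] in auto)

text \<open>The diagonal is cofinal in the double chain: \<open>X n m\<close> lies below its member
  with index \<open>max n m\<close>.\<close>

lemma chain_sup_diagonal:
  assumes P: "porder P" and Y: "\<And>m. chain_sup P (\<lambda>n. X n m) (Y m)"
    and Z: "\<And>n. omega_chain P (\<lambda>m. X n m)" and y: "chain_sup P Y y"
  shows "chain_sup P (\<lambda>n. X n n) y"
proof (rule chain_supI)
  note c = chain_sup_carr[OF Y] chain_sup_carr[OF y] chain_sup_in[OF Y]
  have mono: "leq P (X n m) (X n' m')" if "n \<le> n'" "m \<le> m'" for n m n' m'
    by (rule porder_trans[OF P chain_sup_mono[OF P Y that(1)] omega_chain_mono[OF P Z that(2)]])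
      (use c in auto)
  show "leq P (X n n) (X (Suc n) (Suc n))" for n by (rule mono) auto
  show "leq P (X n n) y" for n
    by (rule porder_trans[OF P chain_sup_upper[OF Y] chain_sup_upper[OF y]]) (use c in auto)
  show "leq P y u" if u: "u \<in> carr P" "\<And>n. leq P (X n n) u" for u
  proof (rule chain_sup_least[OF y u(1)], rule chain_sup_least[OF Y u(1)])
    fix m n
    show "leq P (X n m) u"
      by (rule porder_trans[OF P mono[of n "max n m" m "max n m"] u(2)]) (use c u in auto)
  qed
qed (use chain_sup_in[OF Y] chain_sup_carr[OF y] in auto)

section \<open>Chains in the lifting, and continuity of Kleisli composition\<close>

lemma carr_lift [simp]: "carr (lift P) = insert None (Some ` carr P)"
  by (simp add: lift_def)

lemma leq_lift [simp]:
  "leq (lift P) None v" "leq (lift P) (Some a) None = False" "leq (lift P) (Some a) (Some b) = leq P a b"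
  by (simp_all add: lift_def)

lemma porder_lift: 
  assumes "porder P" shows "porder (lift P)"
  unfolding porder_def
proof (intro conjI ballI impI)
  fix a b c
  assume "a \<in> carr (lift P)" "b \<in> carr (lift P)" "c \<in> carr (lift P)"
    "leq (lift P) a b" "leq (lift P) b c"
  then show "leq (lift P) a c"
    by (cases a; cases b; cases c) (simp_all, metis image_iff option.inject porder_trans[OF assms])
next
  fix a b
  assume "a \<in> carr (lift P)" "b \<in> carr (lift P)" "leq (lift P) a b" "leq (lift P) b a"
  then show "a = b"
    by (cases a; cases b) (simp_all, metis image_iff option.inject porder_antisym[OF assms])
qed (use assms in \<open>auto intro: porder_refl\<close>)

lemma chain_sup_lift_None [simp]: "chain_sup (lift P) X None \<longleftrightarrow> (\<forall>n. X n = None)"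
proof
  assume *: "chain_sup (lift P) X None"
  show "\<forall>n. X n = None"
  proof
    fix n show "X n = None" using chain_sup_upper[OF *, of n] by (cases "X n") auto
  qed
next
  assume "\<forall>n. X n = None"
  then show "chain_sup (lift P) X None" by (intro chain_supI) simp_all
qed

text \<open>If all members were \<open>None\<close>, then \<open>None\<close> would be an upper
  bound strictly below \<open>Some s\<close>. So the chain leaves bottom at a first index
  \<open>N\<close>, and by monotonicity it never returns; the rest is a chain in \<open>P\<close>.
  Arguments about the lifting go through this normal form.\<close>

lemma chain_sup_lift_Some:
  assumes P: "porder P"
  shows "chain_sup (lift P) X (Some s) \<longleftrightarrow>
    (\<exists>N Y. chain_sup P Y s \<and> (\<forall>n<N. X n = None) \<and> (\<forall>n. X (n + N) = Some (Y n)))"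
proof
  assume X: "chain_sup (lift P) X (Some s)"
  have "\<exists>n. X n \<noteq> None"
  proof (rule ccontr)
    assume "\<not> (\<exists>n. X n \<noteq> None)"
    then have "leq (lift P) (Some s) None" by (intro chain_sup_least[OF X]) auto
    then show False by simp
  qed
  then obtain N where N: "X N \<noteq> None" "\<forall>n<N. X n = None"
    using exists_least_iff[of "\<lambda>n. X n \<noteq> None"] by auto
  have ne: "X (n + N) \<noteq> None" for n
    using chain_sup_mono[OF porder_lift[OF P] X, of N "n + N"] N(1)
    by (cases "X (n + N)"; cases "X N") auto
  define Y where "Y n = the (X (n + N))" for n
  have Y: "X (n + N) = Some (Y n)" for n using ne by (simp add: Y_def)
  have sh: "chain_sup (lift P) (\<lambda>n. Some (Y n)) (Some s)"
    using chain_sup_shift[OF porder_lift[OF P] X, of N] by (simp add: Y)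
  have "chain_sup P Y s"
  proof (rule chain_supI)
    fix u assume "u \<in> carr P" "\<And>n. leq P (Y n) u"
    then show "leq P s u" using chain_sup_least[OF sh, of "Some u"] by auto
  qed (use chain_supD[OF sh] in auto)
  then show "\<exists>N Y. chain_sup P Y s \<and> (\<forall>n<N. X n = None) \<and> (\<forall>n. X (n + N) = Some (Y n))"
    using N Y by blast
next
  assume "\<exists>N Y. chain_sup P Y s \<and> (\<forall>n<N. X n = None) \<and> (\<forall>n. X (n + N) = Some (Y n))"
  then obtain N Y where Y: "chain_sup P Y s" and X: "\<forall>n<N. X n = None" "\<And>n. X (n + N) = Some (Y n)"
    by blast
  have XN: "X n = (if n < N then None else Some (Y (n - N)))" for n
    using X(1) X(2)[of "n - N"] by auto
  show "chain_sup (lift P) X (Some s)"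
  proof (rule chain_supI)
    fix u assume u: "u \<in> carr (lift P)" "\<And>n. leq (lift P) (X n) u"
    from u(2)[of N] obtain v where v: "u = Some v" by (cases u) (auto simp: XN)
    show "leq (lift P) (Some s) u"
      using u(2)[of "_ + N"] u(1) by (auto simp: v X(2) intro!: chain_sup_least[OF Y])
  next
    fix n show "leq (lift P) (X n) (X (Suc n))"
      using chain_sup_step[OF Y, of "n - N"] by (auto simp: XN Suc_diff_le)
  qed (use chain_sup_in[OF Y] chain_sup_carr[OF Y] chain_sup_upper[OF Y] in \<open>auto simp: XN\<close>)
qed

lemma chain_sup_Some:
  "porder P \<Longrightarrow> chain_sup P Y s \<Longrightarrow> chain_sup (lift P) (\<lambda>n. Some (Y n)) (Some s)"
  unfolding chain_sup_lift_Some by (intro exI[of _ 0] exI[of _ Y]) simp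

lemma chain_sup_lift_prefix:
  assumes P: "porder P" and X: "\<And>n. n < N \<Longrightarrow> X n = None" and s: "chain_sup (lift P) (\<lambda>n. X (n + N)) s"
  shows "chain_sup (lift P) X s"
proof (cases s)
  case None
  have "X n = None" for n
    using s X[of n] by (cases "n < N") (auto simp: None dest: spec[of _ "n - N"])
  then show ?thesis by (simp add: None)
next
  case (Some t)
  then obtain M Y where "chain_sup P Y t" "\<forall>n<M. X (n + N) = None" "\<forall>n. X (n + M + N) = Some (Y n)"
    using s by (auto simp: chain_sup_lift_Some[OF P])
  moreover have "X n = None" if "n < M + N" for n
    using that calculation(2) X[of n] by (cases "n < N") (auto dest: spec[of _ "n - N"])
  ultimately show ?thesis
    unfolding Some chain_sup_lift_Some[OF P] by (intro exI[of _ "M + N"] exI[of _ Y]) (simp add: add.assoc)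
qed

lemma omega_cpo_lift:
  assumes "omega_cpo P" shows "omega_cpo (lift P)"
  unfolding omega_cpo_def
proof (intro conjI allI impI)
  note P = omega_cpo_porder[OF assms]
  show "porder (lift P)" by (rule porder_lift[OF P])
  fix X assume X: "omega_chain (lift P) X"
  show "\<exists>s. chain_sup (lift P) X s"
  proof (cases "\<forall>n. X n = None")
    case True
    then show ?thesis by (metis chain_sup_lift_None)
  next
    case False
    then obtain N where N: "X N \<noteq> None" "\<forall>n<N. X n = None"
      using exists_least_iff[of "\<lambda>n. X n \<noteq> None"] by auto
    have ne: "X (n + N) \<noteq> None" for n
      using omega_chain_mono[OF porder_lift[OF P] X, of N "n + N"] N(1)
      by (cases "X (n + N)"; cases "X N") auto
    define Y where "Y n = the (X (n + N))" for n
    have Y: "X (n + N) = Some (Y n)" for n using ne by (simp add: Y_def)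
    have "omega_chain P Y"
      unfolding omega_chain_def
    proof (intro conjI allI)
      have "Some (Y n) \<in> carr (lift P)" for n
        using X by (simp only: Y[symmetric]) (auto simp: omega_chain_def)
      then show "range Y \<subseteq> carr P" by auto
      have "leq (lift P) (X (n + N)) (X (Suc n + N))" for n
        using X by (auto simp: omega_chain_def)
      then show "leq P (Y n) (Y (Suc n))" for n unfolding Y by simp
    qed
    then obtain s where "chain_sup P Y s" using assms by (auto simp: omega_cpo_def)
    then have "chain_sup (lift P) X (Some s)"
      using N(2) Y by (auto simp: chain_sup_lift_Some[OF P])
    then show ?thesis ..
  qed
qed

text \<open>The continuation varies with the index as well, through the environment or the function
  applied. Once \<open>U\<close> is defined from index \<open>N\<close> on, its member
  \<open>V n\<close> meets the continuation \<open>K (n + N)\<close>; hence the offset in the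
  hypothesis.\<close>

lemma chain_sup_bind:
  assumes P: "porder P" and Q: "porder Q" and U: "chain_sup (lift P) U u"
    and K: "\<And>N V v. chain_sup P V v \<Longrightarrow> chain_sup (lift Q) (\<lambda>n. K (n + N) (V n)) (\<kappa> v)"
  shows "chain_sup (lift Q) (\<lambda>n. Option.bind (U n) (K n)) (Option.bind u \<kappa>)"
proof (cases u)
  case None
  then show ?thesis using U by simp
next
  case (Some v)
  then obtain N V where V: "chain_sup P V v" "\<forall>n<N. U n = None" "\<forall>n. U (n + N) = Some (V n)"
    using U by (auto simp: chain_sup_lift_Some[OF P])
  show ?thesis
    by (rule chain_sup_lift_prefix[OF Q, where N = N]) (use V K[OF V(1), of N] in \<open>auto simp: Some\<close>)
qed

section \<open>Discrete posets, coproducts and products\<close>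

lemma carr_discrete [simp]: "carr (discrete A) = A"
  by (simp add: discrete_def)

lemma porder_discrete: "porder (discrete A)"
  by (auto simp: porder_def discrete_def)

lemma chain_sup_discrete [simp]: "chain_sup (discrete A) X s \<longleftrightarrow> s \<in> A \<and> (\<forall>n. X n = s)"
proof
  assume X: "chain_sup (discrete A) X s"
  show "s \<in> A \<and> (\<forall>n. X n = s)"
    using chain_sup_carr[OF X] chain_sup_upper[OF X] by (simp add: discrete_def)
next
  assume "s \<in> A \<and> (\<forall>n. X n = s)"
  then show "chain_sup (discrete A) X s"
    by (intro chain_supI) (simp_all add: discrete_def)
qed

lemma omega_cpo_discrete: "omega_cpo (discrete A)"
  unfolding omega_cpo_def
proof (intro conjI allI impI)
  fix X assume X: "omega_chain (discrete A) X"
  then have "X n = X 0" for n by (induction n) (auto simp: omega_chain_def discrete_def)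
  moreover have "X 0 \<in> A" using X by (auto simp: omega_chain_def)
  ultimately show "\<exists>s. chain_sup (discrete A) X s" by (auto simp: chain_sup_discrete)
qed (rule porder_discrete)

lemma leq_sum_poset [simp]:
  "leq (sum_poset P Q) (VInl a) (VInl b) = leq P a b" "leq (sum_poset P Q) (VInr c) (VInr d) = leq Q c d"
  "leq (sum_poset P Q) (VInl a) (VInr d) = False" "leq (sum_poset P Q) (VInr c) (VInl b) = False"
  and carr_sum_poset: "carr (sum_poset P Q) = VInl ` carr P \<union> VInr ` carr Q"
  and leq_prod_poset [simp]:
  "leq (prod_poset P Q) (VPair a c) (VPair b d) \<longleftrightarrow> leq P a b \<and> leq Q c d"
  and carr_prod_poset: "carr (prod_poset P Q) = {VPair a b | a b. a \<in> carr P \<and> b \<in> carr Q}"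
  by (simp_all add: sum_poset_def prod_poset_def)

lemma porder_sum:
  assumes P: "porder P" and Q: "porder Q" shows "porder (sum_poset P Q)"
  unfolding porder_def
proof (intro conjI ballI impI)
  fix a b c assume *: "a \<in> carr (sum_poset P Q)" "b \<in> carr (sum_poset P Q)" "c \<in> carr (sum_poset P Q)"
    "leq (sum_poset P Q) a b" "leq (sum_poset P Q) b c"
  then show "leq (sum_poset P Q) a c"
    unfolding carr_sum_poset
    by (elim UnE imageE) (simp_all, metis porder_trans[OF P], metis porder_trans[OF Q])
next
  fix a b assume *: "a \<in> carr (sum_poset P Q)" "b \<in> carr (sum_poset P Q)"
    "leq (sum_poset P Q) a b" "leq (sum_poset P Q) b a"
  then show "a = b"
    unfolding carr_sum_poset
    by (elim UnE imageE) (simp_all, metis porder_antisym[OF P], metis porder_antisym[OF Q])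
next
  fix a assume "a \<in> carr (sum_poset P Q)"
  then show "leq (sum_poset P Q) a a"
    unfolding carr_sum_poset using porder_refl[OF P] porder_refl[OF Q] by (elim UnE imageE) simp_all
qed

lemma porder_prod:
  assumes P: "porder P" and Q: "porder Q" shows "porder (prod_poset P Q)"
  unfolding porder_def
proof (intro conjI ballI impI)
  fix a b c assume "a \<in> carr (prod_poset P Q)" "b \<in> carr (prod_poset P Q)" "c \<in> carr (prod_poset P Q)"
    and le: "leq (prod_poset P Q) a b" "leq (prod_poset P Q) b c"
  then obtain a1 a2 b1 b2 c1 c2 where *: "a = VPair a1 a2" "b = VPair b1 b2" "c = VPair c1 c2"
    "a1 \<in> carr P" "a2 \<in> carr Q" "b1 \<in> carr P" "b2 \<in> carr Q" "c1 \<in> carr P" "c2 \<in> carr Q"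
    unfolding carr_prod_poset by blast
  then show "leq (prod_poset P Q) a c"
    using le porder_trans[OF P, of a1 b1 c1] porder_trans[OF Q, of a2 b2 c2] by simp
next
  fix a b assume "a \<in> carr (prod_poset P Q)" "b \<in> carr (prod_poset P Q)"
    and le: "leq (prod_poset P Q) a b" "leq (prod_poset P Q) b a"
  then obtain a1 a2 b1 b2 where *: "a = VPair a1 a2" "b = VPair b1 b2"
    "a1 \<in> carr P" "a2 \<in> carr Q" "b1 \<in> carr P" "b2 \<in> carr Q"
    unfolding carr_prod_poset by blast
  then show "a = b"
    using le porder_antisym[OF P, of a1 b1] porder_antisym[OF Q, of a2 b2] by simp
next
  fix a assume "a \<in> carr (prod_poset P Q)"
  then show "leq (prod_poset P Q) a a"
    using porder_refl[OF P] porder_refl[OF Q] by (auto simp: carr_prod_poset)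
qed

text \<open>The hypothesis \<open>range\<close> says that the image of \<open>i\<close> is closed
  under comparability. Members of a chain lie below its supremum and upper bounds lie above its
  members, so neither can leave the image. Both coproduct injections have this property.\<close>

lemma chain_sup_embedding:
  assumes le: "\<And>a b. leq R (i a) (i b) = leq P a b" and carr: "\<And>a. i a \<in> carr R \<longleftrightarrow> a \<in> carr P"
    and range: "\<And>u a. u \<in> carr R \<Longrightarrow> leq R (i a) u \<or> leq R u (i a) \<Longrightarrow> u \<in> range i"
  shows "chain_sup R X (i s) \<longleftrightarrow> (\<exists>Y. X = (\<lambda>n. i (Y n)) \<and> chain_sup P Y s)"
proof
  assume X: "chain_sup R X (i s)"
  have "X n \<in> range i" for n using range[OF chain_sup_in[OF X]] chain_sup_upper[OF X] by blast
  then have "\<forall>n. \<exists>a. X n = i a" by blast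
  then obtain Y where Y: "X = (\<lambda>n. i (Y n))" by metis
  show "\<exists>Y. X = (\<lambda>n. i (Y n)) \<and> chain_sup P Y s"
  proof (intro exI conjI, rule Y, rule chain_supI)
    fix u assume "u \<in> carr P" "\<And>n. leq P (Y n) u"
    then show "leq P s u" using chain_sup_least[OF X, of "i u"] by (simp add: Y le carr)
  qed (use chain_supD[OF X] in \<open>simp_all add: Y le carr\<close>)
next
  assume "\<exists>Y. X = (\<lambda>n. i (Y n)) \<and> chain_sup P Y s"
  then obtain Y where Y: "X = (\<lambda>n. i (Y n))" "chain_sup P Y s" by blast
  show "chain_sup R X (i s)"
    unfolding Y(1)
  proof (rule chain_supI)
    fix u assume u: "u \<in> carr R" "\<And>n. leq R (i (Y n)) u"
    then obtain b where "u = i b" using range by blast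
    with u show "leq R (i s) u" by (auto simp: le carr intro!: chain_sup_least[OF Y(2)])
  qed (use chain_supD[OF Y(2)] in \<open>simp_all add: le carr\<close>)
qed

lemma chain_sup_sum_Inl:
  "chain_sup (sum_poset P Q) X (VInl s) \<longleftrightarrow> (\<exists>Y. X = (\<lambda>n. VInl (Y n)) \<and> chain_sup P Y s)"
  by (rule chain_sup_embedding) (auto simp: carr_sum_poset)

lemma chain_sup_sum_Inr:
  "chain_sup (sum_poset P Q) X (VInr s) \<longleftrightarrow> (\<exists>Y. X = (\<lambda>n. VInr (Y n)) \<and> chain_sup Q Y s)"
  by (rule chain_sup_embedding) (auto simp: carr_sum_poset)

lemma chain_sup_sum_cases:
  assumes "chain_sup (sum_poset P Q) X s"
  obtains (Inl) Y a where "X = (\<lambda>n. VInl (Y n))" "s = VInl a" "chain_sup P Y a"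
    | (Inr) Y a where "X = (\<lambda>n. VInr (Y n))" "s = VInr a" "chain_sup Q Y a"
  using chain_sup_carr[OF assms] assms
  by (auto simp: carr_sum_poset chain_sup_sum_Inl chain_sup_sum_Inr)

lemma omega_cpo_sum:
  assumes "omega_cpo P" "omega_cpo Q" shows "omega_cpo (sum_poset P Q)"
  unfolding omega_cpo_def
proof (intro conjI allI impI)
  note po = omega_cpo_porder[OF assms(1)] omega_cpo_porder[OF assms(2)]
  show po': "porder (sum_poset P Q)" using po by (rule porder_sum)
  fix X assume X: "omega_chain (sum_poset P Q) X"
  then have X_in: "X n \<in> carr (sum_poset P Q)" for n by (auto simp: omega_chain_def)
  have le: "leq (sum_poset P Q) (X 0) (X n)" for n by (rule omega_chain_mono[OF po' X]) simp
  consider a where "X 0 = VInl a" | a where "X 0 = VInr a"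
    using X_in[of 0] by (auto simp: carr_sum_poset)
  then show "\<exists>s. chain_sup (sum_poset P Q) X s"
  proof cases
    case 1
    then have "\<exists>a. X n = VInl a" for n using X_in[of n] le[of n] by (auto simp: carr_sum_poset)
    then obtain Y where Y: "X = (\<lambda>n. VInl (Y n))" by metis
    have "omega_chain P Y" using X by (auto simp: omega_chain_def Y carr_sum_poset)
    then show ?thesis using assms(1) unfolding Y omega_cpo_def by (metis chain_sup_sum_Inl)
  next
    case 2
    then have "\<exists>a. X n = VInr a" for n using X_in[of n] le[of n] by (auto simp: carr_sum_poset)
    then obtain Y where Y: "X = (\<lambda>n. VInr (Y n))" by metis
    have "omega_chain Q Y" using X by (auto simp: omega_chain_def Y carr_sum_poset)
    then show ?thesis using assms(2) unfolding Y omega_cpo_def by (metis chain_sup_sum_Inr)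
  qed
qed

lemma chain_sup_prod:
  "chain_sup (prod_poset P Q) (\<lambda>n. VPair (Y n) (Z n)) (VPair a b) \<longleftrightarrow> chain_sup P Y a \<and> chain_sup Q Z b"
proof
  assume X: "chain_sup (prod_poset P Q) (\<lambda>n. VPair (Y n) (Z n)) (VPair a b)"
  have c: "a \<in> carr P" "b \<in> carr Q" using chain_sup_carr[OF X] by (auto simp: carr_prod_poset)
  have u: "leq P (Y n) a" "leq Q (Z n) b" for n using chain_sup_upper[OF X, of n] by auto
  have "leq P a u" if "u \<in> carr P" "\<And>n. leq P (Y n) u" for u
    using chain_sup_least[OF X, of "VPair u b"] that c u by (auto simp: carr_prod_poset)
  moreover have "leq Q b v" if "v \<in> carr Q" "\<And>n. leq Q (Z n) v" for v
    using chain_sup_least[OF X, of "VPair a v"] that c u by (auto simp: carr_prod_poset)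
  ultimately show "chain_sup P Y a \<and> chain_sup Q Z b"
    using chain_sup_in[OF X] chain_sup_step[OF X] c u
    by (intro conjI chain_supI) (auto simp: carr_prod_poset)
next
  assume "chain_sup P Y a \<and> chain_sup Q Z b"
  then have Y: "chain_sup P Y a" and Z: "chain_sup Q Z b" by auto
  show "chain_sup (prod_poset P Q) (\<lambda>n. VPair (Y n) (Z n)) (VPair a b)"
  proof (rule chain_supI)
    fix u assume "u \<in> carr (prod_poset P Q)" "\<And>n. leq (prod_poset P Q) (VPair (Y n) (Z n)) u"
    then show "leq (prod_poset P Q) (VPair a b) u"
      by (auto simp: carr_prod_poset intro!: chain_sup_least[OF Y] chain_sup_least[OF Z])
  qed (use chain_supD[OF Y]
      chain_supD[OF Z]
      in \<open>auto simp: carr_prod_poset\<close>)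
qed

lemma chain_sup_prod_cases:
  assumes "chain_sup (prod_poset P Q) X s"
  obtains Y Z a b where "X = (\<lambda>n. VPair (Y n) (Z n))" "s = VPair a b" "chain_sup P Y a" "chain_sup Q Z b"
proof -
  have "\<exists>a b. X n = VPair a b" for n using chain_sup_in[OF assms, of n] by (auto simp: carr_prod_poset)
  note * = this
  define Y Z where "Y n = (case X n of VPair a b \<Rightarrow> a)" and "Z n = (case X n of VPair a b \<Rightarrow> b)" for n
  have "X n = VPair (Y n) (Z n)" for n using *[of n] by (auto simp: Y_def Z_def)
  then have "X = (\<lambda>n. VPair (Y n) (Z n))" by (rule ext)
  moreover obtain a b where "s = VPair a b" using chain_sup_carr[OF assms] by (auto simp: carr_prod_poset)
  ultimately show ?thesis using that[of Y Z a b] assms chain_sup_prod[of P Q Y Z a b] by simp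
qed

lemma omega_cpo_prod:
  assumes "omega_cpo P" "omega_cpo Q" shows "omega_cpo (prod_poset P Q)"
  unfolding omega_cpo_def
proof (intro conjI allI impI)
  show "porder (prod_poset P Q)" using assms by (intro porder_prod omega_cpo_porder)
  fix X assume X: "omega_chain (prod_poset P Q) X"
  then have "X n \<in> carr (prod_poset P Q)" for n by (auto simp: omega_chain_def)
  then have "\<exists>a b. X n = VPair a b" for n unfolding carr_prod_poset by blast
  note * = this
  define Y Z where "Y n = (case X n of VPair a b \<Rightarrow> a)" and "Z n = (case X n of VPair a b \<Rightarrow> b)" for n
  have "X n = VPair (Y n) (Z n)" for n using *[of n] by (auto simp: Y_def Z_def)
  then have YZ: "X = (\<lambda>n. VPair (Y n) (Z n))" by (rule ext)
  have "omega_chain P Y" "omega_chain Q Z" using X by (auto simp: omega_chain_def YZ carr_prod_poset)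
  then show "\<exists>s. chain_sup (prod_poset P Q) X s"
    using assms chain_sup_prod[of P Q Y Z] unfolding YZ omega_cpo_def by blast
qed

section \<open>Function spaces and fixed points\<close>

text \<open>With a constant sequence this is Scott continuity of \<open>b\<close>. With a varying
  one it is convergence of \<open>B\<close> to \<open>b\<close> tested along moving arguments; for
  elements of the exponential this coincides with being a supremum there
  (\<open>chain_sup_exp\<close>). One notion thus serves morphisms, function values and families of
  term bodies.\<close>

definition sup_cont :: "'a poset \<Rightarrow> 'b poset \<Rightarrow> (nat \<Rightarrow> 'a \<Rightarrow> 'b) \<Rightarrow> ('a \<Rightarrow> 'b) \<Rightarrow> bool" where
  "sup_cont P R B b \<longleftrightarrow> (\<forall>V v. chain_sup P V v \<longrightarrow> chain_sup R (\<lambda>n. B n (V n)) (b v))"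

lemma sup_contD: "sup_cont P R B b \<Longrightarrow> chain_sup P V v \<Longrightarrow> chain_sup R (\<lambda>n. B n (V n)) (b v)"
  by (simp add: sup_cont_def)

text \<open>The argument chain is delayed by \<open>N\<close> first, so that after dropping
  \<open>N\<close> members the function has moved ahead and the argument has not.\<close>

lemma sup_cont_shift:
  assumes P: "porder P" and R: "porder R" and B: "sup_cont P R B b" and V: "chain_sup P V v"
  shows "chain_sup R (\<lambda>n. B (n + N) (V n)) (b v)"
  using chain_sup_shift[OF R sup_contD[OF B chain_sup_delay[OF P V, of N]], of N] by simp

lemma sup_cont_carr:
  assumes P: "porder P" and B: "sup_cont P R B b" and a: "a \<in> carr P"
  shows "B n a \<in> carr R" and "b a \<in> carr R"
  using sup_contD[OF B chain_sup_const[OF P a]] by (auto dest: chain_sup_in chain_sup_carr)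

lemma sup_cont_mono:
  assumes P: "porder P" and B: "sup_cont P R (\<lambda>_. b) b"
    and a: "a \<in> carr P" and c: "c \<in> carr P" and le: "leq P a c"
  shows "leq R (b a) (b c)"
  using chain_sup_upper[OF sup_contD[OF B chain_sup_step_up[OF P a c le]], of 0] by simp

lemma morphism_iff_sup_cont:
  assumes P: "porder P"
  shows "morphism P R \<phi> \<longleftrightarrow> sup_cont P R (\<lambda>_. \<phi>) \<phi>"
proof
  assume m: "morphism P R \<phi>"
  show "sup_cont P R (\<lambda>_. \<phi>) \<phi>"
    unfolding sup_cont_def
  proof (intro allI impI)
    fix V v assume V: "chain_sup P V v"
    have "is_sup R (\<phi> \<circ> V) (\<phi> v)"
      using m V by (simp add: morphism_def chain_sup_def)
    moreover have "omega_chain R (\<phi> \<circ> V)"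
      using m chain_sup_in[OF V] chain_sup_step[OF V]
      by (auto simp: morphism_def omega_chain_def monotone_on_def)
    ultimately show "chain_sup R (\<lambda>n. \<phi> (V n)) (\<phi> v)"
      by (simp add: chain_sup_def o_def)
  qed
next
  assume c: "sup_cont P R (\<lambda>_. \<phi>) \<phi>"
  show "morphism P R \<phi>"
    unfolding morphism_def
  proof (intro conjI allI impI)
    show "\<phi> ` carr P \<subseteq> carr R" using sup_cont_carr(2)[OF P c] by auto
    show "monotone_on (carr P) (leq P) (leq R) \<phi>"
      using sup_cont_mono[OF P c] by (auto simp: monotone_on_def)
    fix X s assume "omega_chain P X" "is_sup P X s"
    then show "is_sup R (\<phi> \<circ> X) (\<phi> s)"
      using sup_contD[OF c, of X s] by (simp add: chain_sup_def o_def)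
  qed
qed

lemma kleisli_exp_iff:
  "porder P \<Longrightarrow> \<phi> \<in> carr (kleisli_exp P Q) \<longleftrightarrow>
    sup_cont P (lift Q) (\<lambda>_. \<phi>) \<phi> \<and> (\<forall>a. a \<notin> carr P \<longrightarrow> \<phi> a = None)"
  by (simp add: kleisli_exp_def morphism_iff_sup_cont)

lemma leq_kleisli_exp: "leq (kleisli_exp P Q) \<phi> \<psi> \<longleftrightarrow> (\<forall>a\<in>carr P. leq (lift Q) (\<phi> a) (\<psi> a))"
  by (simp add: kleisli_exp_def)

lemma kleisli_exp_app:
  assumes P: "porder P" and "\<phi> \<in> carr (kleisli_exp P Q)"
  shows "\<phi> a \<in> carr (lift Q)"
  using assms sup_cont_carr(2)[OF P, of "lift Q" "\<lambda>_. \<phi>" \<phi> a]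
  by (cases "a \<in> carr P") (simp_all add: kleisli_exp_iff[OF P])

lemma porder_exp:
  assumes P: "porder P" and Q: "porder Q" shows "porder (kleisli_exp P Q)"
  unfolding porder_def
proof (intro conjI ballI impI)
  note app = kleisli_exp_app[OF P]
  fix a b c assume "a \<in> carr (kleisli_exp P Q)" "b \<in> carr (kleisli_exp P Q)" "c \<in> carr (kleisli_exp P Q)"
    "leq (kleisli_exp P Q) a b" "leq (kleisli_exp P Q) b c"
  then show "leq (kleisli_exp P Q) a c"
    unfolding leq_kleisli_exp using app porder_trans[OF porder_lift[OF Q]] by blast
next
  note app = kleisli_exp_app[OF P]
  fix a b assume *: "a \<in> carr (kleisli_exp P Q)" "b \<in> carr (kleisli_exp P Q)"
    "leq (kleisli_exp P Q) a b" "leq (kleisli_exp P Q) b a"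
  show "a = b"
  proof
    fix x show "a x = b x"
    proof (cases "x \<in> carr P")
      case True
      then show ?thesis using * porder_antisym[OF porder_lift[OF Q] _ _ app app]
        by (simp add: leq_kleisli_exp)
    next
      \<comment> \<open>Off the carrier both maps are \<open>None\<close> by the convention of
        \<open>kleisli_exp\<close>; this is what makes the pointwise order antisymmetric.\<close>
      case False
      then show ?thesis using * by (simp add: kleisli_exp_iff[OF P])
    qed
  qed
next
  fix a assume "a \<in> carr (kleisli_exp P Q)"
  then show "leq (kleisli_exp P Q) a a"
    unfolding leq_kleisli_exp by (blast intro: porder_refl[OF porder_lift[OF Q]] kleisli_exp_app[OF P])
qed

text \<open>Each value sequence has a supremum because the lifting of \<open>Q\<close> is an
  omega-cpo. The resulting map is continuous because its value along a chain is an iterated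
  supremum, and the two suprema may be exchanged.\<close>

lemma exp_pointwise_sup:
  assumes P: "porder P" and Q: "omega_cpo Q" and F: "omega_chain (kleisli_exp P Q) F"
  obtains \<phi> where "\<phi> \<in> carr (kleisli_exp P Q)"
    "\<And>a. a \<in> carr P \<Longrightarrow> chain_sup (lift Q) (\<lambda>n. F n a) (\<phi> a)"
proof -
  note LQ = omega_cpo_lift[OF Q]
  have F_in: "F n \<in> carr (kleisli_exp P Q)" for n using F by (auto simp: omega_chain_def)
  have "\<exists>y. chain_sup (lift Q) (\<lambda>n. F n a) y" if "a \<in> carr P" for a
  proof -
    have "omega_chain (lift Q) (\<lambda>n. F n a)"
      unfolding omega_chain_def
    proof (intro conjI allI)
      show "range (\<lambda>n. F n a) \<subseteq> carr (lift Q)" using kleisli_exp_app[OF P F_in] by blast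
      show "leq (lift Q) (F n a) (F (Suc n) a)" for n
        using F that unfolding omega_chain_def leq_kleisli_exp by blast
    qed
    then show ?thesis using LQ unfolding omega_cpo_def by blast
  qed
  then have "\<forall>a. \<exists>y. a \<in> carr P \<longrightarrow> chain_sup (lift Q) (\<lambda>n. F n a) y" by blast
  then obtain f where f: "\<And>a. a \<in> carr P \<Longrightarrow> chain_sup (lift Q) (\<lambda>n. F n a) (f a)"
    using choice[of "\<lambda>a y. a \<in> carr P \<longrightarrow> chain_sup (lift Q) (\<lambda>n. F n a) y"] by blast
  define \<phi> where "\<phi> a = (if a \<in> carr P then f a else None)" for a
  have \<phi>: "chain_sup (lift Q) (\<lambda>n. F n a) (\<phi> a)" if "a \<in> carr P" for a
    using f that by (simp add: \<phi>_def)
  have "sup_cont P (lift Q) (\<lambda>_. \<phi>) \<phi>"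
    unfolding sup_cont_def
  proof (intro allI impI)
    fix V v assume V: "chain_sup P V v"
    show "chain_sup (lift Q) (\<lambda>n. \<phi> (V n)) (\<phi> v)"
    proof (rule chain_sup_interchange[OF omega_cpo_porder[OF LQ], where X = "\<lambda>n m. F m (V n)" and Y = "\<lambda>m. F m v"])
      show "chain_sup (lift Q) (\<lambda>n. F m (V n)) (F m v)" for m
        using F_in[of m] V by (auto simp: kleisli_exp_iff[OF P] intro: sup_contD)
    qed (use \<phi> chain_sup_in[OF V] chain_sup_carr[OF V] in auto)
  qed
  then have "\<phi> \<in> carr (kleisli_exp P Q)"
    by (simp add: kleisli_exp_iff[OF P] \<phi>_def)
  then show ?thesis using \<phi> that by blast
qed

text \<open>An abstract supremum is the pointwise one by antisymmetry: the pointwise supremum exists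
  in the exponential and lies both above and below it.\<close>

lemma chain_sup_exp_pointwise:
  assumes P: "porder P" and Q: "omega_cpo Q"
  shows "chain_sup (kleisli_exp P Q) X s \<longleftrightarrow> (\<forall>n. X n \<in> carr (kleisli_exp P Q)) \<and>
    s \<in> carr (kleisli_exp P Q) \<and> (\<forall>a\<in>carr P. chain_sup (lift Q) (\<lambda>n. X n a) (s a))"
proof
  note Q' = omega_cpo_porder[OF Q]
  assume X: "chain_sup (kleisli_exp P Q) X s"
  then obtain \<phi> where \<phi>: "\<phi> \<in> carr (kleisli_exp P Q)"
    "\<And>a. a \<in> carr P \<Longrightarrow> chain_sup (lift Q) (\<lambda>n. X n a) (\<phi> a)"
    using exp_pointwise_sup[OF P Q, of X] by (auto simp: chain_sup_def)
  have "leq (kleisli_exp P Q) s \<phi>"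
    by (rule chain_sup_least[OF X \<phi>(1)]) (auto simp: leq_kleisli_exp intro: chain_sup_upper[OF \<phi>(2)])
  moreover have "leq (kleisli_exp P Q) \<phi> s"
    unfolding leq_kleisli_exp
  proof
    fix a assume a: "a \<in> carr P"
    show "leq (lift Q) (\<phi> a) (s a)"
      by (rule chain_sup_least[OF \<phi>(2)[OF a] kleisli_exp_app[OF P chain_sup_carr[OF X]]])
        (use chain_sup_upper[OF X] a in \<open>simp add: leq_kleisli_exp\<close>)
  qed
  ultimately have "s = \<phi>"
    by (rule porder_antisym[OF porder_exp[OF P Q'] _ _ chain_sup_carr[OF X] \<phi>(1)])
  then show "(\<forall>n. X n \<in> carr (kleisli_exp P Q)) \<and>
    s \<in> carr (kleisli_exp P Q) \<and> (\<forall>a\<in>carr P. chain_sup (lift Q) (\<lambda>n. X n a) (s a))"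
    using \<phi> chain_sup_in[OF X] by blast
next
  assume *: "(\<forall>n. X n \<in> carr (kleisli_exp P Q)) \<and>
    s \<in> carr (kleisli_exp P Q) \<and> (\<forall>a\<in>carr P. chain_sup (lift Q) (\<lambda>n. X n a) (s a))"
  then have pw: "\<And>a. a \<in> carr P \<Longrightarrow> chain_sup (lift Q) (\<lambda>n. X n a) (s a)" by blast
  show "chain_sup (kleisli_exp P Q) X s"
  proof (rule chain_supI)
    fix u assume u: "u \<in> carr (kleisli_exp P Q)" "\<And>n. leq (kleisli_exp P Q) (X n) u"
    show "leq (kleisli_exp P Q) s u"
      unfolding leq_kleisli_exp
    proof
      fix a assume a: "a \<in> carr P"
      show "leq (lift Q) (s a) (u a)"
        by (rule chain_sup_least[OF pw[OF a] kleisli_exp_app[OF P u(1)]])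
          (use u(2) a in \<open>simp add: leq_kleisli_exp\<close>)
    qed
  qed (use * in \<open>auto simp: leq_kleisli_exp intro: chain_sup_step[OF pw] chain_sup_upper[OF pw]\<close>)
qed

lemma omega_cpo_exp:
  assumes P: "porder P" and Q: "omega_cpo Q" shows "omega_cpo (kleisli_exp P Q)"
  unfolding omega_cpo_def
proof (intro conjI allI impI)
  show "porder (kleisli_exp P Q)" by (rule porder_exp[OF P omega_cpo_porder[OF Q]])
  fix X assume X: "omega_chain (kleisli_exp P Q) X"
  obtain \<phi> where "\<phi> \<in> carr (kleisli_exp P Q)"
    "\<And>a. a \<in> carr P \<Longrightarrow> chain_sup (lift Q) (\<lambda>n. X n a) (\<phi> a)"
    using exp_pointwise_sup[OF P Q X] by blast
  then have "chain_sup (kleisli_exp P Q) X \<phi>"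
    using X by (auto simp: chain_sup_exp_pointwise[OF P Q] omega_chain_def)
  then show "\<exists>s. chain_sup (kleisli_exp P Q) X s" by blast
qed

text \<open>From pointwise to moving arguments by the diagonal of the double chain
  \<open>X n (V m)\<close>; back by testing on constant chains.\<close>

lemma chain_sup_exp:
  assumes P: "porder P" and Q: "omega_cpo Q"
  shows "chain_sup (kleisli_exp P Q) X s \<longleftrightarrow> (\<forall>n. X n \<in> carr (kleisli_exp P Q)) \<and>
    s \<in> carr (kleisli_exp P Q) \<and> sup_cont P (lift Q) X s"
proof
  assume "chain_sup (kleisli_exp P Q) X s"
  then have X: "\<And>n. X n \<in> carr (kleisli_exp P Q)" and s: "s \<in> carr (kleisli_exp P Q)"
    and pw: "\<And>a. a \<in> carr P \<Longrightarrow> chain_sup (lift Q) (\<lambda>n. X n a) (s a)"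
    by (simp_all add: chain_sup_exp_pointwise[OF P Q])
  have "sup_cont P (lift Q) X s"
    unfolding sup_cont_def
  proof (intro allI impI)
    fix V v assume V: "chain_sup P V v"
    show "chain_sup (lift Q) (\<lambda>n. X n (V n)) (s v)"
    proof (rule chain_sup_diagonal[OF porder_lift[OF omega_cpo_porder[OF Q]],
        where X = "\<lambda>n m. X n (V m)" and Y = "\<lambda>m. s (V m)"])
      show "chain_sup (lift Q) (\<lambda>n. X n (V m)) (s (V m))" for m
        by (rule pw[OF chain_sup_in[OF V]])
      show "omega_chain (lift Q) (\<lambda>m. X n (V m))" for n
        using X[of n] sup_contD[OF _ V, of "lift Q" "\<lambda>_. X n" "X n"]
        by (simp add: kleisli_exp_iff[OF P] chain_sup_def)
      show "chain_sup (lift Q) (\<lambda>m. s (V m)) (s v)"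
        using s sup_contD[OF _ V, of "lift Q" "\<lambda>_. s" s] by (simp add: kleisli_exp_iff[OF P])
    qed
  qed
  then show "(\<forall>n. X n \<in> carr (kleisli_exp P Q)) \<and>
    s \<in> carr (kleisli_exp P Q) \<and> sup_cont P (lift Q) X s" using X s by blast
next
  assume *: "(\<forall>n. X n \<in> carr (kleisli_exp P Q)) \<and>
    s \<in> carr (kleisli_exp P Q) \<and> sup_cont P (lift Q) X s"
  then show "chain_sup (kleisli_exp P Q) X s"
    using sup_contD[of P "lift Q" X s, OF _ chain_sup_const[OF P]]
    by (simp add: chain_sup_exp_pointwise[OF P Q])
qed

text \<open>The instance of \<open>codes\<close> at a single pair of posets. The theory of coded
  function spaces uses only this, so the depth bound enters just where the instance is
  obtained.\<close>

definition faithful :: "'f coding \<Rightarrow> 'f val poset \<Rightarrow> 'f val poset \<Rightarrow> bool" where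
  "faithful C P Q \<longleftrightarrow> (\<forall>\<phi>\<in>carr (kleisli_exp P Q). dec C (enc C \<phi>) = \<phi>)"

lemma apply_val_enc:
  "faithful C P Q \<Longrightarrow> \<phi> \<in> carr (kleisli_exp P Q) \<Longrightarrow> apply_val C (VFun (enc C \<phi>)) = \<phi>"
  by (rule ext) (simp add: faithful_def)

lemma carr_fun_iff:
  assumes "faithful C P Q"
  shows "v \<in> carr (fun_poset C P Q) \<longleftrightarrow>
    apply_val C v \<in> carr (kleisli_exp P Q) \<and> v = VFun (enc C (apply_val C v))"
  using apply_val_enc[OF assms] by (auto simp: fun_poset_def)

lemma enc_in_fun:
  "\<phi> \<in> carr (kleisli_exp P Q) \<Longrightarrow> VFun (enc C \<phi>) \<in> carr (fun_poset C P Q)"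
  by (auto simp: fun_poset_def)

lemma leq_fun_iff:
  assumes "faithful C P Q" "u \<in> carr (fun_poset C P Q)" "v \<in> carr (fun_poset C P Q)"
  shows "leq (fun_poset C P Q) u v \<longleftrightarrow> leq (kleisli_exp P Q) (apply_val C u) (apply_val C v)"
proof -
  obtain \<phi> \<psi> where "u = VFun (enc C \<phi>)" "v = VFun (enc C \<psi>)"
    "\<phi> \<in> carr (kleisli_exp P Q)" "\<psi> \<in> carr (kleisli_exp P Q)"
    using assms by (auto simp: fun_poset_def)
  then show ?thesis
    using apply_val_enc[OF assms(1)] assms(1) by (simp add: fun_poset_def faithful_def)
qed

lemma chain_sup_fun_iff:
  assumes f: "faithful C P Q"
  shows "chain_sup (fun_poset C P Q) X s \<longleftrightarrow> (\<forall>n. X n \<in> carr (fun_poset C P Q)) \<and>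
    s \<in> carr (fun_poset C P Q) \<and> chain_sup (kleisli_exp P Q) (\<lambda>n. apply_val C (X n)) (apply_val C s)"
proof (cases "(\<forall>n. X n \<in> carr (fun_poset C P Q)) \<and> s \<in> carr (fun_poset C P Q)")
  case True
  then have X: "\<And>n. X n \<in> carr (fun_poset C P Q)" and s: "s \<in> carr (fun_poset C P Q)" by auto
  \<comment> \<open>Decoding maps the coded elements onto the whole exponential, so quantifying over
    upper bounds means the same on both sides.\<close>
  have all: "(\<forall>u\<in>carr (fun_poset C P Q). R (apply_val C u)) \<longleftrightarrow> (\<forall>\<phi>\<in>carr (kleisli_exp P Q). R \<phi>)" for R
    using apply_val_enc[OF f] carr_fun_iff[OF f] enc_in_fun by metis
  have "is_sup (fun_poset C P Q) X s \<longleftrightarrow> (\<forall>n. leq (kleisli_exp P Q) (apply_val C (X n)) (apply_val C s)) \<and>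
     (\<forall>u\<in>carr (fun_poset C P Q). (\<forall>n. leq (kleisli_exp P Q) (apply_val C (X n)) (apply_val C u)) \<longrightarrow>
        leq (kleisli_exp P Q) (apply_val C s) (apply_val C u))"
    by (simp add: is_sup_def X s leq_fun_iff[OF f] cong: ball_cong)
  also have "\<dots> \<longleftrightarrow> is_sup (kleisli_exp P Q) (\<lambda>n. apply_val C (X n)) (apply_val C s)"
    using s all[of "\<lambda>\<phi>. (\<forall>n. leq (kleisli_exp P Q) (apply_val C (X n)) \<phi>) \<longrightarrow>
        leq (kleisli_exp P Q) (apply_val C s) \<phi>"] carr_fun_iff[OF f]
    by (auto simp: is_sup_def)
  finally show ?thesis
    using X s carr_fun_iff[OF f]
    by (auto simp: chain_sup_def omega_chain_def leq_fun_iff[OF f X X])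
next
  case False
  then show ?thesis by (auto dest: chain_sup_in chain_sup_carr)
qed

lemma chain_sup_fun:
  assumes "faithful C P Q" "porder P" "omega_cpo Q"
  shows "chain_sup (fun_poset C P Q) X s \<longleftrightarrow> (\<forall>n. X n \<in> carr (fun_poset C P Q)) \<and>
    s \<in> carr (fun_poset C P Q) \<and> sup_cont P (lift Q) (\<lambda>n. apply_val C (X n)) (apply_val C s)"
  unfolding chain_sup_fun_iff[OF assms(1)] chain_sup_exp[OF assms(2,3)]
  using carr_fun_iff[OF assms(1)] by blast

lemma fun_ext:
  assumes f: "faithful C P Q" and P: "porder P"
    and u: "u \<in> carr (fun_poset C P Q)" and v: "v \<in> carr (fun_poset C P Q)"
    and eq: "\<And>a. a \<in> carr P \<Longrightarrow> apply_val C u a = apply_val C v a"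
  shows "u = v"
proof -
  have "apply_val C u = apply_val C v"
  proof
    fix a show "apply_val C u a = apply_val C v a"
      using u v eq by (cases "a \<in> carr P") (simp_all add: carr_fun_iff[OF f] kleisli_exp_iff[OF P])
  qed
  then show ?thesis using u v carr_fun_iff[OF f] by metis
qed

lemma porder_fun:
  assumes f: "faithful C P Q" and P: "porder P" and Q: "porder Q" shows "porder (fun_poset C P Q)"
  unfolding porder_def
proof (intro conjI ballI impI)
  note c = carr_fun_iff[OF f, THEN iffD1, THEN conjunct1]
  fix a b d assume *: "a \<in> carr (fun_poset C P Q)" "b \<in> carr (fun_poset C P Q)" "d \<in> carr (fun_poset C P Q)"
    "leq (fun_poset C P Q) a b" "leq (fun_poset C P Q) b d"
  then show "leq (fun_poset C P Q) a d"
    using porder_trans[OF porder_exp[OF P Q] _ _ c c c] by (simp add: leq_fun_iff[OF f])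
next
  note c = carr_fun_iff[OF f, THEN iffD1, THEN conjunct1]
  fix a b assume *: "a \<in> carr (fun_poset C P Q)" "b \<in> carr (fun_poset C P Q)"
    "leq (fun_poset C P Q) a b" "leq (fun_poset C P Q) b a"
  then have "apply_val C a = apply_val C b"
    using porder_antisym[OF porder_exp[OF P Q] _ _ c c] by (simp add: leq_fun_iff[OF f])
  then show "a = b" using fun_ext[OF f P *(1,2)] by simp
next
  fix a assume "a \<in> carr (fun_poset C P Q)"
  then show "leq (fun_poset C P Q) a a"
    using porder_refl[OF porder_exp[OF P Q]] carr_fun_iff[OF f] by (simp add: leq_fun_iff[OF f])
qed

lemma omega_cpo_fun:
  assumes f: "faithful C P Q" and P: "porder P" and Q: "omega_cpo Q"
  shows "omega_cpo (fun_poset C P Q)"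
  unfolding omega_cpo_def
proof (intro conjI allI impI)
  show "porder (fun_poset C P Q)" by (rule porder_fun[OF f P omega_cpo_porder[OF Q]])
  fix X assume X: "omega_chain (fun_poset C P Q) X"
  then have X_in: "X n \<in> carr (fun_poset C P Q)" for n by (auto simp: omega_chain_def)
  then have "omega_chain (kleisli_exp P Q) (\<lambda>n. apply_val C (X n))"
    using X carr_fun_iff[OF f] leq_fun_iff[OF f] by (auto simp: omega_chain_def)
  then obtain \<phi> where \<phi>: "chain_sup (kleisli_exp P Q) (\<lambda>n. apply_val C (X n)) \<phi>"
    using omega_cpo_exp[OF P Q] unfolding omega_cpo_def by blast
  then have "chain_sup (fun_poset C P Q) X (VFun (enc C \<phi>))"
    using X_in chain_sup_carr[OF \<phi>] apply_val_enc[OF f]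
    by (simp add: chain_sup_fun_iff[OF f] enc_in_fun)
  then show "\<exists>s. chain_sup (fun_poset C P Q) X s" by blast
qed

section \<open>Kleene fixed points, iteration and recursion\<close>

definition bottom :: "'a poset \<Rightarrow> 'a \<Rightarrow> bool" where
  "bottom D b \<longleftrightarrow> b \<in> carr D \<and> (\<forall>a\<in>carr D. leq D b a)"

text \<open>The supremum of the iterates from the bottom element is a fixed point by continuity and
  lies below every fixed point by induction on the iterates. Since \<open>least_in\<close> is a
  definite description, uniqueness by antisymmetry is needed as well.\<close>

lemma kleene_lfp:
  assumes D: "omega_cpo D" and b: "bottom D b" and \<Phi>: "sup_cont D D (\<lambda>_. \<Phi>) \<Phi>"
  shows "chain_sup D (\<lambda>m. (\<Phi> ^^ m) b) (least_in D {x \<in> carr D. \<Phi> x = x})"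
proof -
  note po = omega_cpo_porder[OF D]
  note \<Phi>_in = sup_cont_carr(2)[OF po \<Phi>]
  have in_D: "(\<Phi> ^^ m) b \<in> carr D" for m
    by (induction m) (use b \<Phi>_in in \<open>auto simp: bottom_def\<close>)
  have "leq D ((\<Phi> ^^ m) b) ((\<Phi> ^^ Suc m) b)" for m
  proof (induction m)
    case 0
    then show ?case using b in_D[of 1] by (simp add: bottom_def)
  next
    case (Suc m)
    then show ?case using sup_cont_mono[OF po \<Phi> in_D[of m] in_D[of "Suc m"]] by simp
  qed
  then have "omega_chain D (\<lambda>m. (\<Phi> ^^ m) b)" using in_D by (auto simp: omega_chain_def)
  then obtain s where s: "chain_sup D (\<lambda>m. (\<Phi> ^^ m) b) s" using D unfolding omega_cpo_def by blast
  \<comment> \<open>The image of the chain of iterates is the same chain without its first member,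
    so both have the supremum \<open>s\<close>.\<close>
  have fixed: "\<Phi> s = s"
    using chain_sup_unique[OF po sup_contD[OF \<Phi> s]] chain_sup_shift[OF po s, of 1] by simp
  have least: "leq D s x" if x: "x \<in> carr D" "\<Phi> x = x" for x
  proof (rule chain_sup_least[OF s x(1)])
    fix m show "leq D ((\<Phi> ^^ m) b) x"
    proof (induction m)
      case 0
      then show ?case using b x by (simp add: bottom_def)
    next
      case (Suc m)
      then show ?case using sup_cont_mono[OF po \<Phi> in_D x(1)] x(2) by simp
    qed
  qed
  have "least_in D {x \<in> carr D. \<Phi> x = x} = s"
    unfolding least_in_def
  proof (rule the_equality)
    fix a assume a: "a \<in> {x \<in> carr D. \<Phi> x = x} \<and> (\<forall>x\<in>{x \<in> carr D. \<Phi> x = x}. leq D a x)"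
    then show "a = s"
      using porder_antisym[OF po, of a s] least chain_sup_carr[OF s] fixed by blast
  qed (use fixed least chain_sup_carr[OF s] in auto)
  then show ?thesis using s by simp
qed

text \<open>For every fixed \<open>m\<close> the \<open>m\<close>-fold iterates converge by
  induction on \<open>m\<close>; exchanging the suprema over \<open>m\<close> and \<open>n\<close>
  gives convergence of the least fixed points.\<close>

lemma kleene_lfp_cont:
  assumes D: "omega_cpo D" and b: "bottom D b"
    and "\<And>n. sup_cont D D (\<lambda>_. F n) (F n)" and "sup_cont D D (\<lambda>_. \<Phi>) \<Phi>" and F: "sup_cont D D F \<Phi>"
  shows "chain_sup D (\<lambda>n. least_in D {x \<in> carr D. F n x = x}) (least_in D {x \<in> carr D. \<Phi> x = x})"
proof (rule chain_sup_interchange[OF omega_cpo_porder[OF D],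
    where X = "\<lambda>n m. (F n ^^ m) b" and Y = "\<lambda>m. (\<Phi> ^^ m) b"])
  fix m show "chain_sup D (\<lambda>n. (F n ^^ m) b) ((\<Phi> ^^ m) b)"
  proof (induction m)
    case 0
    then show ?case using b chain_sup_const[OF omega_cpo_porder[OF D]] by (simp add: bottom_def)
  next
    case (Suc m)
    then show ?case using sup_contD[OF F] by simp
  qed
qed (use kleene_lfp[OF D b] assms in auto)

text \<open>The functional whose least fixed point is the loop. It is cut off to \<open>None\<close>
  outside \<open>P\<close>, so that it maps \<open>kleisli_exp P Q\<close> into itself.\<close>

definition iter_step ::
    "'f val poset \<Rightarrow> ('f val \<Rightarrow> 'f val option) \<Rightarrow> ('f val \<Rightarrow> 'f val option) \<Rightarrow> 'f val \<Rightarrow> 'f val option" where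
  "iter_step P b h = (\<lambda>a. if a \<in> carr P then Option.bind (b a)
     (\<lambda>v. case v of VInl a' \<Rightarrow> h a' | VInr w \<Rightarrow> Some w | _ \<Rightarrow> None) else None)"

lemma sup_cont_iter_step:
  assumes P: "porder P" and Q: "porder Q"
    and B: "sup_cont P (lift (sum_poset P Q)) B b" and H: "sup_cont P (lift Q) H h"
  shows "sup_cont P (lift Q) (\<lambda>n. iter_step P (B n) (H n)) (iter_step P b h)"
  unfolding sup_cont_def
proof (intro allI impI)
  fix V v assume V: "chain_sup P V v"
  let ?c = "\<lambda>h v. case v of VInl a' \<Rightarrow> h a' | VInr w \<Rightarrow> Some w | _ \<Rightarrow> None"
  have "chain_sup (lift Q) (\<lambda>n. Option.bind (B n (V n)) (?c (H n))) (Option.bind (b v) (?c h))"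
  proof (rule chain_sup_bind[OF porder_sum[OF P Q] Q sup_contD[OF B V]])
    fix N U u assume "chain_sup (sum_poset P Q) U u"
    then show "chain_sup (lift Q) (\<lambda>n. ?c (H (n + N)) (U n)) (?c h u)"
      by (cases rule: chain_sup_sum_cases)
        (simp_all add: sup_cont_shift[OF P porder_lift[OF Q] H] chain_sup_Some[OF Q])
  qed
  then show "chain_sup (lift Q) (\<lambda>n. iter_step P (B n) (H n) (V n)) (iter_step P b h v)"
    using chain_sup_in[OF V] chain_sup_carr[OF V] by (simp add: iter_step_def)
qed

lemma bottom_exp: "porder P \<Longrightarrow> porder Q \<Longrightarrow> bottom (kleisli_exp P Q) (\<lambda>_. None)"
  by (simp add: bottom_def kleisli_exp_iff leq_kleisli_exp sup_cont_def)

lemma iter_step_exp: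
  assumes P: "porder P" and Q: "omega_cpo Q"
    and B: "sup_cont P (lift (sum_poset P Q)) B b"
    and Bn: "\<And>n. sup_cont P (lift (sum_poset P Q)) (\<lambda>_. B n) (B n)"
    and b: "sup_cont P (lift (sum_poset P Q)) (\<lambda>_. b) b"
  shows "sup_cont (kleisli_exp P Q) (kleisli_exp P Q) (\<lambda>n. iter_step P (B n)) (iter_step P b)"
  unfolding sup_cont_def
proof (intro allI impI)
  note Q' = omega_cpo_porder[OF Q]
  have mem: "iter_step P b h \<in> carr (kleisli_exp P Q)"
    if "sup_cont P (lift (sum_poset P Q)) (\<lambda>_. b) b" "h \<in> carr (kleisli_exp P Q)" for b h
    using sup_cont_iter_step[OF P Q' that(1), of "\<lambda>_. h" h] that(2)
    by (simp add: kleisli_exp_iff[OF P]) (simp add: iter_step_def)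
  fix H h assume "chain_sup (kleisli_exp P Q) H h"
  then show "chain_sup (kleisli_exp P Q) (\<lambda>n. iter_step P (B n) (H n)) (iter_step P b h)"
    using mem Bn b sup_cont_iter_step[OF P Q' B] unfolding chain_sup_exp[OF P Q] by blast
qed

text \<open>The loop equations are required only on the carrier of \<open>P\<close>. Outside it both
  sides are \<open>None\<close>, so for elements of the exponential they amount to an equation
  between functions.\<close>

lemma iteration_eq:
  assumes P: "porder P"
  shows "iteration P Q b = least_in (kleisli_exp P Q) {h \<in> carr (kleisli_exp P Q). iter_step P b h = h}"
proof -
  have "(\<forall>a\<in>carr P. h a = (case b a of Some (VInl a') \<Rightarrow> h a' | Some (VInr v) \<Rightarrow> Some v | _ \<Rightarrow> None)) \<longleftrightarrow>
      iter_step P b h = h" if "h \<in> carr (kleisli_exp P Q)" for h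
  proof -
    have "Option.bind (b a) (\<lambda>v. case v of VInl a' \<Rightarrow> h a' | VInr w \<Rightarrow> Some w | _ \<Rightarrow> None) =
      (case b a of Some (VInl a') \<Rightarrow> h a' | Some (VInr v) \<Rightarrow> Some v | _ \<Rightarrow> None)" for a
      by (cases "b a") (auto split: val.splits)
    then show ?thesis using that by (auto simp: iter_step_def fun_eq_iff kleisli_exp_iff[OF P])
  qed
  then show ?thesis unfolding iteration_def by (intro arg_cong[where f = "least_in _"] Collect_cong) blast
qed

lemma iteration_chain_sup:
  assumes P: "porder P" and Q: "omega_cpo Q" and b: "sup_cont P (lift (sum_poset P Q)) (\<lambda>_. b) b"
  shows "chain_sup (kleisli_exp P Q) (\<lambda>m. (iter_step P b ^^ m) (\<lambda>_. None)) (iteration P Q b)"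
  unfolding iteration_eq[OF P]
  by (rule kleene_lfp[OF omega_cpo_exp[OF P Q] bottom_exp[OF P omega_cpo_porder[OF Q]] iter_step_exp[OF P Q b b b]])

lemma iteration_cont:
  assumes P: "porder P" and Q: "omega_cpo Q"
    and B: "sup_cont P (lift (sum_poset P Q)) B b"
    and Bn: "\<And>n. sup_cont P (lift (sum_poset P Q)) (\<lambda>_. B n) (B n)"
    and b: "sup_cont P (lift (sum_poset P Q)) (\<lambda>_. b) b"
  shows "chain_sup (kleisli_exp P Q) (\<lambda>n. iteration P Q (B n)) (iteration P Q b)"
  unfolding iteration_eq[OF P]
  by (rule kleene_lfp_cont[OF omega_cpo_exp[OF P Q] bottom_exp[OF P omega_cpo_porder[OF Q]]
    iter_step_exp[OF P Q Bn Bn Bn] iter_step_exp[OF P Q b b b] iter_step_exp[OF P Q B Bn b]])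

text \<open>The recursion equation describes applications of a function value, while Kleene
  iteration needs a self-map of the function space. A body with value bottom is therefore read as
  the code of the nowhere defined function, whose applications are all bottom.\<close>

definition fix_step :: "'f coding \<Rightarrow> ('f val \<Rightarrow> 'f val option) \<Rightarrow> 'f val \<Rightarrow> 'f val" where
  "fix_step C b f = (case b f of None \<Rightarrow> VFun (enc C (\<lambda>_. None)) | Some g \<Rightarrow> g)"

lemma bottom_fun:
  assumes "faithful C P Q" "porder P" "porder Q"
  shows "bottom (fun_poset C P Q) (VFun (enc C (\<lambda>_. None)))"
proof -
  have n: "(\<lambda>_. None) \<in> carr (kleisli_exp P Q)" using bottom_exp[OF assms(2,3)] by (simp add: bottom_def)
  show ?thesis
    using leq_fun_iff[OF assms(1) enc_in_fun[OF n]] apply_val_enc[OF assms(1) n]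
    by (simp add: bottom_def enc_in_fun[OF n] leq_kleisli_exp)
qed

text \<open>A poset with bottom is an algebra of the lifting monad; this is the continuity of its
  structure map. While \<open>U\<close> is undefined the new chain waits at
  \<open>b\<close>.\<close>

lemma chain_sup_lift_default:
  assumes D: "porder D" and b: "bottom D b" and U: "chain_sup (lift D) U u"
  shows "chain_sup D (\<lambda>n. case U n of None \<Rightarrow> b | Some g \<Rightarrow> g) (case u of None \<Rightarrow> b | Some g \<Rightarrow> g)"
proof (cases u)
  case None
  then show ?thesis using U b chain_sup_const[OF D] by (simp add: bottom_def)
next
  case (Some s)
  then obtain N Y where Y: "chain_sup D Y s" "\<forall>n<N. U n = None" "\<forall>n. U (n + N) = Some (Y n)"
    using U by (auto simp: chain_sup_lift_Some[OF D])
  have eq: "(case U n of None \<Rightarrow> b | Some g \<Rightarrow> g) = (if n < N then b else Y (n - N))" for n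
  proof (cases "n < N")
    case False
    then show ?thesis using Y(3)[rule_format, of "n - N"] by simp
  qed (use Y(2) in simp)
  have "chain_sup D (\<lambda>n. if n < N then b else Y (n - N)) s"
  proof (rule chain_supI)
    fix n show "leq D (if n < N then b else Y (n - N)) (if Suc n < N then b else Y (Suc n - N))"
      using b chain_sup_step[OF Y(1), of "n - N"] chain_sup_in[OF Y(1)] by (auto simp: bottom_def Suc_diff_le)
  next
    fix v assume v: "v \<in> carr D" "\<And>n. leq D (if n < N then b else Y (n - N)) v"
    show "leq D s v" by (rule chain_sup_least[OF Y(1) v(1)]) (use v(2)[of "_ + N"] in simp)
  qed (use b chain_sup_in[OF Y(1)] chain_sup_carr[OF Y(1)] chain_sup_upper[OF Y(1)] in \<open>auto simp: bottom_def\<close>)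
  then show ?thesis unfolding eq by (simp add: Some)
qed

lemma sup_cont_fix_step:
  assumes f: "faithful C P Q" and P: "porder P" and Q: "porder Q"
    and B: "sup_cont (fun_poset C P Q) (lift (fun_poset C P Q)) B b"
  shows "sup_cont (fun_poset C P Q) (fun_poset C P Q) (\<lambda>n. fix_step C (B n)) (fix_step C b)"
  using chain_sup_lift_default[OF porder_fun[OF f P Q] bottom_fun[OF f P Q] sup_contD[OF B]]
  unfolding sup_cont_def fix_step_def by blast

text \<open>Two function values with equal applications on the carrier are equal by
  \<open>fun_ext\<close>, provided that both are values of the function space. Continuity of
  \<open>b\<close> is used to see that \<open>fix_step C b h\<close> is one.\<close>

lemma fixpoint_eq:
  assumes f: "faithful C P Q" and P: "porder P" and Q: "porder Q"
    and b: "sup_cont (fun_poset C P Q) (lift (fun_poset C P Q)) (\<lambda>_. b) b"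
  shows "fixpoint C P Q b = least_in (fun_poset C P Q) {h \<in> carr (fun_poset C P Q). fix_step C b h = h}"
proof -
  note po = porder_fun[OF f P Q]
  have n: "(\<lambda>_. None) \<in> carr (kleisli_exp P Q)" using bottom_exp[OF P Q] by (simp add: bottom_def)
  have "(\<forall>a\<in>carr P. apply_val C h a = (case b h of None \<Rightarrow> None | Some g \<Rightarrow> apply_val C g a)) \<longleftrightarrow>
      fix_step C b h = h" if h: "h \<in> carr (fun_poset C P Q)" for h
  proof -
    have e: "apply_val C (fix_step C b h) a = (case b h of None \<Rightarrow> None | Some g \<Rightarrow> apply_val C g a)" for a
      using apply_val_enc[OF f n] by (simp add: fix_step_def split: option.split)
    have m: "fix_step C b h \<in> carr (fun_poset C P Q)"
      by (rule sup_cont_carr(2)[OF po sup_cont_fix_step[OF f P Q b] h])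
    show ?thesis
    proof
      assume "\<forall>a\<in>carr P. apply_val C h a = (case b h of None \<Rightarrow> None | Some g \<Rightarrow> apply_val C g a)"
      then show "fix_step C b h = h" by (intro fun_ext[OF f P m h]) (simp add: e)
    next
      assume "fix_step C b h = h"
      then show "\<forall>a\<in>carr P. apply_val C h a = (case b h of None \<Rightarrow> None | Some g \<Rightarrow> apply_val C g a)"
        using e by metis
    qed
  qed
  then show ?thesis unfolding fixpoint_def by (intro arg_cong[where f = "least_in _"] Collect_cong) blast
qed

lemma fixpoint_chain_sup:
  assumes f: "faithful C P Q" and P: "porder P" and Q: "omega_cpo Q"
    and b: "sup_cont (fun_poset C P Q) (lift (fun_poset C P Q)) (\<lambda>_. b) b"
  shows "chain_sup (fun_poset C P Q) (\<lambda>m. (fix_step C b ^^ m) (VFun (enc C (\<lambda>_. None)))) (fixpoint C P Q b)"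
  unfolding fixpoint_eq[OF f P omega_cpo_porder[OF Q] b]
  by (rule kleene_lfp[OF omega_cpo_fun[OF f P Q] bottom_fun[OF f P omega_cpo_porder[OF Q]]
    sup_cont_fix_step[OF f P omega_cpo_porder[OF Q] b]])

lemma fixpoint_cont:
  assumes f: "faithful C P Q" and P: "porder P" and Q: "omega_cpo Q"
    and B: "sup_cont (fun_poset C P Q) (lift (fun_poset C P Q)) B b"
    and Bn: "\<And>n. sup_cont (fun_poset C P Q) (lift (fun_poset C P Q)) (\<lambda>_. B n) (B n)"
    and b: "sup_cont (fun_poset C P Q) (lift (fun_poset C P Q)) (\<lambda>_. b) b"
  shows "chain_sup (fun_poset C P Q) (\<lambda>n. fixpoint C P Q (B n)) (fixpoint C P Q b)"
proof -
  note Q' = omega_cpo_porder[OF Q]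
  show ?thesis
    unfolding fixpoint_eq[OF f P Q' b] fixpoint_eq[OF f P Q' Bn]
    by (rule kleene_lfp_cont[OF omega_cpo_fun[OF f P Q] bottom_fun[OF f P Q']
      sup_cont_fix_step[OF f P Q' Bn] sup_cont_fix_step[OF f P Q' b] sup_cont_fix_step[OF f P Q' B]])
qed

lemma omega_cpo_ty:
  assumes "codes N C" "fun_depth \<tau> \<le> N"
  shows "omega_cpo (ty_cpo C k \<tau>)"
  using assms(2)
proof (induction \<tau>)
  case (Fun \<tau> \<sigma>)
  then have "faithful C (ty_cpo C k \<tau>) (ty_cpo C k \<sigma>)"
    using assms(1) by (auto simp: codes_def faithful_def)
  then show ?case using Fun by (simp add: omega_cpo_fun omega_cpo_porder)
qed (simp_all add: omega_cpo_discrete omega_cpo_sum omega_cpo_prod)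

section \<open>Continuity of the semantics\<close>

definition chain_sup_env :: "'a poset list \<Rightarrow> (nat \<Rightarrow> 'a list) \<Rightarrow> 'a list \<Rightarrow> bool" where
  "chain_sup_env Ps X s \<longleftrightarrow> length s = length Ps \<and> (\<forall>n. length (X n) = length Ps) \<and>
     (\<forall>i<length Ps. chain_sup (Ps ! i) (\<lambda>n. X n ! i) (s ! i))"

definition cont_in :: "'a poset list \<Rightarrow> 'b poset \<Rightarrow> ('a list \<Rightarrow> 'b option) \<Rightarrow> bool" where
  "cont_in Ps Q \<phi> \<longleftrightarrow> (\<forall>X s. chain_sup_env Ps X s \<longrightarrow> chain_sup (lift Q) (\<lambda>n. \<phi> (X n)) (\<phi> s))"

lemma cont_inD: "cont_in Ps Q \<phi> \<Longrightarrow> chain_sup_env Ps X s \<Longrightarrow> chain_sup (lift Q) (\<lambda>n. \<phi> (X n)) (\<phi> s)"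
  by (simp add: cont_in_def)

lemma chain_sup_env_Cons:
  assumes "chain_sup P V v" "chain_sup_env Ps X s"
  shows "chain_sup_env (P # Ps) (\<lambda>n. V n # X n) (v # s)"
  unfolding chain_sup_env_def
proof (intro conjI allI impI)
  fix i assume "i < length (P # Ps)"
  then show "chain_sup ((P # Ps) ! i) (\<lambda>n. (V n # X n) ! i) ((v # s) ! i)"
    using assms by (cases i) (simp_all add: chain_sup_env_def)
qed (use assms in \<open>simp_all add: chain_sup_env_def\<close>)

lemma chain_sup_env_shift:
  assumes "list_all omega_cpo Ps" "chain_sup_env Ps X s"
  shows "chain_sup_env Ps (\<lambda>n. X (n + N)) s"
  unfolding chain_sup_env_def
proof (intro conjI allI impI)
  fix i assume i: "i < length Ps"
  show "chain_sup (Ps ! i) (\<lambda>n. X (n + N) ! i) (s ! i)"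
    by (rule chain_sup_shift[where X = "\<lambda>n. X n ! i"])
      (use assms i in \<open>auto simp: chain_sup_env_def list_all_length omega_cpo_porder\<close>)
qed (use assms in \<open>simp_all add: chain_sup_env_def\<close>)

text \<open>A constant chain with itself as supremum also serves, further on, as the statement that
  an environment consists of elements of the carriers.\<close>

lemma chain_sup_env_const:
  assumes "list_all omega_cpo Ps" "length x = length Ps" "\<And>i. i < length Ps \<Longrightarrow> x ! i \<in> carr (Ps ! i)"
  shows "chain_sup_env Ps (\<lambda>_. x) x"
  using assms by (auto simp: chain_sup_env_def list_all_length intro: chain_sup_const omega_cpo_porder)

lemma chain_sup_env_const_of:
  assumes "list_all omega_cpo Ps" "chain_sup_env Ps X s"
  shows "chain_sup_env Ps (\<lambda>_. X n) (X n)" and "chain_sup_env Ps (\<lambda>_. s) s"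
proof -
  have "X n ! i \<in> carr (Ps ! i)" "s ! i \<in> carr (Ps ! i)" if "i < length Ps" for i
  proof -
    have "chain_sup (Ps ! i) (\<lambda>n. X n ! i) (s ! i)" using assms(2) that by (simp add: chain_sup_env_def)
    from chain_sup_in[OF this, of n] chain_sup_carr[OF this]
    show "X n ! i \<in> carr (Ps ! i)" "s ! i \<in> carr (Ps ! i)" .
  qed
  then show "chain_sup_env Ps (\<lambda>_. X n) (X n)" "chain_sup_env Ps (\<lambda>_. s) s"
    using assms by (simp_all add: chain_sup_env_const chain_sup_env_def[of Ps X s])
qed

text \<open>Common form of the sequencing constructs. The intermediate value and the environment
  move together, and the environment is shifted by the number of steps for which the first
  computation is still undefined.\<close>

lemma cont_bind:
  assumes Ps: "list_all omega_cpo Ps" and P: "omega_cpo P" and Q: "omega_cpo Q" and \<phi>: "cont_in Ps P \<phi>"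
    and \<psi>: "\<And>V v X s. chain_sup P V v \<Longrightarrow> chain_sup_env Ps X s \<Longrightarrow>
      chain_sup (lift Q) (\<lambda>n. \<psi> (V n) (X n)) (\<psi> v s)"
  shows "cont_in Ps Q (\<lambda>\<gamma>. Option.bind (\<phi> \<gamma>) (\<lambda>a. \<psi> a \<gamma>))"
  unfolding cont_in_def
proof (intro allI impI)
  fix X s assume X: "chain_sup_env Ps X s"
  show "chain_sup (lift Q) (\<lambda>n. Option.bind (\<phi> (X n)) (\<lambda>a. \<psi> a (X n))) (Option.bind (\<phi> s) (\<lambda>a. \<psi> a s))"
    by (rule chain_sup_bind[OF omega_cpo_porder[OF P] omega_cpo_porder[OF Q] cont_inD[OF \<phi> X]])
      (rule \<psi>[OF _ chain_sup_env_shift[OF Ps X]])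
qed

lemma map_option_bind: "map_option f x = Option.bind x (\<lambda>a. Some (f a))"
  by (cases x) simp_all

lemma cont_map:
  assumes Ps: "list_all omega_cpo Ps" and P: "omega_cpo P" and Q: "omega_cpo Q" and \<phi>: "cont_in Ps P \<phi>"
    and f: "\<And>V v. chain_sup P V v \<Longrightarrow> chain_sup Q (\<lambda>n. f (V n)) (f v)"
  shows "cont_in Ps Q (\<lambda>\<gamma>. map_option f (\<phi> \<gamma>))"
  unfolding map_option_bind
  by (rule cont_bind[OF Ps P Q \<phi>]) (rule chain_sup_Some[OF omega_cpo_porder[OF Q] f])

lemma cont_var:
  "list_all omega_cpo Ps \<Longrightarrow> i < length Ps \<Longrightarrow> cont_in Ps (Ps ! i) (\<lambda>\<gamma>. Some (\<gamma> ! i))"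
  unfolding cont_in_def
  by (intro allI impI chain_sup_Some[where Y = "\<lambda>n. _ n ! i"])
    (simp_all add: chain_sup_env_def list_all_length omega_cpo_porder)

lemma cont_const: "omega_cpo Q \<Longrightarrow> a \<in> carr Q \<Longrightarrow> cont_in Ps Q (\<lambda>_. Some a)"
  unfolding cont_in_def by (intro allI impI chain_sup_Some chain_sup_const omega_cpo_porder) auto

lemma cont_let:
  assumes "list_all omega_cpo Ps" "omega_cpo P" "omega_cpo Q" "cont_in Ps P \<phi>" "cont_in (P # Ps) Q \<psi>"
  shows "cont_in Ps Q (\<lambda>\<gamma>. Option.bind (\<phi> \<gamma>) (\<lambda>a. \<psi> (a # \<gamma>)))"
  by (rule cont_bind[OF assms(1-4)]) (rule cont_inD[OF assms(5) chain_sup_env_Cons])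

lemma cont_case_zero:
  assumes "list_all omega_cpo Ps" "omega_cpo Q" "cont_in Ps (discrete {}) \<phi>"
  shows "cont_in Ps Q (\<lambda>\<gamma>. Option.bind (\<phi> \<gamma>) (\<lambda>_. None))"
  by (rule cont_bind[OF assms(1) omega_cpo_discrete assms(2,3)]) simp

lemma cont_inl:
  assumes "list_all omega_cpo Ps" "omega_cpo P" "omega_cpo Q" "cont_in Ps P \<phi>"
  shows "cont_in Ps (sum_poset P Q) (\<lambda>\<gamma>. map_option VInl (\<phi> \<gamma>))"
  by (rule cont_map[OF assms(1,2) omega_cpo_sum[OF assms(2,3)] assms(4)]) (auto simp: chain_sup_sum_Inl)

lemma cont_inr:
  assumes "list_all omega_cpo Ps" "omega_cpo P" "omega_cpo Q" "cont_in Ps Q \<phi>"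
  shows "cont_in Ps (sum_poset P Q) (\<lambda>\<gamma>. map_option VInr (\<phi> \<gamma>))"
  by (rule cont_map[OF assms(1,3) omega_cpo_sum[OF assms(2,3)] assms(4)]) (auto simp: chain_sup_sum_Inr)

lemma cont_case_sum:
  assumes "list_all omega_cpo Ps" "omega_cpo P" "omega_cpo Q" "omega_cpo R"
    "cont_in Ps (sum_poset P Q) \<phi>" and \<psi>: "cont_in (P # Ps) R \<psi>" and \<theta>: "cont_in (Q # Ps) R \<theta>"
  shows "cont_in Ps R (\<lambda>\<gamma>. Option.bind (\<phi> \<gamma>)
    (\<lambda>v. case v of VInl a \<Rightarrow> \<psi> (a # \<gamma>) | VInr a \<Rightarrow> \<theta> (a # \<gamma>) | _ \<Rightarrow> None))"
proof (rule cont_bind[OF assms(1) omega_cpo_sum[OF assms(2,3)] assms(4,5)])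
  fix V v X s assume "chain_sup (sum_poset P Q) V v" and X: "chain_sup_env Ps X s"
  then show "chain_sup (lift R) (\<lambda>n. case V n of VInl a \<Rightarrow> \<psi> (a # X n) | VInr a \<Rightarrow> \<theta> (a # X n) | _ \<Rightarrow> None)
    (case v of VInl a \<Rightarrow> \<psi> (a # s) | VInr a \<Rightarrow> \<theta> (a # s) | _ \<Rightarrow> None)"
    by (cases rule: chain_sup_sum_cases)
      (simp_all add: cont_inD[OF \<psi> chain_sup_env_Cons[OF _ X]] cont_inD[OF \<theta> chain_sup_env_Cons[OF _ X]])
qed

lemma cont_pair:
  assumes "list_all omega_cpo Ps" "omega_cpo P" "omega_cpo Q" "cont_in Ps P \<phi>" and \<psi>: "cont_in Ps Q \<psi>"
  shows "cont_in Ps (prod_poset P Q) (\<lambda>\<gamma>. Option.bind (\<phi> \<gamma>) (\<lambda>a. map_option (VPair a) (\<psi> \<gamma>)))"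
proof (rule cont_bind[OF assms(1,2) omega_cpo_prod[OF assms(2,3)] assms(4)])
  fix V v X s assume V: "chain_sup P V v" and X: "chain_sup_env Ps X s"
  note PQ = omega_cpo_prod[OF assms(2,3)]
  have "chain_sup (lift (prod_poset P Q)) (\<lambda>n. Option.bind (\<psi> (X n)) (\<lambda>b. Some (VPair (V n) b)))
      (Option.bind (\<psi> s) (\<lambda>b. Some (VPair v b)))"
  proof (rule chain_sup_bind[OF omega_cpo_porder[OF assms(3)] omega_cpo_porder[OF PQ] cont_inD[OF \<psi> X]])
    fix N U u assume "chain_sup Q U u"
    then show "chain_sup (lift (prod_poset P Q)) (\<lambda>n. Some (VPair (V (n + N)) (U n))) (Some (VPair v u))"
      using chain_sup_shift[OF omega_cpo_porder[OF assms(2)] V]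
      by (intro chain_sup_Some[OF omega_cpo_porder[OF PQ]]) (simp add: chain_sup_prod)
  qed
  then show "chain_sup (lift (prod_poset P Q)) (\<lambda>n. map_option (VPair (V n)) (\<psi> (X n)))
      (map_option (VPair v) (\<psi> s))" by (simp add: map_option_bind)
qed

lemma cont_case_pair:
  assumes "list_all omega_cpo Ps" "omega_cpo P" "omega_cpo Q" "omega_cpo R"
    "cont_in Ps (prod_poset P Q) \<phi>" and \<psi>: "cont_in (P # Q # Ps) R \<psi>"
  shows "cont_in Ps R (\<lambda>\<gamma>. Option.bind (\<phi> \<gamma>) (\<lambda>v. case v of VPair a b \<Rightarrow> \<psi> (a # b # \<gamma>) | _ \<Rightarrow> None))"
proof (rule cont_bind[OF assms(1) omega_cpo_prod[OF assms(2,3)] assms(4,5)])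
  fix V v X s assume "chain_sup (prod_poset P Q) V v" and X: "chain_sup_env Ps X s"
  then show "chain_sup (lift R) (\<lambda>n. case V n of VPair a b \<Rightarrow> \<psi> (a # b # X n) | _ \<Rightarrow> None)
    (case v of VPair a b \<Rightarrow> \<psi> (a # b # s) | _ \<Rightarrow> None)"
    by (cases rule: chain_sup_prod_cases)
      (simp_all add: cont_inD[OF \<psi> chain_sup_env_Cons[OF _ chain_sup_env_Cons[OF _ X]]])
qed

text \<open>A body with one additional variable becomes a convergent sequence of functions of that
  variable, the form in which abstraction, iteration and recursion consume it.\<close>

lemma cont_body:
  assumes "cont_in (P # Ps) R \<psi>" "chain_sup_env Ps X s"
  shows "sup_cont P (lift R) (\<lambda>n a. \<psi> (a # X n)) (\<lambda>a. \<psi> (a # s))"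
  unfolding sup_cont_def by (intro allI impI cont_inD[OF assms(1)] chain_sup_env_Cons assms(2))

lemma sup_cont_lam:
  assumes "cont_in (P # Ps) Q \<psi>" "chain_sup_env Ps X s"
  shows "sup_cont P (lift Q) (\<lambda>n a. if a \<in> carr P then \<psi> (a # X n) else None)
    (\<lambda>a. if a \<in> carr P then \<psi> (a # s) else None)"
  unfolding sup_cont_def
  using sup_contD[OF cont_body[OF assms]] chain_sup_in chain_sup_carr by fastforce

lemma lam_exp:
  assumes "omega_cpo P" "cont_in (P # Ps) Q \<psi>" "chain_sup_env Ps (\<lambda>_. s) s"
  shows "(\<lambda>a. if a \<in> carr P then \<psi> (a # s) else None) \<in> carr (kleisli_exp P Q)"
  using sup_cont_lam[OF assms(2,3)] by (simp add: kleisli_exp_iff[OF omega_cpo_porder[OF assms(1)]])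

lemma lam_chain_sup:
  assumes Ps: "list_all omega_cpo Ps" and P: "omega_cpo P" and Q: "omega_cpo Q" and f: "faithful C P Q"
    and \<psi>: "cont_in (P # Ps) Q \<psi>" and X: "chain_sup_env Ps X s"
  shows "chain_sup (fun_poset C P Q) (\<lambda>n. VFun (enc C (\<lambda>a. if a \<in> carr P then \<psi> (a # X n) else None)))
     (VFun (enc C (\<lambda>a. if a \<in> carr P then \<psi> (a # s) else None)))"
proof -
  note m = lam_exp[OF P \<psi> chain_sup_env_const_of(1)[OF Ps X]] lam_exp[OF P \<psi> chain_sup_env_const_of(2)[OF Ps X]]
  show ?thesis
    unfolding chain_sup_fun[OF f omega_cpo_porder[OF P] Q] apply_val_enc[OF f m(1)] apply_val_enc[OF f m(2)]
    using enc_in_fun[OF m(1)] enc_in_fun[OF m(2)] sup_cont_lam[OF \<psi> X] by blast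
qed

lemma cont_lam:
  assumes "list_all omega_cpo Ps" "omega_cpo P" "omega_cpo Q" "faithful C P Q" "cont_in (P # Ps) Q \<psi>"
  shows "cont_in Ps (fun_poset C P Q)
    (\<lambda>\<gamma>. Some (VFun (enc C (\<lambda>a. if a \<in> carr P then \<psi> (a # \<gamma>) else None))))"
  unfolding cont_in_def
  using chain_sup_Some[OF porder_fun[OF assms(4) omega_cpo_porder[OF assms(2)] omega_cpo_porder[OF assms(3)]]
    lam_chain_sup[OF assms]] by blast

lemma cont_app:
  assumes Ps: "list_all omega_cpo Ps" and P: "omega_cpo P" and Q: "omega_cpo Q" and f: "faithful C P Q"
    and \<phi>: "cont_in Ps (fun_poset C P Q) \<phi>" and \<theta>: "cont_in Ps P \<theta>"
  shows "cont_in Ps Q (\<lambda>\<gamma>. Option.bind (\<phi> \<gamma>) (\<lambda>g. Option.bind (\<theta> \<gamma>) (apply_val C g)))"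
proof (rule cont_bind[OF Ps omega_cpo_fun[OF f omega_cpo_porder[OF P] Q] Q \<phi>])
  note P' = omega_cpo_porder[OF P] and Q' = omega_cpo_porder[OF Q]
  fix V v X s assume "chain_sup (fun_poset C P Q) V v" and X: "chain_sup_env Ps X s"
  then have V: "sup_cont P (lift Q) (\<lambda>n. apply_val C (V n)) (apply_val C v)"
    by (simp add: chain_sup_fun[OF f P' Q])
  show "chain_sup (lift Q) (\<lambda>n. Option.bind (\<theta> (X n)) (apply_val C (V n))) (Option.bind (\<theta> s) (apply_val C v))"
    by (rule chain_sup_bind[OF P' Q' cont_inD[OF \<theta> X]]) (rule sup_cont_shift[OF P' porder_lift[OF Q'] V])
qed

lemma cont_iterate:
  assumes Ps: "list_all omega_cpo Ps" and P: "omega_cpo P" and Q: "omega_cpo Q"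
    and \<psi>: "cont_in (P # Ps) (sum_poset P Q) \<psi>" and \<theta>: "cont_in Ps P \<theta>"
  shows "cont_in Ps Q (\<lambda>\<gamma>. Option.bind (\<theta> \<gamma>) (iteration P Q (\<lambda>a. \<psi> (a # \<gamma>))))"
proof (rule cont_bind[OF Ps P Q \<theta>, where \<psi> = "\<lambda>a \<gamma>. iteration P Q (\<lambda>a. \<psi> (a # \<gamma>)) a"])
  note P' = omega_cpo_porder[OF P]
  fix V v X s assume V: "chain_sup P V v" and X: "chain_sup_env Ps X s"
  have "chain_sup (kleisli_exp P Q) (\<lambda>n. iteration P Q (\<lambda>a. \<psi> (a # X n))) (iteration P Q (\<lambda>a. \<psi> (a # s)))"
    by (rule iteration_cont[OF P' Q cont_body[OF \<psi> X]])
      (rule cont_body[OF \<psi> chain_sup_env_const_of(1)[OF Ps X]]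
        cont_body[OF \<psi> chain_sup_env_const_of(2)[OF Ps X]])+
  then show "chain_sup (lift Q) (\<lambda>n. iteration P Q (\<lambda>a. \<psi> (a # X n)) (V n)) (iteration P Q (\<lambda>a. \<psi> (a # s)) v)"
    using V by (auto simp: chain_sup_exp[OF P' Q] intro: sup_contD)
qed

lemma cont_mu:
  assumes Ps: "list_all omega_cpo Ps" and P: "omega_cpo P" and Q: "omega_cpo Q" and f: "faithful C P Q"
    and \<psi>: "cont_in (fun_poset C P Q # Ps) (fun_poset C P Q) \<psi>"
  shows "cont_in Ps (fun_poset C P Q) (\<lambda>\<gamma>. Some (fixpoint C P Q (\<lambda>h. \<psi> (h # \<gamma>))))"
  unfolding cont_in_def
proof (intro allI impI)
  note P' = omega_cpo_porder[OF P] and Q' = omega_cpo_porder[OF Q]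
  fix X s assume X: "chain_sup_env Ps X s"
  show "chain_sup (lift (fun_poset C P Q)) (\<lambda>n. Some (fixpoint C P Q (\<lambda>h. \<psi> (h # X n))))
     (Some (fixpoint C P Q (\<lambda>h. \<psi> (h # s))))"
    by (rule chain_sup_Some[OF porder_fun[OF f P' Q'] fixpoint_cont[OF f P' Q cont_body[OF \<psi> X]]])
      (rule cont_body[OF \<psi> chain_sup_env_const_of(1)[OF Ps X]]
        cont_body[OF \<psi> chain_sup_env_const_of(2)[OF Ps X]])+
qed

text \<open>A primitive acts on argument lists by an arbitrary function \<open>\<psi>\<close>. By
  \<open>flat\<close> every chain of arguments is constant, so nothing has to be known about
  \<open>\<psi>\<close> except where its values lie. The interpretations of \<open>Real\<close> and
  of its transform are both flat.\<close>

lemma cont_those: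
  assumes Ps: "list_all omega_cpo Ps" and P: "omega_cpo P" and Q: "omega_cpo Q"
    and flat: "\<And>V v n. chain_sup P V v \<Longrightarrow> V n = v"
    and \<phi>: "\<And>\<phi>. \<phi> \<in> set \<phi>s \<Longrightarrow> cont_in Ps P \<phi>"
    and \<psi>: "\<And>vs. length vs = length \<phi>s \<Longrightarrow> set vs \<subseteq> carr P \<Longrightarrow> \<psi> vs \<in> carr (lift Q)"
  shows "cont_in Ps Q (\<lambda>\<gamma>. Option.bind (those (map (\<lambda>d. d \<gamma>) \<phi>s)) \<psi>)"
  using \<phi> \<psi>
proof (induction \<phi>s arbitrary: \<psi>)
  case Nil
  then show ?case
    using chain_sup_const[OF porder_lift[OF omega_cpo_porder[OF Q]]] by (simp add: cont_in_def)
next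
  case (Cons \<phi> \<phi>s)
  have "cont_in Ps Q (\<lambda>\<gamma>. Option.bind (\<phi> \<gamma>)
     (\<lambda>v. Option.bind (those (map (\<lambda>d. d \<gamma>) \<phi>s)) (\<lambda>vs. \<psi> (v # vs))))"
  proof (rule cont_bind[OF Ps P Q])
    fix V v X s assume V: "chain_sup P V v" and X: "chain_sup_env Ps X s"
    have "cont_in Ps Q (\<lambda>\<gamma>. Option.bind (those (map (\<lambda>d. d \<gamma>) \<phi>s)) (\<lambda>vs. \<psi> (v # vs)))"
      using Cons.prems chain_sup_carr[OF V] by (intro Cons.IH) auto
    from cont_inD[OF this X]
    show "chain_sup (lift Q) (\<lambda>n. Option.bind (those (map (\<lambda>d. d (X n)) \<phi>s)) (\<lambda>vs. \<psi> (V n # vs)))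
      (Option.bind (those (map (\<lambda>d. d s) \<phi>s)) (\<lambda>vs. \<psi> (v # vs)))"
      by (simp add: flat[OF V])
  qed (use Cons.prems in simp)
  moreover have "Option.bind (\<phi> \<gamma>) (\<lambda>v. Option.bind (those (map (\<lambda>d. d \<gamma>) \<phi>s)) (\<lambda>vs. \<psi> (v # vs))) =
      Option.bind (those (map (\<lambda>d. d \<gamma>) (\<phi> # \<phi>s))) \<psi>" for \<gamma>
    by (cases "\<phi> \<gamma>"; cases "those (map (\<lambda>d. d \<gamma>) \<phi>s)") simp_all
  ultimately show ?case by simp
qed

section \<open>Source typing below a depth bound, and continuity of source terms\<close>

definition small_src :: "nat \<Rightarrow> ty \<Rightarrow> bool" where
  "small_src N \<tau> \<longleftrightarrow> src_ty \<tau> \<and> fun_depth \<tau> \<le> N"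

lemma small_src_simps [simp]:
  "small_src N Real" "small_src N Zero" "small_src N One"
  "small_src N (Sum \<tau> \<sigma>) \<longleftrightarrow> small_src N \<tau> \<and> small_src N \<sigma>"
  "small_src N (Prod \<tau> \<sigma>) \<longleftrightarrow> small_src N \<tau> \<and> small_src N \<sigma>"
  by (auto simp: small_src_def)

lemma small_src_Fun:
  "small_src N (Fun \<tau> \<sigma>) \<longleftrightarrow> small_src N \<tau> \<and> small_src N \<sigma> \<and> fun_depth (Fun \<tau> \<sigma>) \<le> N"
  by (auto simp: small_src_def)

text \<open>\<open>Real\<close> becomes a product of types of depth 0 and arrows are kept, so a
  single bound serves a term and its transform.\<close>

lemma fun_depth_AD_ty: "src_ty \<tau> \<Longrightarrow> fun_depth (AD_ty \<tau>) = fun_depth \<tau>"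
  by (induction \<tau>) simp_all

text \<open>Typing derivations of source terms all of whose types, and those of whose transform, can be
  interpreted faithfully by a coding for depth \<open>N\<close>.\<close>

inductive src_typed :: "'op signature \<Rightarrow> nat \<Rightarrow> ty list \<Rightarrow> 'op tm \<Rightarrow> ty \<Rightarrow> bool" for S N where
  Var: "list_all (small_src N) \<Gamma> \<Longrightarrow> i < length \<Gamma> \<Longrightarrow> src_typed S N \<Gamma> (TVar i) (\<Gamma> ! i)"
| Let: "src_typed S N \<Gamma> t \<sigma> \<Longrightarrow> src_typed S N (\<sigma> # \<Gamma>) s \<tau> \<Longrightarrow> src_typed S N \<Gamma> (TLet t s) \<tau>"
| Const: "list_all (small_src N) \<Gamma> \<Longrightarrow> src_typed S N \<Gamma> (TConst c) Real"
| Op: "list_all (small_src N) \<Gamma> \<Longrightarrow> length ts = arity S f \<Longrightarrow> \<forall>t\<in>set ts. src_typed S N \<Gamma> t Real \<Longrightarrow>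
    tm_depth (AD_prim S f) \<le> N \<Longrightarrow> src_typed S N \<Gamma> (TOp f ts) Real"
| CaseZero: "src_typed S N \<Gamma> t Zero \<Longrightarrow> small_src N \<tau> \<Longrightarrow> src_typed S N \<Gamma> (TCaseZero \<tau> t) \<tau>"
| Inl: "src_typed S N \<Gamma> t \<tau> \<Longrightarrow> small_src N \<sigma> \<Longrightarrow> src_typed S N \<Gamma> (TInl \<sigma> t) (Sum \<tau> \<sigma>)"
| Inr: "src_typed S N \<Gamma> t \<sigma> \<Longrightarrow> small_src N \<tau> \<Longrightarrow> src_typed S N \<Gamma> (TInr \<tau> t) (Sum \<tau> \<sigma>)"
| CaseSum: "src_typed S N \<Gamma> r (Sum \<sigma> \<rho>) \<Longrightarrow> src_typed S N (\<sigma> # \<Gamma>) t \<tau> \<Longrightarrow> src_typed S N (\<rho> # \<Gamma>) s \<tau> \<Longrightarrow>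
    src_typed S N \<Gamma> (TCaseSum r t s) \<tau>"
| Unit: "list_all (small_src N) \<Gamma> \<Longrightarrow> src_typed S N \<Gamma> TUnit One"
| Pair: "src_typed S N \<Gamma> t \<tau> \<Longrightarrow> src_typed S N \<Gamma> s \<sigma> \<Longrightarrow> src_typed S N \<Gamma> (TPair t s) (Prod \<tau> \<sigma>)"
| CasePair: "src_typed S N \<Gamma> r (Prod \<sigma> \<rho>) \<Longrightarrow> src_typed S N (\<sigma> # \<rho> # \<Gamma>) t \<tau> \<Longrightarrow>
    src_typed S N \<Gamma> (TCasePair r t) \<tau>"
| Lam: "src_typed S N (\<tau> # \<Gamma>) t \<sigma> \<Longrightarrow> small_src N (Fun \<tau> \<sigma>) \<Longrightarrow> src_typed S N \<Gamma> (TLam \<tau> \<sigma> t) (Fun \<tau> \<sigma>)"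
| App: "src_typed S N \<Gamma> t (Fun \<tau> \<sigma>) \<Longrightarrow> src_typed S N \<Gamma> s \<tau> \<Longrightarrow> src_typed S N \<Gamma> (TApp t s) \<sigma>"
| Sign: "src_typed S N \<Gamma> t Real \<Longrightarrow> src_typed S N \<Gamma> (TSign t) (Sum One One)"
| Iterate: "src_typed S N (\<sigma> # \<Gamma>) t (Sum \<sigma> \<tau>) \<Longrightarrow> src_typed S N \<Gamma> s \<sigma> \<Longrightarrow>
    src_typed S N \<Gamma> (TIterate \<sigma> \<tau> t s) \<tau>"
| Mu: "src_typed S N (Fun \<tau> \<sigma> # \<Gamma>) t (Fun \<tau> \<sigma>) \<Longrightarrow> src_typed S N \<Gamma> (TMu \<tau> \<sigma> t) (Fun \<tau> \<sigma>)"

lemma src_typed_small: "src_typed S N \<Gamma> t \<tau> \<Longrightarrow> small_src N \<tau> \<and> list_all (small_src N) \<Gamma>"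
  by (induction rule: src_typed.induct) (auto simp: list_all_length small_src_Fun simp del: fun_depth.simps)

locale faithful_coding =
  fixes C :: "'f coding" and N :: nat and k :: enat
  assumes codes: "codes N C"
begin

abbreviation "cpo \<tau> \<equiv> ty_cpo C k \<tau>"
abbreviation "AD_cpo \<tau> \<equiv> ty_cpo C k (AD_ty \<tau>)"

lemma cpo: "small_src N \<tau> \<Longrightarrow> omega_cpo (cpo \<tau>)"
  and AD_cpo: "small_src N \<tau> \<Longrightarrow> omega_cpo (AD_cpo \<tau>)"
  using omega_cpo_ty[OF codes] by (auto simp: small_src_def fun_depth_AD_ty)

lemmas cpo_porder = cpo[THEN omega_cpo_porder]
lemmas AD_cpo_porder = AD_cpo[THEN omega_cpo_porder]

lemma cpos: "list_all (small_src N) \<Gamma> \<Longrightarrow> list_all omega_cpo (map cpo \<Gamma>)"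
  and AD_cpos: "list_all (small_src N) \<Gamma> \<Longrightarrow> list_all omega_cpo (map (\<lambda>\<tau>. AD_cpo \<tau>) \<Gamma>)"
  by (auto simp: list_all_iff intro: cpo AD_cpo)

lemma faithful: "small_src N (Fun \<tau> \<sigma>) \<Longrightarrow> faithful C (cpo \<tau>) (cpo \<sigma>)"
  and AD_faithful: "small_src N (Fun \<tau> \<sigma>) \<Longrightarrow> faithful C (AD_cpo \<tau>) (AD_cpo \<sigma>)"
  using codes[unfolded codes_def, rule_format, of \<tau> \<sigma> _ k]
    codes[unfolded codes_def, rule_format, of "AD_ty \<tau>" "AD_ty \<sigma>" _ k]
    fun_depth_AD_ty[of \<tau>] fun_depth_AD_ty[of \<sigma>]
  unfolding faithful_def small_src_def by simp_all

lemma sem_cont: "src_typed S N \<Gamma> t \<tau> \<Longrightarrow> cont_in (map cpo \<Gamma>) (cpo \<tau>) (sem S C k t)"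
proof (induction rule: src_typed.induct)
  case (Var \<Gamma> i)
  then show ?case using cont_var[OF cpos[OF Var(1)], of i] by simp
next
  case (Let \<Gamma> t \<sigma> s \<tau>)
  note small = Let.hyps[THEN src_typed_small]
  show ?case using cont_let[OF cpos cpo cpo Let.IH(1)] Let.IH(2) small by simp
next
  case (Const \<Gamma> c)
  then show ?case by (auto intro!: cont_const omega_cpo_discrete)
next
  case (Op \<Gamma> ts f)
  have "cont_in (map cpo \<Gamma>) (discrete (range VReal)) (\<lambda>\<gamma>. Option.bind (those (map (\<lambda>d. d \<gamma>) (map (sem S C k) ts)))
      (\<lambda>vs. map_option VReal (op_sem S f (map un_real vs))))"
    by (rule cont_those[OF cpos[OF Op(1)] omega_cpo_discrete[of "range VReal"] omega_cpo_discrete])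
      (use Op in \<open>auto split: option.split simp: map_option_case\<close>)
  then show ?case by simp
next
  case (CaseZero \<Gamma> t \<tau>)
  note small = CaseZero.hyps(1)[THEN src_typed_small]
  show ?case using cont_case_zero[OF cpos cpo] CaseZero small by simp
next
  case (Inl \<Gamma> t \<tau> \<sigma>)
  note small = Inl.hyps(1)[THEN src_typed_small]
  show ?case using cont_inl[OF cpos cpo cpo Inl.IH] Inl.hyps(2) small by simp
next
  case (Inr \<Gamma> t \<sigma> \<tau>)
  note small = Inr.hyps(1)[THEN src_typed_small]
  show ?case using cont_inr[OF cpos cpo cpo Inr.IH] Inr.hyps(2) small by simp
next
  case (CaseSum \<Gamma> r \<sigma> \<rho> t \<tau> s)
  note small = CaseSum.hyps[THEN src_typed_small]
  show ?case using cont_case_sum[OF cpos cpo cpo cpo, of \<Gamma> \<sigma> \<rho> \<tau>] CaseSum.IH small by simp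
next
  case (Unit \<Gamma>)
  then show ?case by (auto intro!: cont_const omega_cpo_discrete)
next
  case (Pair \<Gamma> t \<tau> s \<sigma>)
  note small = Pair.hyps[THEN src_typed_small]
  show ?case using cont_pair[OF cpos cpo cpo Pair.IH] small by simp
next
  case (CasePair \<Gamma> r \<sigma> \<rho> t \<tau>)
  note small = CasePair.hyps[THEN src_typed_small]
  show ?case using cont_case_pair[OF cpos cpo cpo cpo, of \<Gamma> \<sigma> \<rho> \<tau>] CasePair.IH small by simp
next
  case (Lam \<tau> \<Gamma> t \<sigma>)
  note small = Lam.hyps(1)[THEN src_typed_small]
  show ?case using cont_lam[OF cpos cpo cpo faithful[OF Lam.hyps(2)]] Lam.IH small by simp
next
  case (App \<Gamma> t \<tau> \<sigma> s)
  note small = App.hyps[THEN src_typed_small]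
  show ?case
    using cont_app[OF cpos cpo cpo faithful, of \<Gamma> \<tau> \<sigma>] App.IH small by (simp add: small_src_Fun del: fun_depth.simps)
next
  case (Sign \<Gamma> t)
  note small = Sign.hyps[THEN src_typed_small]
  have "cont_in (map cpo \<Gamma>) (sum_poset (discrete {VUnit}) (discrete {VUnit})) (\<lambda>\<gamma>. Option.bind (sem S C k t \<gamma>)
      (\<lambda>v. if un_real v < 0 then Some (VInl VUnit) else if un_real v > 0 then Some (VInr VUnit) else None))"
    by (rule cont_bind[OF cpos omega_cpo_discrete[of "range VReal"] omega_cpo_sum[OF omega_cpo_discrete omega_cpo_discrete]])
      (use small Sign.IH in \<open>auto intro!: chain_sup_Some porder_sum porder_discrete
        simp: chain_sup_sum_Inl chain_sup_sum_Inr\<close>)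
  then show ?case by simp
next
  case (Iterate \<sigma> \<Gamma> t \<tau> s)
  note small = Iterate.hyps[THEN src_typed_small]
  show ?case using cont_iterate[OF cpos cpo cpo, of \<Gamma> \<sigma> \<tau>] Iterate.IH small by simp
next
  case (Mu \<tau> \<sigma> \<Gamma> t)
  note small = Mu.hyps[THEN src_typed_small]
  show ?case
    using cont_mu[OF cpos cpo cpo faithful, of \<Gamma> \<tau> \<sigma>] Mu.IH small by (simp add: small_src_Fun del: fun_depth.simps)
qed

end

section \<open>The transform of a primitive\<close>

lemma nth_up: "(\<And>i. \<gamma>' ! \<rho> i = \<gamma> ! i) \<Longrightarrow> (a # \<gamma>') ! up \<rho> i = (a # \<gamma>) ! i"
  by (cases i) (simp_all add: up_def)

lemma nth_up_less:
  "(\<And>i. i < n \<Longrightarrow> \<gamma>' ! \<rho> i = \<gamma> ! i) \<Longrightarrow> i < Suc n \<Longrightarrow> (a # \<gamma>') ! up \<rho> i = (a # \<gamma>) ! i"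
  by (cases i) (simp_all add: up_def)

lemma sem_ren:
  "(\<And>i. \<gamma>' ! \<rho> i = \<gamma> ! i) \<Longrightarrow> sem S C k (ren \<rho> t) \<gamma>' = sem S C k t \<gamma>"
  by (induction t arbitrary: \<rho> \<gamma> \<gamma>') (simp_all add: nth_up o_def cong: map_cong if_cong val.case_cong)

text \<open>The renaming that \<open>AD_op\<close> applies to \<open>partial_op\<close> is correct
  only below the arity, since \<open>n - 1 - l\<close> is truncated beyond it. Typing confines the
  free variables to indices below the length of the context, so agreement there suffices.\<close>

lemma sem_ren_typed:
  "has_type S' \<Gamma> t \<tau> \<Longrightarrow> (\<And>i. i < length \<Gamma> \<Longrightarrow> \<gamma>' ! \<rho> i = \<gamma> ! i) \<Longrightarrow>
    sem S C k (ren \<rho> t) \<gamma>' = sem S C k t \<gamma>"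
proof (induction arbitrary: \<rho> \<gamma> \<gamma>' rule: has_type.induct)
  case (2 \<Gamma> t \<sigma> s \<tau>)
  show ?case using "2.IH"(1)[OF "2.prems"] "2.IH"(2)[OF nth_up_less[OF "2.prems"]] by simp
next
  case (4 ts f \<Gamma>)
  have "map (\<lambda>t. sem S C k (ren \<rho> t) \<gamma>') ts = map (\<lambda>t. sem S C k t \<gamma>) ts"
    by (rule map_cong[OF refl]) (use 4 in blast)
  then show ?case by (simp only: ren.simps sem.simps map_map o_def)
next
  case (8 \<Gamma> r \<sigma> \<rho>' t \<tau> s)
  show ?case
    using "8.IH"(1)[OF "8.prems"] "8.IH"(2,3)[OF nth_up_less[OF "8.prems"]] by simp
next
  case (11 \<Gamma> r \<sigma> \<rho>' t \<tau>)
  show ?case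
    using "11.IH"(1)[OF "11.prems"] "11.IH"(2)[OF nth_up_less[OF nth_up_less[OF "11.prems"]]] by simp
next
  case (12 \<tau> \<Gamma> t \<sigma>)
  show ?case using "12.IH"[OF nth_up_less[OF "12.prems"]] by (simp cong: if_cong)
next
  case (15 \<sigma> \<Gamma> t \<tau> s)
  show ?case using "15.IH"(1)[OF nth_up_less[OF "15.prems"]] "15.IH"(2)[OF "15.prems"] by simp
next
  case (16 \<tau> \<sigma> \<Gamma> t)
  show ?case using "16.IH"[OF nth_up_less[OF "16.prems"]] by simp
qed simp_all

lemma sem_shift: "length E = m \<Longrightarrow> sem S C k (shift m t) (E @ \<gamma>) = sem S C k t \<gamma>"
  unfolding shift_def by (rule sem_ren) (simp add: nth_append)

lemma tm_depth_ren [simp]: "tm_depth (ren \<rho> t) = tm_depth t"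
  by (induction t arbitrary: \<rho>) (simp_all add: o_def cong: map_cong)

lemma those_map_Some: "those (map Some xs) = Some xs"
  by (induction xs) simp_all

lemma those_eq_Some: "those xs = Some ys \<Longrightarrow> xs = map Some ys"
  by (induction xs arbitrary: ys) (auto split: option.splits)

lemma length_those: "those xs = Some ys \<Longrightarrow> length ys = length xs"
  by (drule those_eq_Some) simp

text \<open>The bindings present after the nested pair cases of \<open>AD_op\<close>. The last
  argument is bound innermost and comes first, each value followed by its tangent vector.\<close>

definition dual_env :: "(real \<times> (nat \<Rightarrow> real)) list \<Rightarrow> 'f val list" where
  "dual_env ps = concat (map (\<lambda>(x, w). [VReal x, VVect w]) (rev ps))"

lemma dual_env_simps [simp]:
  "dual_env [] = []" "dual_env (p # ps) = dual_env ps @ [VReal (fst p), VVect (snd p)]"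
  by (simp_all add: dual_env_def split_beta)

lemma length_dual_env [simp]: "length (dual_env ps) = 2 * length ps"
  by (induction ps) simp_all

lemma dual_env_nth:
  "l < length ps \<Longrightarrow> dual_env ps ! (2 * (length ps - 1 - l)) = VReal (fst (ps ! l)) \<and>
     dual_env ps ! Suc (2 * (length ps - 1 - l)) = VVect (snd (ps ! l))"
proof (induction ps arbitrary: l)
  case (Cons p ps)
  then show ?case
  proof (cases l)
    case (Suc m)
    then have "Suc (2 * (length ps - 1 - m)) < 2 * length ps" using Cons.prems by simp
    then show ?thesis using Cons Suc by (simp add: nth_append)
  qed (simp add: nth_append)
qed simp

lemma un_dual_mk_dual [simp]: "un_dual (mk_dual p) = p"
  by (simp add: un_dual_def mk_dual_def split_beta)

lemma un_dual_VPair [simp]: "un_dual (VPair (VReal x) (VVect w)) = (x, w)"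
  by (simp add: un_dual_def)

lemma mk_dual_eq: "mk_dual p = VPair (VReal (fst p)) (VVect (snd p))"
  by (simp add: mk_dual_def split_beta)

text \<open>The block \<open>E\<close> of \<open>2 * m\<close> earlier bindings makes the induction
  go through; the shift lets each argument ignore it. Defined values have to be dual numbers, since
  otherwise the pair case would yield bottom.\<close>

lemma sem_case_pairs:
  assumes "\<And>d v. d \<in> set ds \<Longrightarrow> sem S C k d \<gamma> = Some v \<Longrightarrow> v \<in> range mk_dual" and "length E = 2 * m"
  shows "sem S C k (foldr TCasePair (map (\<lambda>i. shift (2 * (i + m)) (ds ! i)) [0..<length ds]) b) (E @ \<gamma>) =
    Option.bind (those (map (\<lambda>d. sem S C k d \<gamma>) ds)) (\<lambda>vs. sem S C k b (dual_env (map un_dual vs) @ E @ \<gamma>))"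
  using assms
proof (induction ds arbitrary: E m)
  case (Cons d ds)
  have *: "map (\<lambda>i. shift (2 * (i + m)) ((d # ds) ! i)) [0..<length (d # ds)] =
      shift (2 * m) d # map (\<lambda>i. shift (2 * (i + Suc m)) (ds ! i)) [0..<length ds]"
    by (simp add: map_upt_Suc del: upt_Suc)
  have d: "sem S C k (shift (2 * m) d) (E @ \<gamma>) = sem S C k d \<gamma>"
    by (rule sem_shift) (use Cons.prems in simp)
  show ?case
  proof (cases "sem S C k d \<gamma>")
    case None
    then show ?thesis by (simp only: * foldr.simps o_apply sem.simps d) simp
  next
    case (Some v)
    then obtain p where v: "v = mk_dual p" using Cons.prems(1)[of d v] by auto
    have "sem S C k (foldr TCasePair (map (\<lambda>i. shift (2 * (i + Suc m)) (ds ! i)) [0..<length ds]) b)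
        ((VReal (fst p) # VVect (snd p) # E) @ \<gamma>) =
      Option.bind (those (map (\<lambda>d. sem S C k d \<gamma>) ds))
        (\<lambda>vs. sem S C k b (dual_env (map un_dual vs) @ (VReal (fst p) # VVect (snd p) # E) @ \<gamma>))"
      by (rule Cons.IH) (use Cons.prems in auto)
    then show ?thesis
      unfolding * foldr.simps o_apply sem.simps d Some v
      by (cases "those (map (\<lambda>d. sem S C k d \<gamma>) ds)") (simp_all add: Some v mk_dual_eq[of p])
  qed
qed simp

text \<open>Term number \<open>i\<close> is evaluated below the bindings of its predecessors. The
  hypothesis gives it the value \<open>c i\<close> whatever those bindings contain, so the results
  can be collected independently of each other. The latest binding comes first, hence
  \<open>rev zs\<close>.\<close>

lemma sem_lets:
  assumes "\<And>i ws. i < length es \<Longrightarrow> length ws = i + length us \<Longrightarrow> sem S C k (es ! i) (ws @ \<gamma>) = c i"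
  shows "sem S C k (foldr TLet es b) (us @ \<gamma>) =
    Option.bind (those (map c [0..<length es])) (\<lambda>zs. sem S C k b (rev zs @ us @ \<gamma>))"
  using assms
proof (induction es arbitrary: us c)
  case (Cons e es)
  have *: "map c [0..<length (e # es)] = c 0 # map (\<lambda>i. c (Suc i)) [0..<length es]"
    by (simp add: map_upt_Suc del: upt_Suc)
  have e: "sem S C k e (us @ \<gamma>) = c 0" using Cons.prems[of 0 us] by simp
  show ?case
  proof (cases "c 0")
    case None
    then show ?thesis unfolding * by (simp add: e)
  next
    case (Some z)
    have "sem S C k (foldr TLet es b) ((z # us) @ \<gamma>) =
      Option.bind (those (map (\<lambda>i. c (Suc i)) [0..<length es])) (\<lambda>zs. sem S C k b (rev zs @ (z # us) @ \<gamma>))"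
      by (rule Cons.IH) (use Cons.prems[of "Suc _"] in simp)
    then show ?thesis
      unfolding * using e Some
      by (cases "those (map (\<lambda>i. c (Suc i)) [0..<length es])") simp_all
  qed
qed simp

lemma sem_vect_sum:
  assumes "\<And>i. i < length ts \<Longrightarrow> sem S C k (ts ! i) \<gamma> = Some (VVect (u i))"
  shows "sem S C k (vect_sum ts) \<gamma> = Some (VVect (\<lambda>j. \<Sum>i<length ts. u i j))"
proof -
  have fold: "sem S C k (foldl TVAdd t ts) \<gamma> = Some (VVect (\<lambda>j. a j + (\<Sum>i<length ts. u i j)))"
    if "sem S C k t \<gamma> = Some (VVect a)" "\<And>i. i < length ts \<Longrightarrow> sem S C k (ts ! i) \<gamma> = Some (VVect (u i))"
    for t a u ts
    using that
  proof (induction ts arbitrary: t a u)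
    case (Cons s ts)
    have "sem S C k (TVAdd t s) \<gamma> = Some (VVect (\<lambda>j. a j + u 0 j))"
      using Cons.prems(1) Cons.prems(2)[of 0] by simp
    from Cons.IH[OF this, of "\<lambda>i. u (Suc i)"] Cons.prems(2)[of "Suc _"]
    show ?case by (simp add: sum.lessThan_Suc_shift add.assoc del: sum.lessThan_Suc)
  qed simp
  show ?thesis
  proof (cases ts)
    case (Cons t ts')
    then show ?thesis
      using fold[of t "u 0" ts' "\<lambda>i. u (Suc i)"] assms[of 0] assms[of "Suc _"]
      by (simp add: vect_sum_def sum.lessThan_Suc_shift del: sum.lessThan_Suc)
  qed (simp add: vect_sum_def)
qed

text \<open>The part of \<open>AD_op\<close> that depends on the primitive and its arity but not on
  the arguments. It is shared by the transform at variables, about which soundness speaks, and the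
  transform at arbitrary terms.\<close>

definition AD_op_body :: "'op signature \<Rightarrow> 'op \<Rightarrow> nat \<Rightarrow> 'op tm" where
  "AD_op_body S f n = (let x = (\<lambda>l. 2 * (n - 1 - l)) in
     TLet (TOp f (map (\<lambda>l. TVar (x l)) [0..<n]))
       (foldr TLet (map (\<lambda>i. ren (\<lambda>l. x l + 1 + i) (partial_op S f i)) [0..<n])
         (TPair (TVar n)
           (vect_sum (map (\<lambda>i. TVScale (TVar (x i + 1 + (n + 1))) (TVar (n - 1 - i))) [0..<n])))))"

lemma AD_op_eq:
  "AD_op S f ds = foldr TCasePair (map (\<lambda>i. shift (2 * i) (ds ! i)) [0..<length ds]) (AD_op_body S f (length ds))"
  by (simp add: AD_op_def AD_op_body_def Let_def)

text \<open>What matters is that the right-hand side is free of \<open>\<gamma>\<close>: all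
  variables of the body are bound by the pair cases and the lets, and \<open>partial_op\<close> sees
  only the \<open>n\<close> values.\<close>

lemma sem_AD_op_body:
  assumes typed: "\<And>i. i < n \<Longrightarrow> has_type S (replicate n Real) (partial_op S f i) Real"
    and n: "length ps = n"
  shows "sem S C k (AD_op_body S f n) (dual_env ps @ \<gamma>) =
    Option.bind (op_sem S f (map fst ps)) (\<lambda>y.
      Option.bind (those (map (\<lambda>i. sem S C k (partial_op S f i) (map (\<lambda>p. VReal (fst p)) ps)) [0..<n]))
        (\<lambda>zs. Some (mk_dual (y, \<lambda>j. \<Sum>i<n. snd (ps ! i) j * un_real (zs ! i)))))"
proof -
  let ?E = "dual_env ps :: 'b val list" and ?vs = "map (\<lambda>p. VReal (fst p)) ps :: 'b val list"
  let ?x = "\<lambda>l. 2 * (n - 1 - l)"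
  let ?es = "map (\<lambda>i. ren (\<lambda>l. ?x l + 1 + i) (partial_op S f i)) [0..<n]"
  let ?ts = "map (\<lambda>i. TVScale (TVar (?x i + 1 + (n + 1))) (TVar (n - 1 - i))) [0..<n] :: 'a tm list"
  let ?D = "\<lambda>i. sem S C k (partial_op S f i) ?vs"
  have E: "?E ! ?x l = VReal (fst (ps ! l))" "?E ! Suc (?x l) = VVect (snd (ps ! l))" "Suc (?x l) < length ?E"
    if "l < n" for l
    using dual_env_nth[of l ps] that n by auto
  have args: "those (map (\<lambda>t. t (?E @ \<gamma>)) (map (sem S C k) (map (\<lambda>l. TVar (?x l)) [0..<n]))) = Some ?vs"
  proof -
    have "map (\<lambda>t. t (?E @ \<gamma>)) (map (sem S C k) (map (\<lambda>l. TVar (?x l)) [0..<n])) = map Some ?vs"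
      by (rule nth_equalityI) (use E n in \<open>auto simp: nth_append\<close>)
    then show ?thesis by (simp only: those_map_Some)
  qed
  have inner: "sem S C k (foldr TLet ?es (TPair (TVar n) (vect_sum ?ts))) (VReal y # ?E @ \<gamma>) =
      Option.bind (those (map ?D [0..<n]))
        (\<lambda>zs. Some (mk_dual (y, \<lambda>j. \<Sum>i<n. snd (ps ! i) j * un_real (zs ! i))))" for y
  proof -
    have "sem S C k (foldr TLet ?es (TPair (TVar n) (vect_sum ?ts))) ([VReal y] @ ?E @ \<gamma>) =
      Option.bind (those (map ?D [0..<length ?es]))
        (\<lambda>zs. sem S C k (TPair (TVar n) (vect_sum ?ts)) (rev zs @ [VReal y] @ ?E @ \<gamma>))"
    proof (rule sem_lets)
      fix i and ws :: "'b val list"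
      assume i: "i < length ?es" and ws: "length ws = i + length [VReal y :: 'b val]"
      have "sem S C k (ren (\<lambda>l. ?x l + 1 + i) (partial_op S f i)) (ws @ ?E @ \<gamma>) = ?D i"
        by (rule sem_ren_typed[OF typed]) (use i E(1,3) ws n in \<open>simp_all add: nth_append\<close>)
      then show "sem S C k (?es ! i) (ws @ ?E @ \<gamma>) = ?D i" using i by simp
    qed
    moreover have "sem S C k (TPair (TVar n) (vect_sum ?ts)) (rev zs @ [VReal y] @ ?E @ \<gamma>) =
        Some (mk_dual (y, \<lambda>j. \<Sum>i<n. snd (ps ! i) j * un_real (zs ! i)))" if zs: "length zs = n" for zs
    proof -
      have "sem S C k (vect_sum ?ts) (rev zs @ [VReal y] @ ?E @ \<gamma>) =
        Some (VVect (\<lambda>j. \<Sum>i<length ?ts. snd (ps ! i) j * un_real (zs ! i)))"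
      proof (rule sem_vect_sum)
        fix i assume "i < length ?ts"
        then have i: "i < n" by simp
        \<comment> \<open>The \<open>n\<close> derivatives and \<open>y\<close> lie on top of
          \<open>?E\<close>, which accounts for \<open>n + 1\<close>; the other 1 leads from a value
          to its tangent. Among the derivatives the last one has index 0, so number \<open>i\<close>
          is found at \<open>n - 1 - i\<close>.\<close>
        have "(rev zs @ [VReal y] @ ?E @ \<gamma>) ! (?x i + 1 + (n + 1)) = VVect (snd (ps ! i))"
          using E(2,3)[OF i] zs by (simp add: nth_append)
        moreover have "(rev zs @ [VReal y] @ ?E @ \<gamma>) ! (n - 1 - i) = zs ! i"
          using i zs by (simp add: nth_append rev_nth)
        ultimately show "sem S C k (?ts ! i) (rev zs @ [VReal y] @ ?E @ \<gamma>) =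
            Some (VVect (\<lambda>j. snd (ps ! i) j * un_real (zs ! i)))"
          using i by simp
      qed
      then show ?thesis using zs by (simp add: mk_dual_eq nth_append)
    qed
    ultimately show ?thesis
      using length_those[of "map ?D [0..<n]"] by (cases "those (map ?D [0..<n])") simp_all
  qed
  show ?thesis
    unfolding AD_op_body_def Let_def sem.simps args
    using inner by (cases "op_sem S f (map fst ps)") (simp_all add: o_def)
qed

text \<open>The map \<open>dual_deriv (op_map S f)\<close> transported to lists of values. Replacing
  the transform of a primitive by it removes every reference to the chosen terms
  \<open>partial_op\<close>.\<close>

definition op_dual :: "'op signature \<Rightarrow> 'op \<Rightarrow> 'f val list \<Rightarrow> 'f val option" where
  "op_dual S f vs = (let ps = map un_dual vs; x = map fst ps in
     map_option (\<lambda>y. mk_dual (y, \<lambda>c. \<Sum>l<length ps. partial_deriv (op_map S f) () 0 l x * snd (ps ! l) c))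
       (op_sem S f x))"

text \<open>Soundness determines the value of the body in the environment
  \<open>dual_env ps @ map mk_dual ps\<close>; since the trailing part does not influence it, the
  value is known in every environment. Soundness covers tangent vectors in
  \<open>vect_space k\<close> only, hence the condition on the values of \<open>ds\<close>.\<close>

lemma sem_AD_op:
  assumes wf: "wf_signature S" and sound: "sound_for_primitives S C N" and depth: "tm_depth (AD_prim S f) \<le> N"
    and len: "length ds = arity S f"
    and ds: "\<And>d v. d \<in> set ds \<Longrightarrow> sem S C k d \<gamma> = Some v \<Longrightarrow> v \<in> mk_dual ` (UNIV \<times> vect_space k)"
  shows "sem S C k (AD_op S f ds) \<gamma> = Option.bind (those (map (\<lambda>d. sem S C k d \<gamma>) ds)) (op_dual S f)"
proof -
  let ?n = "arity S f"
  have typed: "\<And>i. i < ?n \<Longrightarrow> has_type S (replicate ?n Real) (partial_op S f i) Real"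
    using wf by (simp add: wf_signature_def)
  have body: "sem S C k (AD_op_body S f ?n) (dual_env ps @ \<gamma>) = op_dual S f (map mk_dual ps)"
    if ps: "length ps = ?n" "set ps \<subseteq> UNIV \<times> vect_space k" for ps and \<gamma> :: "'b val list"
  proof -
    let ?vs = "map mk_dual ps :: 'b val list"
    let ?ds = "map TVar [0..<?n] :: 'a tm list"
    have vars: "those (map (\<lambda>d. sem S C k d ?vs) ?ds) = Some ?vs"
    proof -
      have "map (\<lambda>d. sem S C k d ?vs) ?ds = map Some ?vs" by (rule nth_equalityI) (use ps in auto)
      then show ?thesis by (simp only: those_map_Some)
    qed
    have "v \<in> range mk_dual" if "d \<in> set ?ds" "sem S C k d ?vs = Some v" for d v
      using that ps by auto
    from sem_case_pairs[of ?ds S C k ?vs "[]" 0, OF this]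
    have prim: "sem S C k (AD_prim S f) ?vs = sem S C k (AD_op_body S f ?n) (dual_env ps @ ?vs)"
      using vars by (simp add: AD_prim_def AD_op_eq o_def)
    have eq: "map_option (\<lambda>v. ((), [un_dual v])) (sem S C k (AD_prim S f) ?vs) = dual_deriv (op_map S f) ((), ps)"
      using sound depth ps unfolding sound_for_primitives_def by blast
    \<comment> \<open>One result \<open>r\<close> for both environments. It is a pair of numbers
      rather than a value, so comparing it with soundness through \<open>un_dual\<close> loses no
      information.\<close>
    obtain r where r: "sem S C k (AD_op_body S f ?n) (dual_env ps @ \<gamma>) = map_option mk_dual r"
      "sem S C k (AD_op_body S f ?n) (dual_env ps @ ?vs) = map_option mk_dual r"
    proof -
      let ?zs = "those (map (\<lambda>i. sem S C k (partial_op S f i) (map (\<lambda>p. VReal (fst p)) ps :: 'b val list)) [0..<?n])"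
      let ?r = "Option.bind (op_sem S f (map fst ps)) (\<lambda>y.
        map_option (\<lambda>zs. (y, \<lambda>j. \<Sum>i<?n. snd (ps ! i) j * un_real (zs ! i))) ?zs)"
      have "sem S C k (AD_op_body S f ?n) (dual_env ps @ \<gamma>) = map_option mk_dual ?r" for \<gamma> :: "'b val list"
        by (subst sem_AD_op_body[OF _ ps(1)], rule typed, assumption, cases "op_sem S f (map fst ps)"; cases ?zs)
          simp_all
      then show ?thesis using that by blast
    qed
    have "map_option (\<lambda>v. ((), [v])) r = dual_deriv (op_map S f) ((), ps)"
      using eq unfolding prim r(2) by (simp add: option.map_comp o_def)
    then show ?thesis
      unfolding r(1) op_dual_def dual_deriv_def op_map_def Let_def
      by (cases r; cases "op_sem S f (map fst ps)") (auto simp: o_def)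
  qed
  have "v \<in> range mk_dual" if "d \<in> set ds" "sem S C k d \<gamma> = Some v" for d v
    using ds[OF that] by blast
  from sem_case_pairs[of ds S C k \<gamma> "[]" 0, OF this]
  have "sem S C k (AD_op S f ds) \<gamma> = Option.bind (those (map (\<lambda>d. sem S C k d \<gamma>) ds))
      (\<lambda>vs. sem S C k (AD_op_body S f ?n) (dual_env (map un_dual vs) @ \<gamma>))"
    by (simp add: AD_op_eq len)
  also have "\<dots> = Option.bind (those (map (\<lambda>d. sem S C k d \<gamma>) ds)) (op_dual S f)"
  proof (rule Option.bind_cong[OF refl])
    fix vs assume vs: "those (map (\<lambda>d. sem S C k d \<gamma>) ds) = Some vs"
    have mem: "v \<in> mk_dual ` (UNIV \<times> vect_space k)" if "v \<in> set vs" for v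
    proof -
      have "Some v \<in> set (map (\<lambda>d. sem S C k d \<gamma>) ds)" unfolding those_eq_Some[OF vs] using that by simp
      then show ?thesis unfolding set_map by (elim imageE) (rule ds, assumption, rule sym)
    qed
    have v: "mk_dual (un_dual v) = v" "un_dual v \<in> UNIV \<times> vect_space k" if "v \<in> set vs" for v
      using mem[OF that] by auto
    have "set (map un_dual vs) \<subseteq> UNIV \<times> vect_space k" unfolding set_map using v(2) by blast
    moreover have "length (map un_dual vs) = ?n" using length_those[OF vs] len by simp
    moreover have "map mk_dual (map un_dual vs) = vs" using v(1) by (simp add: map_idI)
    ultimately show "sem S C k (AD_op_body S f ?n) (dual_env (map un_dual vs) @ \<gamma>) = op_dual S f vs"
      using body by metis
  qed
  finally show ?thesis .
qed

section \<open>Depth bounds, and continuity of transformed terms\<close>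

lemma tm_depth_case_pairs:
  "tm_depth (foldr TCasePair es b) \<le> N \<longleftrightarrow> (\<forall>e\<in>set es. tm_depth e \<le> N) \<and> tm_depth b \<le> N"
  by (induction es) auto

lemma tm_depth_AD_op:
  "tm_depth (AD_op S f ds) \<le> N \<longleftrightarrow> (\<forall>d\<in>set ds. tm_depth d \<le> N) \<and> tm_depth (AD_op_body S f (length ds)) \<le> N"
  unfolding AD_op_eq tm_depth_case_pairs by (auto simp: shift_def all_set_conv_all_nth)

text \<open>Both transforms contain the same body, and the arguments of \<open>AD_prim\<close> are
  variables, of depth 0. So the bound on the transformed program makes soundness applicable to each
  primitive that occurs in it.\<close>

lemma tm_depth_AD_prim:
  assumes "tm_depth (AD_op S f ds) \<le> N" "length ds = arity S f"
  shows "tm_depth (AD_prim S f) \<le> N"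
  using assms unfolding AD_prim_def AD.simps tm_depth_AD_op by simp

text \<open>Annotations are bounded because \<open>AD\<close> keeps them up to \<open>AD_ty\<close>,
  which preserves depth. The type of a variable bound without annotation, as in \<open>TLet\<close>,
  is bounded because it is the type of a subterm already treated.\<close>

lemma has_type_src_typed:
  "has_type S \<Gamma> t \<tau> \<Longrightarrow> src_tm t \<Longrightarrow> tm_depth (AD S t) \<le> N \<Longrightarrow> list_all (small_src N) \<Gamma> \<Longrightarrow> src_typed S N \<Gamma> t \<tau>"
proof (induction rule: has_type.induct)
  case (2 \<Gamma> t \<sigma> s \<tau>)
  then have t: "src_typed S N \<Gamma> t \<sigma>" by simp
  then show ?case using 2 src_typed_small[OF t] by (auto intro: src_typed.Let)
next
  case (4 ts f \<Gamma>)
  then show ?case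
    using tm_depth_AD_prim[of S f "map (AD S) ts" N]
    by (auto intro!: src_typed.Op simp: tm_depth_AD_op list_all_iff)
next
  case (8 \<Gamma> r \<sigma> \<rho> t \<tau> s)
  then have r: "src_typed S N \<Gamma> r (Sum \<sigma> \<rho>)" by simp
  then show ?case using 8 src_typed_small[OF r] by (auto intro: src_typed.CaseSum)
next
  case (11 \<Gamma> r \<sigma> \<rho> t \<tau>)
  then have r: "src_typed S N \<Gamma> r (Prod \<sigma> \<rho>)" by simp
  then show ?case using 11 src_typed_small[OF r] by (auto intro: src_typed.CasePair)
next
  case (15 \<sigma> \<Gamma> t \<tau> s)
  then have s: "src_typed S N \<Gamma> s \<sigma>" by simp
  then show ?case using 15 src_typed_small[OF s] by (auto intro: src_typed.Iterate)
qed (auto intro: src_typed.intros simp: small_src_def fun_depth_AD_ty)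

lemma carr_dual: "carr (ty_cpo C k (AD_ty Real)) = mk_dual ` (UNIV \<times> vect_space k)"
  by (auto simp: carr_prod_poset mk_dual_def image_iff)

lemma vect_space_sum:
  fixes n :: nat
  assumes "\<And>l. l < n \<Longrightarrow> w l \<in> vect_space k"
  shows "(\<lambda>c. \<Sum>l<n. a l * w l c) \<in> vect_space k"
proof -
  have sub: "{c. (\<Sum>l<n. a l * w l c) \<noteq> 0} \<subseteq> (\<Union>l<n. {c. w l c \<noteq> 0})"
  proof
    fix c assume "c \<in> {c. (\<Sum>l<n. a l * w l c) \<noteq> 0}"
    then have "\<not> (\<forall>l\<in>{..<n}. a l * w l c = 0)" using sum.neutral[of "{..<n}" "\<lambda>l. a l * w l c"] by blast
    then show "c \<in> (\<Union>l<n. {c. w l c \<noteq> 0})" by auto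
  qed
  moreover have "finite (\<Union>l<n. {c. w l c \<noteq> 0})" using assms by (auto simp: vect_space_def)
  ultimately have "finite {c. (\<Sum>l<n. a l * w l c) \<noteq> 0}" by (rule finite_subset)
  moreover have "1 \<le> c \<and> enat c \<le> k" if "(\<Sum>l<n. a l * w l c) \<noteq> 0" for c
    using subsetD[OF sub, of c] that assms by (auto simp: vect_space_def)
  ultimately show ?thesis by (auto simp: vect_space_def)
qed

lemma op_dual_carr:
  assumes "set vs \<subseteq> carr (ty_cpo C k (AD_ty Real))"
  shows "op_dual S f vs \<in> carr (lift (ty_cpo C k (AD_ty Real)))"
proof -
  have "un_dual v \<in> UNIV \<times> vect_space k" if "v \<in> set vs" for v
    using that assms unfolding carr_dual by auto
  then have "(\<lambda>c. \<Sum>l<length vs. a l * snd (un_dual (vs ! l)) c) \<in> vect_space k" for a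
    by (intro vect_space_sum) (metis mem_Sigma_iff nth_mem prod.collapse)
  then show ?thesis
    by (cases "op_sem S f (map fst (map un_dual vs))")
      (auto simp: op_dual_def Let_def carr_dual simp del: AD_ty.simps ty_cpo.simps)
qed

text \<open>Agreement on environments within the carriers is enough; the description of
  \<open>AD_op\<close> by \<open>op_dual\<close> is available only there.\<close>

lemma cont_in_cong:
  assumes Ps: "list_all omega_cpo Ps" and \<psi>: "cont_in Ps Q \<psi>"
    and eq: "\<And>\<gamma>. chain_sup_env Ps (\<lambda>_. \<gamma>) \<gamma> \<Longrightarrow> \<phi> \<gamma> = \<psi> \<gamma>"
  shows "cont_in Ps Q \<phi>"
  unfolding cont_in_def
proof (intro allI impI)
  fix X s assume X: "chain_sup_env Ps X s"
  show "chain_sup (lift Q) (\<lambda>n. \<phi> (X n)) (\<phi> s)"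
    using cont_inD[OF \<psi> X] eq[OF chain_sup_env_const_of(1)[OF Ps X]] eq[OF chain_sup_env_const_of(2)[OF Ps X]]
    by simp
qed

lemma cont_in_carr: "cont_in Ps Q \<phi> \<Longrightarrow> chain_sup_env Ps (\<lambda>_. \<gamma>) \<gamma> \<Longrightarrow> \<phi> \<gamma> \<in> carr (lift Q)"
  by (drule (1) cont_inD) (rule chain_sup_carr)

locale sound_AD = faithful_coding C N k for C :: "'f coding" and N k +
  fixes S :: "'op signature"
  assumes wf: "wf_signature S" and sound: "sound_for_primitives S C N"
begin

text \<open>The induction is on the source derivation and not on the transformed term. At a
  primitive the transform is exchanged for \<open>op_dual\<close>, whose arguments are flat;
  elsewhere the transform keeps the shape of the term or adds a pair.\<close>

lemma AD_sem_cont: "src_typed S N \<Gamma> t \<tau> \<Longrightarrow> cont_in (map (\<lambda>\<tau>. AD_cpo \<tau>) \<Gamma>) (AD_cpo \<tau>) (sem S C k (AD S t))"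
proof (induction rule: src_typed.induct)
  case (Var \<Gamma> i)
  then show ?case using cont_var[OF AD_cpos[OF Var(1)], of i] by simp
next
  case (Let \<Gamma> t \<sigma> s \<tau>)
  note small = Let.hyps[THEN src_typed_small]
  show ?case using cont_let[OF AD_cpos AD_cpo AD_cpo Let.IH(1)] Let.IH(2) small by simp
next
  case (Const \<Gamma> c)
  have "(\<lambda>j. 0) \<in> vect_space k" by (simp add: vect_space_def)
  then show ?case
    by (auto intro!: cont_const omega_cpo_discrete omega_cpo_prod simp: carr_prod_poset)
next
  case (Op \<Gamma> ts f)
  have "cont_in (map (\<lambda>\<tau>. AD_cpo \<tau>) \<Gamma>) (AD_cpo Real)
      (\<lambda>\<gamma>. Option.bind (those (map (\<lambda>d. d \<gamma>) (map (sem S C k) (map (AD S) ts)))) (op_dual S f))"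
  proof (rule cont_those[OF AD_cpos[OF Op(1)] AD_cpo[of Real] AD_cpo[of Real]])
    fix V v and n :: nat assume "chain_sup (AD_cpo Real) V v"
    then show "V n = v" by (auto elim!: chain_sup_prod_cases)
  next
    show "op_dual S f vs \<in> carr (lift (AD_cpo Real))" if "set vs \<subseteq> carr (AD_cpo Real)" for vs
      using that by (rule op_dual_carr)
  qed (use Op in \<open>auto simp del: AD_ty.simps\<close>)
  then show ?case
  proof (rule cont_in_cong[OF AD_cpos[OF Op(1)]])
    fix \<gamma> assume \<gamma>: "chain_sup_env (map (\<lambda>\<tau>. AD_cpo \<tau>) \<Gamma>) (\<lambda>_. \<gamma>) \<gamma>"
    have "sem S C k (AD_op S f (map (AD S) ts)) \<gamma> =
        Option.bind (those (map (\<lambda>d. sem S C k d \<gamma>) (map (AD S) ts))) (op_dual S f)"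
    proof (rule sem_AD_op[OF wf sound Op.hyps(3)])
      fix d v assume "d \<in> set (map (AD S) ts)" "sem S C k d \<gamma> = Some v"
      then show "v \<in> mk_dual ` (UNIV \<times> vect_space k)"
        using cont_in_carr[OF _ \<gamma>, of "AD_cpo Real" "sem S C k d"] Op.IH
        by (auto simp: carr_dual simp del: AD_ty.simps ty_cpo.simps)
    qed (use Op in simp)
    then show "sem S C k (AD S (TOp f ts)) \<gamma> =
        Option.bind (those (map (\<lambda>d. d \<gamma>) (map (sem S C k) (map (AD S) ts)))) (op_dual S f)"
      by (simp add: o_def)
  qed
next
  case (CaseZero \<Gamma> t \<tau>)
  note small = CaseZero.hyps(1)[THEN src_typed_small]
  show ?case using cont_case_zero[OF AD_cpos AD_cpo] CaseZero small by simp
next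
  case (Inl \<Gamma> t \<tau> \<sigma>)
  note small = Inl.hyps(1)[THEN src_typed_small]
  show ?case using cont_inl[OF AD_cpos AD_cpo AD_cpo Inl.IH] Inl.hyps(2) small by simp
next
  case (Inr \<Gamma> t \<sigma> \<tau>)
  note small = Inr.hyps(1)[THEN src_typed_small]
  show ?case using cont_inr[OF AD_cpos AD_cpo AD_cpo Inr.IH] Inr.hyps(2) small by simp
next
  case (CaseSum \<Gamma> r \<sigma> \<rho> t \<tau> s)
  note small = CaseSum.hyps[THEN src_typed_small]
  show ?case using cont_case_sum[OF AD_cpos AD_cpo AD_cpo AD_cpo, of \<Gamma> \<sigma> \<rho> \<tau>] CaseSum.IH small by simp
next
  case (Unit \<Gamma>)
  then show ?case by (auto intro!: cont_const omega_cpo_discrete)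
next
  case (Pair \<Gamma> t \<tau> s \<sigma>)
  note small = Pair.hyps[THEN src_typed_small]
  show ?case using cont_pair[OF AD_cpos AD_cpo AD_cpo Pair.IH] small by simp
next
  case (CasePair \<Gamma> r \<sigma> \<rho> t \<tau>)
  note small = CasePair.hyps[THEN src_typed_small]
  show ?case using cont_case_pair[OF AD_cpos AD_cpo AD_cpo AD_cpo, of \<Gamma> \<sigma> \<rho> \<tau>] CasePair.IH small by simp
next
  case (Lam \<tau> \<Gamma> t \<sigma>)
  note small = Lam.hyps(1)[THEN src_typed_small]
  show ?case using cont_lam[OF AD_cpos AD_cpo AD_cpo AD_faithful[OF Lam.hyps(2)]] Lam.IH small by simp
next
  case (App \<Gamma> t \<tau> \<sigma> s)
  note small = App.hyps[THEN src_typed_small]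
  show ?case
    using cont_app[OF AD_cpos AD_cpo AD_cpo AD_faithful, of \<Gamma> \<tau> \<sigma>] App.IH small by (simp add: small_src_Fun del: fun_depth.simps)
next
  case (Sign \<Gamma> t)
  note small = Sign.hyps[THEN src_typed_small]
  \<comment> \<open>The sign is taken of the first component only, so the transform factors into a
    projection and a test on a discrete poset.\<close>
  have "cont_in (map (\<lambda>\<tau>. AD_cpo \<tau>) \<Gamma>) (discrete (range VReal))
      (\<lambda>\<gamma>. Option.bind (sem S C k (AD S t) \<gamma>) (\<lambda>v. case v of VPair a b \<Rightarrow> Some a | _ \<Rightarrow> None))"
    by (rule cont_bind[OF AD_cpos AD_cpo[of Real] omega_cpo_discrete])
      (use small Sign.IH in \<open>auto intro!: chain_sup_Some porder_discrete elim!: chain_sup_prod_cases\<close>)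
  then have "cont_in (map (\<lambda>\<tau>. AD_cpo \<tau>) \<Gamma>) (sum_poset (discrete {VUnit}) (discrete {VUnit}))
      (\<lambda>\<gamma>. Option.bind (Option.bind (sem S C k (AD S t) \<gamma>) (\<lambda>v. case v of VPair a b \<Rightarrow> Some a | _ \<Rightarrow> None))
      (\<lambda>v. if un_real v < 0 then Some (VInl VUnit) else if un_real v > 0 then Some (VInr VUnit) else None))"
    by (rule cont_bind[rotated 3, OF _ _ AD_cpos omega_cpo_discrete omega_cpo_sum[OF omega_cpo_discrete omega_cpo_discrete]])
      (use small in \<open>auto intro!: chain_sup_Some porder_sum porder_discrete
        simp: chain_sup_sum_Inl chain_sup_sum_Inr\<close>)
  then show ?case by (simp cong: val.case_cong)
next
  case (Iterate \<sigma> \<Gamma> t \<tau> s)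
  note small = Iterate.hyps[THEN src_typed_small]
  show ?case using cont_iterate[OF AD_cpos AD_cpo AD_cpo, of \<Gamma> \<sigma> \<tau>] Iterate.IH small by simp
next
  case (Mu \<tau> \<sigma> \<Gamma> t)
  note small = Mu.hyps[THEN src_typed_small]
  show ?case
    using cont_mu[OF AD_cpos AD_cpo AD_cpo AD_faithful, of \<Gamma> \<tau> \<sigma>] Mu.IH small by (simp add: small_src_Fun del: fun_depth.simps)
qed

end

section \<open>Derivatives at a point\<close>

text \<open>The filter of full, not punctured, neighbourhoods: what holds eventually holds at
  \<open>x\<close>, and germs become statements with \<open>eventually\<close>. The length is part
  of each neighbourhood because \<open>eucl_dist\<close> would read entries that shorter lists do
  not have.\<close>

definition nhds_Rn :: "nat \<Rightarrow> real list \<Rightarrow> real list filter" where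
  "nhds_Rn n x = (INF d\<in>{0<..}. principal {y. length y = n \<and> eucl_dist x y < d})"

lemma eventually_nhds_Rn:
  "eventually P (nhds_Rn n x) \<longleftrightarrow> (\<exists>d>0. \<forall>y. length y = n \<longrightarrow> eucl_dist x y < d \<longrightarrow> P y)"
proof -
  have "eventually P (nhds_Rn n x) \<longleftrightarrow>
      (\<exists>d\<in>{0<..}. eventually P (principal {y. length y = n \<and> eucl_dist x y < d}))"
    unfolding nhds_Rn_def
  proof (rule eventually_INF_base)
    fix a b :: real assume "a \<in> {0<..}" "b \<in> {0<..}"
    then show "\<exists>c\<in>{0<..}. principal {y. length y = n \<and> eucl_dist x y < c} \<le>
        inf (principal {y. length y = n \<and> eucl_dist x y < a}) (principal {y. length y = n \<and> eucl_dist x y < b})"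
      by (intro bexI[of _ "min a b"]) auto
  qed auto
  then show ?thesis by (auto simp: eventually_principal)
qed

lemma eucl_dist_self [simp]: "eucl_dist x x = 0"
  by (simp add: eucl_dist_def L2_set_def)

lemma eucl_dist_nonneg [simp]: "0 \<le> eucl_dist x y"
  by (simp add: eucl_dist_def)

lemma eventually_nhds_Rn_self: "length x = n \<Longrightarrow> eventually P (nhds_Rn n x) \<Longrightarrow> P x"
  by (auto simp: eventually_nhds_Rn)

lemma eventually_length: "eventually (\<lambda>y. length y = n) (nhds_Rn n x)"
  by (auto simp: eventually_nhds_Rn intro: exI[of _ 1])

lemma eventually_eucl_dist: "d > 0 \<Longrightarrow> eventually (\<lambda>y. eucl_dist x y < d) (nhds_Rn n x)"
  by (auto simp: eventually_nhds_Rn)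

lemma eucl_dist_coord: "l < length x \<Longrightarrow> \<bar>y ! l - x ! l\<bar> \<le> eucl_dist x y"
proof -
  assume l: "l < length x"
  have "(y ! l - x ! l)\<^sup>2 \<le> (\<Sum>i<length x. (y ! i - x ! i)\<^sup>2)"
    by (rule member_le_sum) (use l in auto)
  from real_sqrt_le_mono[OF this] show ?thesis by (simp add: eucl_dist_def L2_set_def)
qed

text \<open>Frechet differentiability of a scalar function with gradient \<open>A\<close>, in the
  error form of \<open>differentiable_Rn\<close>. Vector-valued maps are treated by components, so
  that a tuple of results is a list of pairs of a function and a gradient.\<close>

definition has_deriv :: "nat \<Rightarrow> real list \<Rightarrow> (real list \<Rightarrow> real) \<Rightarrow> (nat \<Rightarrow> real) \<Rightarrow> bool" where
  "has_deriv n x g A \<longleftrightarrow> (\<forall>e>0. \<forall>\<^sub>F y in nhds_Rn n x.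
     \<bar>g y - g x - (\<Sum>l<n. A l * (y ! l - x ! l))\<bar> \<le> e * eucl_dist x y)"

lemma has_derivD:
  "has_deriv n x g A \<Longrightarrow> e > 0 \<Longrightarrow>
    \<forall>\<^sub>F y in nhds_Rn n x. \<bar>g y - g x - (\<Sum>l<n. A l * (y ! l - x ! l))\<bar> \<le> e * eucl_dist x y"
  by (simp add: has_deriv_def)

lemma has_deriv_cong:
  assumes "length x = n" "\<forall>\<^sub>F y in nhds_Rn n x. g y = h y" "has_deriv n x g A"
  shows "has_deriv n x h A"
  unfolding has_deriv_def
proof (intro allI impI)
  fix e :: real assume "e > 0"
  from assms(2) has_derivD[OF assms(3) this]
  show "\<forall>\<^sub>F y in nhds_Rn n x. \<bar>h y - h x - (\<Sum>l<n. A l * (y ! l - x ! l))\<bar> \<le> e * eucl_dist x y"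
    by eventually_elim (use eventually_nhds_Rn_self[OF assms(1,2)] in simp)
qed

lemma has_deriv_const: "has_deriv n x (\<lambda>_. c) (\<lambda>_. 0)"
  by (simp add: has_deriv_def)

lemma has_deriv_nth:
  assumes "i < n"
  shows "has_deriv n x (\<lambda>y. y ! i) (\<lambda>l. if l = i then 1 else 0)"
proof -
  have "(\<Sum>l<n. (if l = i then 1 else 0) * (y ! l - x ! l)) = y ! i - x ! i" for y :: "real list"
    using assms by (simp add: if_distrib[of "\<lambda>c. c * _"] sum.delta cong: if_cong)
  then show ?thesis by (simp add: has_deriv_def)
qed

text \<open>The error bound at \<open>e = 1\<close> contributes the 1, the linear part contributes
  the sum of the absolute values of the coefficients.\<close>

lemma has_deriv_lipschitz:
  assumes x: "length x = n" and g: "has_deriv n x g A"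
  shows "\<forall>\<^sub>F y in nhds_Rn n x. \<bar>g y - g x\<bar> \<le> (1 + (\<Sum>l<n. \<bar>A l\<bar>)) * eucl_dist x y"
  using has_derivD[OF g, of 1, simplified]
proof eventually_elim
  case (elim y)
  have "\<bar>\<Sum>l<n. A l * (y ! l - x ! l)\<bar> \<le> (\<Sum>l<n. \<bar>A l\<bar> * eucl_dist x y)"
    by (rule order_trans[OF sum_abs])
      (auto simp: abs_mult x intro!: sum_mono mult_left_mono eucl_dist_coord)
  then have "\<bar>\<Sum>l<n. A l * (y ! l - x ! l)\<bar> \<le> (\<Sum>l<n. \<bar>A l\<bar>) * eucl_dist x y"
    by (simp only: sum_distrib_right)
  with elim show ?case unfolding distrib_right by linarith
qed

lemma has_deriv_continuous:
  assumes x: "length x = n" and g: "has_deriv n x g A" and d: "d > 0"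
  shows "\<forall>\<^sub>F y in nhds_Rn n x. \<bar>g y - g x\<bar> < d"
proof -
  let ?K = "1 + (\<Sum>l<n. \<bar>A l\<bar>)"
  have K: "?K > 0" by (simp add: add_pos_nonneg sum_nonneg)
  then have "\<forall>\<^sub>F y in nhds_Rn n x. eucl_dist x y < d / ?K" by (intro eventually_eucl_dist) (simp add: d)
  then show ?thesis
    using has_deriv_lipschitz[OF x g]
  proof eventually_elim
    case (elim y)
    then have "eucl_dist x y * ?K < d" using K by (simp add: pos_less_divide_eq)
    with elim show ?case by (simp add: mult.commute)
  qed
qed

text \<open>The Euclidean norm is at most the sum of the absolute values of the components. The 1
  added to the sum of their constants keeps \<open>K\<close> positive for an empty list, so that it
  can be divided by.\<close>

lemma eucl_dist_map_lipschitz: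
  assumes x: "length x = n" and g: "\<And>i. i < length gs \<Longrightarrow> has_deriv n x (gs ! i) (A i)"
  obtains K where "K > 0"
    "\<forall>\<^sub>F y in nhds_Rn n x. eucl_dist (map (\<lambda>g. g x) gs) (map (\<lambda>g. g y) gs) \<le> K * eucl_dist x y"
proof -
  define k where "k i = 1 + (\<Sum>l<n. \<bar>A i l\<bar>)" for i
  have "\<forall>\<^sub>F y in nhds_Rn n x. \<forall>i\<in>{..<length gs}. \<bar>(gs ! i) y - (gs ! i) x\<bar> \<le> k i * eucl_dist x y"
    unfolding k_def by (rule eventually_ball_finite) (auto intro: has_deriv_lipschitz[OF x g])
  then have "\<forall>\<^sub>F y in nhds_Rn n x.
      eucl_dist (map (\<lambda>g. g x) gs) (map (\<lambda>g. g y) gs) \<le> (1 + (\<Sum>i<length gs. k i)) * eucl_dist x y"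
  proof eventually_elim
    case (elim y)
    have "eucl_dist (map (\<lambda>g. g x) gs) (map (\<lambda>g. g y) gs) \<le> (\<Sum>i<length gs. \<bar>(gs ! i) y - (gs ! i) x\<bar>)"
      unfolding eucl_dist_def by (rule order_trans[OF L2_set_le_sum_abs]) simp
    also have "\<dots> \<le> (\<Sum>i<length gs. k i * eucl_dist x y)"
      using elim by (intro sum_mono) auto
    also have "\<dots> \<le> (1 + (\<Sum>i<length gs. k i)) * eucl_dist x y"
      by (simp add: distrib_right sum_distrib_right)
    finally show ?case .
  qed
  moreover have "1 + (\<Sum>i<length gs. k i) > 0" by (simp add: k_def add_pos_nonneg sum_nonneg)
  ultimately show ?thesis using that by blast
qed

lemma eventually_nhds_Rn_map:
  assumes x: "length x = n" and g: "\<And>i. i < length gs \<Longrightarrow> has_deriv n x (gs ! i) (A i)"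
    and P: "eventually P (nhds_Rn (length gs) (map (\<lambda>g. g x) gs))"
  shows "\<forall>\<^sub>F y in nhds_Rn n x. P (map (\<lambda>g. g y) gs)"
proof -
  obtain d where d: "d > 0"
    "\<And>z. length z = length gs \<Longrightarrow> eucl_dist (map (\<lambda>g. g x) gs) z < d \<Longrightarrow> P z"
    using P by (auto simp: eventually_nhds_Rn)
  obtain K where K: "K > 0"
    "\<forall>\<^sub>F y in nhds_Rn n x. eucl_dist (map (\<lambda>g. g x) gs) (map (\<lambda>g. g y) gs) \<le> K * eucl_dist x y"
    using eucl_dist_map_lipschitz[OF x g] by blast
  have "\<forall>\<^sub>F y in nhds_Rn n x. eucl_dist x y < d / K" using d(1) K(1) by (intro eventually_eucl_dist) simp
  with K(2) show ?thesis
  proof eventually_elim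
    case (elim y)
    then have "K * eucl_dist x y < d" using K(1) by (simp add: pos_less_divide_eq mult.commute)
    then show ?case using d(2)[of "map (\<lambda>g. g y) gs"] elim by simp
  qed
qed

lemma has_deriv_chain:
  assumes x: "length x = n" and g: "\<And>i. i < length gs \<Longrightarrow> has_deriv n x (gs ! i) (A i)"
    and \<phi>: "has_deriv (length gs) (map (\<lambda>g. g x) gs) \<phi> B"
  shows "has_deriv n x (\<lambda>y. \<phi> (map (\<lambda>g. g y) gs)) (\<lambda>l. \<Sum>i<length gs. B i * A i l)"
  unfolding has_deriv_def
proof (intro allI impI)
  fix e :: real assume e: "e > 0"
  let ?G = "\<lambda>y. map (\<lambda>g. g y) gs" and ?m = "length gs"
  obtain K where K: "K > 0" "\<forall>\<^sub>F y in nhds_Rn n x. eucl_dist (?G x) (?G y) \<le> K * eucl_dist x y"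
    using eucl_dist_map_lipschitz[OF x g] by blast
  define b where "b = 1 + (\<Sum>i<?m. \<bar>B i\<bar>)"
  have b: "b > 0" by (simp add: b_def add_pos_nonneg sum_nonneg)
  \<comment> \<open>Each half of the error pays for one approximation: the outer error
    \<open>e1\<close> is magnified by the Lipschitz constant \<open>K\<close> of the inner tuple,
    the inner error \<open>e2\<close> by the coefficients of the outer gradient, which
    \<open>b\<close> bounds.\<close>
  define e1 e2 where "e1 = e / (2 * K)" and "e2 = e / (2 * b)"
  have e12: "e1 > 0" "e2 > 0" using e K(1) b by (simp_all add: e1_def e2_def)
  have "\<forall>\<^sub>F y in nhds_Rn n x. \<bar>\<phi> (?G y) - \<phi> (?G x) - (\<Sum>i<?m. B i * (?G y ! i - ?G x ! i))\<bar>
      \<le> e1 * eucl_dist (?G x) (?G y)"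
    by (rule eventually_nhds_Rn_map[OF x g has_derivD[OF \<phi> e12(1)]])
  moreover have "\<forall>\<^sub>F y in nhds_Rn n x. \<forall>i\<in>{..<?m}.
      \<bar>(gs ! i) y - (gs ! i) x - (\<Sum>l<n. A i l * (y ! l - x ! l))\<bar> \<le> e2 * eucl_dist x y"
    by (rule eventually_ball_finite) (auto intro: has_derivD[OF g e12(2)])
  ultimately show "\<forall>\<^sub>F y in nhds_Rn n x. \<bar>\<phi> (?G y) - \<phi> (?G x) -
      (\<Sum>l<n. (\<Sum>i<?m. B i * A i l) * (y ! l - x ! l))\<bar> \<le> e * eucl_dist x y"
    using K(2)
  proof eventually_elim
    case (elim y)
    let ?D = "eucl_dist x y"
    let ?r = "\<lambda>i. (gs ! i) y - (gs ! i) x - (\<Sum>l<n. A i l * (y ! l - x ! l))"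
    let ?s = "\<phi> (?G y) - \<phi> (?G x) - (\<Sum>i<?m. B i * (?G y ! i - ?G x ! i))"
    have "(\<Sum>l<n. (\<Sum>i<?m. B i * A i l) * (y ! l - x ! l)) = (\<Sum>i<?m. B i * (\<Sum>l<n. A i l * (y ! l - x ! l)))"
      by (simp add: sum_distrib_right sum_distrib_left mult.assoc) (rule sum.swap)
    then have eq: "\<phi> (?G y) - \<phi> (?G x) - (\<Sum>l<n. (\<Sum>i<?m. B i * A i l) * (y ! l - x ! l)) =
        ?s + (\<Sum>i<?m. B i * ?r i)"
      by (simp add: sum_subtractf right_diff_distrib)
    have "\<bar>?s\<bar> \<le> e1 * (K * ?D)"
      using elim(1,3) e12(1) by (meson mult_left_mono order_trans less_imp_le)
    also have "\<dots> = e / 2 * ?D" using K(1) by (simp add: e1_def)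
    finally have 1: "\<bar>?s\<bar> \<le> e / 2 * ?D" .
    have "\<bar>\<Sum>i<?m. B i * ?r i\<bar> \<le> (\<Sum>i<?m. \<bar>B i\<bar> * (e2 * ?D))"
      by (rule order_trans[OF sum_abs]) (use elim(2) in \<open>auto simp: abs_mult intro!: sum_mono mult_left_mono\<close>)
    also have "\<dots> \<le> b * (e2 * ?D)"
      unfolding b_def distrib_right sum_distrib_right using e12(2) by simp
    also have "\<dots> = e / 2 * ?D" using b by (simp add: e2_def)
    finally have "\<bar>\<Sum>i<?m. B i * ?r i\<bar> \<le> e / 2 * ?D" .
    with 1 have "\<bar>?s\<bar> + \<bar>\<Sum>i<?m. B i * ?r i\<bar> \<le> e / 2 * ?D + e / 2 * ?D" by (rule add_mono)
    also have "\<dots> = e * ?D" by simp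
    finally show ?case unfolding eq by (rule order_trans[OF abs_triangle_ineq])
  qed
qed

text \<open>Along a coordinate line the distance is the absolute value of the increment, and only
  one term of the linear part survives.\<close>

lemma has_deriv_imp_DERIV:
  assumes x: "length x = n" and g: "has_deriv n x g A" and l: "l < n"
  shows "((\<lambda>u. g (x[l := u])) has_real_derivative A l) (at (x ! l))"
  unfolding has_field_derivative_def has_derivative_at_alt
proof (intro conjI allI impI)
  fix e :: real assume "e > 0"
  from has_derivD[OF g this] obtain d where d: "d > 0"
    "\<And>y. length y = n \<Longrightarrow> eucl_dist x y < d \<Longrightarrow>
      \<bar>g y - g x - (\<Sum>l<n. A l * (y ! l - x ! l))\<bar> \<le> e * eucl_dist x y"
    by (auto simp: eventually_nhds_Rn)
  have nth: "x[l := u] ! i - x ! i = (if i = l then u - x ! l else 0)" if "i < n" for i u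
    using that x by simp
  have dist: "eucl_dist x (x[l := u]) = \<bar>u - x ! l\<bar>" for u
  proof -
    have "(\<Sum>i<n. (x[l := u] ! i - x ! i)\<^sup>2) = (\<Sum>i<n. if i = l then (u - x ! l)\<^sup>2 else 0)"
      by (intro sum.cong refl) (simp add: nth)
    then show ?thesis using l by (simp add: eucl_dist_def L2_set_def x)
  qed
  have sum: "(\<Sum>i<n. A i * (x[l := u] ! i - x ! i)) = A l * (u - x ! l)" for u
  proof -
    have "(\<Sum>i<n. A i * (x[l := u] ! i - x ! i)) = (\<Sum>i<n. if i = l then A l * (u - x ! l) else 0)"
      by (intro sum.cong refl) (simp add: nth)
    then show ?thesis using l by simp
  qed
  show "\<exists>d>0. \<forall>u. norm (u - x ! l) < d \<longrightarrow>
      norm (g (x[l := u]) - g (x[l := x ! l]) - A l * (u - x ! l)) \<le> e * norm (u - x ! l)"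
    using d(1) d(2)[of "x[l := _]"] x by (intro exI[of _ d]) (auto simp: dist sum)
qed (rule bounded_linear_mult_right)

text \<open>Ordinary derivatives are unique, so whatever gradient has been produced, its entries are
  the partial derivatives. This connects the relation, which only claims that some gradient exists,
  with the formula in \<open>dual_deriv\<close>.\<close>

lemma has_deriv_imp_partial_deriv:
  assumes x: "length x = n" and g: "has_deriv n x g A" and l: "l < n"
    and h: "\<forall>\<^sub>F y in nhds_Rn n x. snd (the (h (i, y))) ! q = g y"
  shows "partial_deriv h i q l x = A l"
proof -
  have "\<forall>\<^sub>F y in nhds_Rn n x. g y = snd (the (h (i, y))) ! q" using h by eventually_elim simp
  from has_deriv_cong[OF x this g] show ?thesis
    unfolding partial_deriv_def by (intro DERIV_imp_deriv has_deriv_imp_DERIV[OF x _ l])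
qed

lemma wf_signature_has_deriv:
  assumes wf: "wf_signature S" and x: "length x = arity S f" and y: "op_sem S f x = Some y"
  shows "\<forall>\<^sub>F z in nhds_Rn (arity S f) x. op_sem S f z \<noteq> None"
    and "has_deriv (arity S f) x (\<lambda>z. the (op_sem S f z)) (\<lambda>l. partial_deriv (op_map S f) () 0 l x)"
proof -
  let ?n = "arity S f"
  let ?W = "{x. length x = ?n \<and> (\<exists>y. op_map S f ((), x) = Some ((), y))}"
  let ?F = "\<lambda>x. snd (the (op_map S f ((), x)))"
  have W: "open_Rn ?n ?W" "differentiable_Rn ?n 1 ?W ?F"
    using wf by (simp_all add: wf_signature_def differentiable_map_def Let_def)
  have mem: "x \<in> ?W" using x y by (simp add: op_map_def)
  then obtain d where "d > 0" "\<And>z. length z = ?n \<and> eucl_dist x z < d \<Longrightarrow> z \<in> ?W"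
    using W(1) unfolding open_Rn_def by blast
  then have ev: "\<forall>\<^sub>F z in nhds_Rn ?n x. z \<in> ?W"
    unfolding eventually_nhds_Rn by blast
  then show def: "\<forall>\<^sub>F z in nhds_Rn ?n x. op_sem S f z \<noteq> None"
    by eventually_elim (auto simp: op_map_def)
  have F: "?F z ! 0 = the (op_sem S f z)" if "op_sem S f z \<noteq> None" for z
    using that by (auto simp: op_map_def)
  obtain A where A: "\<forall>e>0. \<exists>d>0. \<forall>z\<in>?W. eucl_dist x z < d \<longrightarrow>
     L2_set (\<lambda>q. ?F z ! q - ?F x ! q - (\<Sum>l<?n. A q l * (z ! l - x ! l))) {..<1} \<le> e * eucl_dist x z"
    using W(2) mem unfolding differentiable_Rn_def by blast
  have d1: "has_deriv ?n x (\<lambda>z. ?F z ! 0) (A 0)"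
    unfolding has_deriv_def
  proof (intro allI impI)
    fix e :: real assume "e > 0"
    then obtain d where d: "d > 0" "\<And>z. z \<in> ?W \<Longrightarrow> eucl_dist x z < d \<Longrightarrow>
       L2_set (\<lambda>q. ?F z ! q - ?F x ! q - (\<Sum>l<?n. A q l * (z ! l - x ! l))) {..<1} \<le> e * eucl_dist x z"
      using A by blast
    from ev eventually_eucl_dist[OF d(1)]
    show "\<forall>\<^sub>F z in nhds_Rn ?n x. \<bar>?F z ! 0 - ?F x ! 0 - (\<Sum>l<?n. A 0 l * (z ! l - x ! l))\<bar> \<le> e * eucl_dist x z"
    proof eventually_elim
      case (elim z)
      from d(2)[OF this] show ?case by (simp add: L2_set_def lessThan_Suc)
    qed
  qed
  have eq: "\<forall>\<^sub>F z in nhds_Rn ?n x. ?F z ! 0 = the (op_sem S f z)"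
    using def by eventually_elim (rule F)
  have "has_deriv ?n x (\<lambda>z. the (op_sem S f z)) (A 0)" by (rule has_deriv_cong[OF x eq d1])
  \<comment> \<open>Differentiability supplies some matrix; its first row agrees with the partial
    derivatives at all \<open>l < ?n\<close>, the entries that \<open>has_deriv\<close>
    sees.\<close>
  moreover have "partial_deriv (op_map S f) () 0 l x = A 0 l" if "l < ?n" for l
    by (rule has_deriv_imp_partial_deriv[OF x d1 that]) simp
  ultimately show "has_deriv ?n x (\<lambda>z. the (op_sem S f z)) (\<lambda>l. partial_deriv (op_map S f) () 0 l x)"
    by (simp add: has_deriv_def)
qed

section \<open>The logical relation\<close>

lemma chain_sup_lift_the:
  assumes P: "porder P" and X: "chain_sup (lift P) X s" and ne: "X 0 \<noteq> None"
  shows "s \<noteq> None \<and> (\<forall>n. X n \<noteq> None) \<and> chain_sup P (\<lambda>n. the (X n)) (the s)"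
proof (cases s)
  case None
  then show ?thesis using X ne by simp
next
  case (Some t)
  then obtain N Y where Y: "chain_sup P Y t" "\<forall>n<N. X n = None" "\<forall>n. X (n + N) = Some (Y n)"
    using X by (auto simp: chain_sup_lift_Some[OF P])
  then have "N = 0" using ne by (cases N) auto
  with Y Some show ?thesis by simp
qed

locale related_at = sound_AD C N k S for C :: "'f coding" and N k and S :: "'op signature" +
  fixes ps :: "(real \<times> (nat \<Rightarrow> real)) list"
  assumes ps: "set ps \<subseteq> UNIV \<times> vect_space k"
begin

abbreviation "x0 \<equiv> map fst ps"
abbreviation "F \<equiv> nhds_Rn (length ps) x0"
abbreviation "deriv_at \<equiv> has_deriv (length ps) x0"

definition tangent :: "(nat \<Rightarrow> real) \<Rightarrow> nat \<Rightarrow> real" where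
  "tangent A c = (\<Sum>l<length ps. A l * snd (ps ! l) c)"

lemma tangent_vect_space: "tangent A \<in> vect_space k"
proof -
  have "(\<lambda>c. \<Sum>l<length ps. A l * snd (ps ! l) c) \<in> vect_space k"
    using ps by (intro vect_space_sum) (auto dest: nth_mem)
  then show ?thesis by (simp add: tangent_def[abs_def])
qed

lemma at_x0: "eventually P F \<Longrightarrow> P x0"
  by (rule eventually_nhds_Rn_self) simp_all

text \<open>The asymmetry reflects domains of differentiable maps: being defined is an open
  condition and is demanded nearby, being undefined is recorded at the point only.\<close>

definition rel_lift ::
    "((real list \<Rightarrow> 'f val) \<Rightarrow> 'f val \<Rightarrow> bool) \<Rightarrow> (real list \<Rightarrow> 'f val option) \<Rightarrow> 'f val option \<Rightarrow> bool" where
  "rel_lift R f v \<longleftrightarrow> (v = None \<and> f x0 = None) \<or>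
     (\<exists>g u. (\<forall>\<^sub>F y in F. f y = Some (g y)) \<and> v = Some u \<and> R g u)"

text \<open>\<open>rel \<tau> f v\<close> relates the germ at \<open>x0\<close> of a family \<open>f\<close> of elements of \<open>\<lbrakk>\<tau>\<rbrakk>\<close> to the value \<open>v\<close> that
  the transform assigns to \<open>f\<close> at the tuple \<open>ps\<close> of dual numbers. Since only germs matter, a
  partial family with value \<open>\<bottom>\<close> at \<open>x0\<close> is related to \<open>\<bottom>\<close> whatever it does nearby.\<close>

primrec rel :: "ty \<Rightarrow> (real list \<Rightarrow> 'f val) \<Rightarrow> 'f val \<Rightarrow> bool" where
  "rel Real = (\<lambda>f v. \<exists>g A. deriv_at g A \<and> (\<forall>\<^sub>F y in F. f y = VReal (g y)) \<and> v = mk_dual (g x0, tangent A))"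
| "rel Zero = (\<lambda>f v. False)"
| "rel One = (\<lambda>f v. (\<forall>\<^sub>F y in F. f y = VUnit) \<and> v = VUnit)"
| "rel (Sum \<tau> \<sigma>) = (\<lambda>f v. (\<exists>g u. (\<forall>\<^sub>F y in F. f y = VInl (g y)) \<and> v = VInl u \<and> rel \<tau> g u) \<or>
     (\<exists>g u. (\<forall>\<^sub>F y in F. f y = VInr (g y)) \<and> v = VInr u \<and> rel \<sigma> g u))"
| "rel (Prod \<tau> \<sigma>) = (\<lambda>f v. \<exists>g h u w. (\<forall>\<^sub>F y in F. f y = VPair (g y) (h y)) \<and> v = VPair u w \<and>
     rel \<tau> g u \<and> rel \<sigma> h w)"
| "rel (Fun \<tau> \<sigma>) = (\<lambda>f v. (\<forall>\<^sub>F y in F. f y \<in> carr (fun_poset C (cpo \<tau>) (cpo \<sigma>))) \<and>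
     v \<in> carr (fun_poset C (AD_cpo \<tau>) (AD_cpo \<sigma>)) \<and>
     (\<forall>a a'. rel \<tau> a a' \<longrightarrow> rel_lift (rel \<sigma>) (\<lambda>y. apply_val C (f y) (a y)) (apply_val C v a')))"
| "rel Vect = (\<lambda>f v. False)"

lemma rel_RealI: "deriv_at g A \<Longrightarrow> rel Real (\<lambda>y. VReal (g y)) (mk_dual (g x0, tangent A))"
  unfolding rel.simps by (intro exI[of _ g] exI[of _ A] conjI) simp_all

lemma rel_lift_cong:
  assumes eq: "\<forall>\<^sub>F y in F. f y = g y" and "rel_lift R f v"
  shows "rel_lift R g v"
  using assms(2) unfolding rel_lift_def
proof (elim disjE exE conjE)
  assume "v = None" "f x0 = None"
  then show "(v = None \<and> g x0 = None) \<or> (\<exists>h u. (\<forall>\<^sub>F y in F. g y = Some (h y)) \<and> v = Some u \<and> R h u)"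
    using at_x0[OF eq] by simp
next
  fix h u assume *: "\<forall>\<^sub>F y in F. f y = Some (h y)" "v = Some u" "R h u"
  from eq *(1) have "\<forall>\<^sub>F y in F. g y = Some (h y)" by eventually_elim simp
  with * show "(v = None \<and> g x0 = None) \<or> (\<exists>h u. (\<forall>\<^sub>F y in F. g y = Some (h y)) \<and> v = Some u \<and> R h u)"
    by blast
qed

lemma rel_lift_None: "f x0 = None \<Longrightarrow> rel_lift R f None"
  by (simp add: rel_lift_def)

lemma rel_liftI: "\<forall>\<^sub>F y in F. f y = Some (g y) \<Longrightarrow> R g u \<Longrightarrow> rel_lift R f (Some u)"
  unfolding rel_lift_def by (intro disjI2 exI[of _ g] exI[of _ u] conjI refl)

lemma rel_lift_Some: "R g u \<Longrightarrow> rel_lift R (\<lambda>y. Some (g y)) (Some u)"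
  by (rule rel_liftI) simp_all

text \<open>If the first computation is bottom at \<open>x0\<close>, so is the composite, whatever
  happens nearby. Otherwise the germ \<open>g\<close> can be substituted for its result.
  \<open>K\<close> may depend on the point because the environment does.\<close>

lemma rel_lift_bind:
  assumes f: "rel_lift R f v"
    and K: "\<And>g u. R g u \<Longrightarrow> rel_lift R' (\<lambda>y. K y (g y)) (\<kappa> u)"
  shows "rel_lift R' (\<lambda>y. Option.bind (f y) (K y)) (Option.bind v \<kappa>)"
  using f unfolding rel_lift_def[of R]
proof (elim disjE exE conjE)
  assume "v = None" "f x0 = None"
  then show ?thesis by (simp add: rel_lift_None)
next
  fix g u assume *: "\<forall>\<^sub>F y in F. f y = Some (g y)" "v = Some u" "R g u"
  from *(1) have "\<forall>\<^sub>F y in F. K y (g y) = Option.bind (f y) (K y)" by eventually_elim simp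
  from rel_lift_cong[OF this K[OF *(3)]] show ?thesis by (simp add: *(2))
qed

text \<open>A case distinction suffices, without induction: each clause of \<open>rel\<close> meets
  \<open>f\<close> only under \<open>eventually\<close> or by applying it.\<close>

lemma rel_cong:
  assumes eq: "\<forall>\<^sub>F y in F. f y = g y" and f: "rel \<tau> f v"
  shows "rel \<tau> g v"
proof -
  have tr: "\<forall>\<^sub>F y in F. g y = h y" if "\<forall>\<^sub>F y in F. f y = h y" for h
    using eq that by eventually_elim simp
  show ?thesis
  proof (cases \<tau>)
    case (Fun \<tau>1 \<tau>2)
    have "\<forall>\<^sub>F y in F. g y \<in> carr (fun_poset C (cpo \<tau>1) (cpo \<tau>2))"
      using f Fun eq by (auto elim: eventually_elim2)
    moreover have "rel_lift (rel \<tau>2) (\<lambda>y. apply_val C (g y) (a y)) (apply_val C v a')" if "rel \<tau>1 a a'" for a a'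
    proof (rule rel_lift_cong)
      show "\<forall>\<^sub>F y in F. apply_val C (f y) (a y) = apply_val C (g y) (a y)"
        using eq by eventually_elim simp
    qed (use f Fun that in simp)
    ultimately show ?thesis using f Fun by simp
  next
    case Real
    then obtain h A where "deriv_at h A" "\<forall>\<^sub>F y in F. f y = VReal (h y)" "v = mk_dual (h x0, tangent A)"
      using f by auto
    then show ?thesis unfolding Real rel.simps by (intro exI[of _ h] exI[of _ A] conjI tr)
  next
    case (Sum \<tau>1 \<tau>2)
    show ?thesis
      using f unfolding Sum rel.simps
    proof (elim disjE exE conjE)
      fix h u assume "\<forall>\<^sub>F y in F. f y = VInl (h y)" "v = VInl u" "rel \<tau>1 h u"
      then show "(\<exists>h u. (\<forall>\<^sub>F y in F. g y = VInl (h y)) \<and> v = VInl u \<and> rel \<tau>1 h u) \<or>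
          (\<exists>h u. (\<forall>\<^sub>F y in F. g y = VInr (h y)) \<and> v = VInr u \<and> rel \<tau>2 h u)"
        by (intro disjI1 exI[of _ h] exI[of _ u] conjI tr)
    next
      fix h u assume "\<forall>\<^sub>F y in F. f y = VInr (h y)" "v = VInr u" "rel \<tau>2 h u"
      then show "(\<exists>h u. (\<forall>\<^sub>F y in F. g y = VInl (h y)) \<and> v = VInl u \<and> rel \<tau>1 h u) \<or>
          (\<exists>h u. (\<forall>\<^sub>F y in F. g y = VInr (h y)) \<and> v = VInr u \<and> rel \<tau>2 h u)"
        by (intro disjI2 exI[of _ h] exI[of _ u] conjI tr)
    qed
  next
    case (Prod \<tau>1 \<tau>2)
    then obtain h h' u w where *: "\<forall>\<^sub>F y in F. f y = VPair (h y) (h' y)" "v = VPair u w"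
      "rel \<tau>1 h u" "rel \<tau>2 h' w" using f by auto
    show ?thesis
      unfolding Prod rel.simps
      by (intro exI[of _ h] exI[of _ h'] exI[of _ u] exI[of _ w] conjI tr *)
  qed (use f tr in auto)
qed

text \<open>Abstractions and loops are cut off outside the carriers and suprema are taken inside
  them, so related data must be known to lie there before anything can be unfolded.\<close>

lemma rel_carr: "rel \<tau> f v \<Longrightarrow> (\<forall>\<^sub>F y in F. f y \<in> carr (cpo \<tau>)) \<and> v \<in> carr (AD_cpo \<tau>)"
proof (induction \<tau> arbitrary: f v)
  case Real
  then obtain g A where "\<forall>\<^sub>F y in F. f y = VReal (g y)" "v = mk_dual (g x0, tangent A)" by auto
  then show ?case
    using tangent_vect_space by (auto simp: carr_dual simp del: AD_ty.simps elim!: eventually_mono)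
next
  case (Sum \<tau> \<sigma>)
  from Sum.prems consider
    (1) g u where "\<forall>\<^sub>F y in F. f y = VInl (g y)" "v = VInl u" "rel \<tau> g u"
    | (2) g u where "\<forall>\<^sub>F y in F. f y = VInr (g y)" "v = VInr u" "rel \<sigma> g u" by auto
  then show ?case
  proof cases
    case 1
    from 1(1) Sum.IH(1)[OF 1(3), THEN conjunct1] have "\<forall>\<^sub>F y in F. f y \<in> carr (cpo (Sum \<tau> \<sigma>))"
      by eventually_elim (simp add: carr_sum_poset)
    then show ?thesis using Sum.IH(1)[OF 1(3)] 1(2) by (simp add: carr_sum_poset)
  next
    case 2
    from 2(1) Sum.IH(2)[OF 2(3), THEN conjunct1] have "\<forall>\<^sub>F y in F. f y \<in> carr (cpo (Sum \<tau> \<sigma>))"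
      by eventually_elim (simp add: carr_sum_poset)
    then show ?thesis using Sum.IH(2)[OF 2(3)] 2(2) by (simp add: carr_sum_poset)
  qed
next
  case (Prod \<tau> \<sigma>)
  then obtain g h u w where *: "\<forall>\<^sub>F y in F. f y = VPair (g y) (h y)" "v = VPair u w"
    "rel \<tau> g u" "rel \<sigma> h w" by auto
  from *(1) Prod.IH(1)[OF *(3), THEN conjunct1] Prod.IH(2)[OF *(4), THEN conjunct1]
  have "\<forall>\<^sub>F y in F. f y \<in> carr (cpo (Prod \<tau> \<sigma>))"
    by eventually_elim (simp add: carr_prod_poset)
  then show ?case using Prod.IH(1)[OF *(3)] Prod.IH(2)[OF *(4)] *(2) by (simp add: carr_prod_poset)
qed (auto elim: eventually_mono)

text \<open>Admissibility at \<open>\<tau>\<close> is a hypothesis here, because the lemma is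
  already used within the induction that proves it, for the results of functions.\<close>

lemma rel_lift_admissible:
  assumes adm: "\<And>X f V v. (\<And>m::nat. rel \<tau> (X m) (V m)) \<Longrightarrow>
      \<forall>\<^sub>F y in F. chain_sup (cpo \<tau>) (\<lambda>m. X m y) (f y) \<Longrightarrow> chain_sup (AD_cpo \<tau>) V v \<Longrightarrow> rel \<tau> f v"
    and small: "small_src N \<tau>"
    and X: "\<And>m::nat. rel_lift (rel \<tau>) (X m) (V m)"
    and f: "\<forall>\<^sub>F y in F. chain_sup (lift (cpo \<tau>)) (\<lambda>m. X m y) (f y)"
    and v: "chain_sup (lift (AD_cpo \<tau>)) V v"
  shows "rel_lift (rel \<tau>) f v"
proof (cases v)
  note po = cpo_porder[OF small] AD_cpo_porder[OF small]
  case None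
  then have "V m = None" for m using v by simp
  \<comment> \<open>A right-hand bottom says something only at \<open>x0\<close>, and that is
    enough: \<open>f x0\<close> is the supremum of the \<open>X m x0\<close>.\<close>
  then have "X m x0 = None" for m using X[of m] by (auto simp: rel_lift_def)
  then have "chain_sup (lift (cpo \<tau>)) (\<lambda>_. None) (f x0)" using at_x0[OF f] by simp
  then have "f x0 = None" by (cases "f x0") (auto simp: chain_sup_lift_Some[OF po(1)])
  then show ?thesis by (simp add: None rel_lift_None)
next
  note po = cpo_porder[OF small] AD_cpo_porder[OF small]
  case (Some w)
  then obtain M U where U: "chain_sup (AD_cpo \<tau>) U w" "\<forall>m. V (m + M) = Some (U m)"
    using v by (auto simp: chain_sup_lift_Some[OF po(2)])
  define Y where "Y m y = the (X (m + M) y)" for m y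
  have Y: "rel \<tau> (Y m) (U m)" and XM: "\<forall>\<^sub>F y in F. X (m + M) y \<noteq> None" for m
  proof -
    obtain h where h: "\<forall>\<^sub>F y in F. X (m + M) y = Some (h y)" "rel \<tau> h (U m)"
      using X[of "m + M"] U(2) by (auto simp: rel_lift_def)
    have "\<forall>\<^sub>F y in F. h y = Y m y" using h(1) by eventually_elim (simp add: Y_def)
    then show "rel \<tau> (Y m) (U m)" using h(2) by (rule rel_cong)
    show "\<forall>\<^sub>F y in F. X (m + M) y \<noteq> None" using h(1) by eventually_elim simp
  qed
  have "\<forall>\<^sub>F y in F. f y = Some (the (f y)) \<and> chain_sup (cpo \<tau>) (\<lambda>m. Y m y) (the (f y))"
    \<comment> \<open>A single neighbourhood is used, that of the first defined member. Later
      members are defined on it because the chain increases; infinitely many neighbourhoods never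
      have to be intersected.\<close>
    using f XM[of 0]
  proof eventually_elim
    case (elim y)
    from chain_sup_lift_the[OF po(1) chain_sup_shift[OF porder_lift[OF po(1)] elim(1), of M]] elim(2)
    show ?case by (simp add: Y_def)
  qed
  then have ev: "\<forall>\<^sub>F y in F. f y = Some (the (f y))"
    "\<forall>\<^sub>F y in F. chain_sup (cpo \<tau>) (\<lambda>m. Y m y) (the (f y))"
    by (auto elim: eventually_mono)
  have "rel \<tau> (\<lambda>y. the (f y)) w" by (rule adm[of Y, OF Y ev(2) U(1)])
  then show ?thesis using ev(1) unfolding Some by (intro rel_liftI[where g = "\<lambda>y. the (f y)"])
qed

text \<open>At \<open>Real\<close> and \<open>One\<close> chains are constant, so the limit germ is
  that of \<open>X 0\<close>. At sums and products the germs are taken apart uniformly in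
  \<open>m\<close>. At function types application reduces the claim to the lifted result
  type.\<close>

lemma rel_admissible:
  "small_src N \<tau> \<Longrightarrow> (\<And>m::nat. rel \<tau> (X m) (V m)) \<Longrightarrow>
    \<forall>\<^sub>F y in F. chain_sup (cpo \<tau>) (\<lambda>m. X m y) (f y) \<Longrightarrow> chain_sup (AD_cpo \<tau>) V v \<Longrightarrow> rel \<tau> f v"
proof (induction \<tau> arbitrary: X f V v)
  case Real
  have "\<forall>\<^sub>F y in F. X 0 y = f y" using Real(3) by eventually_elim simp
  moreover have "V 0 = v" using Real(4) by (auto elim!: chain_sup_prod_cases)
  ultimately show ?case using rel_cong[OF _ Real(2)[of 0]] by blast
next
  case Zero
  then show ?case by simp
next
  case One
  have "\<forall>\<^sub>F y in F. X 0 y = f y" using One(3) by eventually_elim simp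
  moreover have "V 0 = v" using One(4) by simp
  ultimately show ?case using rel_cong[OF _ One(2)[of 0]] by blast
next
  case (Sum \<tau> \<sigma>)
  \<comment> \<open>Both injections at once. The chain stays in one summand, so near
    \<open>x0\<close> the germ of \<open>X 0\<close> alone decides where all members and the limit
    lie, and \<open>inv i\<close> extracts the components for all \<open>m\<close>
    simultaneously.\<close>
  have germ: "\<exists>Y g. (\<forall>m. rel \<rho> (Y m) (U m)) \<and> (\<forall>\<^sub>F y in F. f y = i (g y)) \<and>
      (\<forall>\<^sub>F y in F. chain_sup (cpo \<rho>) (\<lambda>m. Y m y) (g y))"
    if r: "\<And>m. \<exists>h. (\<forall>\<^sub>F y in F. X m y = i (h y)) \<and> rel \<rho> h (U m)"
      and i: "\<And>X s. chain_sup Q X s \<Longrightarrow> X 0 \<in> range i \<Longrightarrow> \<exists>Y a. X = (\<lambda>m. i (Y m)) \<and> s = i a \<and> chain_sup (cpo \<rho>) Y a"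
      and X: "\<forall>\<^sub>F y in F. chain_sup Q (\<lambda>m. X m y) (f y)" and inj: "inj i"
    for \<rho> i U Q
  proof (intro exI conjI allI)
    let ?Y = "\<lambda>m y. inv i (X m y)"
    show "rel \<rho> (?Y m) (U m)" for m
    proof -
      obtain h where h: "\<forall>\<^sub>F y in F. X m y = i (h y)" "rel \<rho> h (U m)" using r by blast
      have "\<forall>\<^sub>F y in F. h y = ?Y m y" using h(1) by eventually_elim (simp add: inj)
      then show ?thesis using h(2) by (rule rel_cong)
    qed
    obtain h where "\<forall>\<^sub>F y in F. X 0 y = i (h y)" using r by blast
    with X have "\<forall>\<^sub>F y in F. f y = i (inv i (f y)) \<and> chain_sup (cpo \<rho>) (\<lambda>m. ?Y m y) (inv i (f y))"
    proof eventually_elim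
      case (elim y)
      obtain Z a where "(\<lambda>m. X m y) = (\<lambda>m. i (Z m))" "f y = i a" "chain_sup (cpo \<rho>) Z a"
        using i[OF elim(1)] elim(2) by auto
      then show ?case using inj by (simp add: fun_eq_iff)
    qed
    then show "\<forall>\<^sub>F y in F. f y = i (inv i (f y))" "\<forall>\<^sub>F y in F. chain_sup (cpo \<rho>) (\<lambda>m. ?Y m y) (inv i (f y))"
      by (auto elim: eventually_mono)
  qed
  have sup: "\<forall>\<^sub>F y in F. chain_sup (sum_poset (cpo \<tau>) (cpo \<sigma>)) (\<lambda>m. X m y) (f y)"
    using Sum.prems(3) by simp
  have "chain_sup (sum_poset (AD_cpo \<tau>) (AD_cpo \<sigma>)) V v" using Sum.prems(4) by simp
  then show ?case
  proof (cases rule: chain_sup_sum_cases)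
    case (Inl U u)
    have r: "\<exists>h. (\<forall>\<^sub>F y in F. X m y = VInl (h y)) \<and> rel \<tau> h (U m)" for m
      using Sum.prems(2)[of m] Inl(1) by auto
    obtain Y g where Y: "\<And>m. rel \<tau> (Y m) (U m)" and g: "\<forall>\<^sub>F y in F. f y = VInl (g y)"
      "\<forall>\<^sub>F y in F. chain_sup (cpo \<tau>) (\<lambda>m. Y m y) (g y)"
      using germ[OF r _ sup] by (auto elim!: chain_sup_sum_cases simp: fun_eq_iff inj_def)
    have "rel \<tau> g u" by (rule Sum.IH(1)[of Y U, OF _ Y g(2) Inl(3)]) (use Sum.prems(1) in simp)
    then show ?thesis using g(1) Inl(2) by auto
  next
    case (Inr U u)
    have r: "\<exists>h. (\<forall>\<^sub>F y in F. X m y = VInr (h y)) \<and> rel \<sigma> h (U m)" for m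
      using Sum.prems(2)[of m] Inr(1) by auto
    obtain Y g where Y: "\<And>m. rel \<sigma> (Y m) (U m)" and g: "\<forall>\<^sub>F y in F. f y = VInr (g y)"
      "\<forall>\<^sub>F y in F. chain_sup (cpo \<sigma>) (\<lambda>m. Y m y) (g y)"
      using germ[OF r _ sup] by (auto elim!: chain_sup_sum_cases simp: fun_eq_iff inj_def)
    have "rel \<sigma> g u" by (rule Sum.IH(2)[of Y U, OF _ Y g(2) Inr(3)]) (use Sum.prems(1) in simp)
    then show ?thesis using g(1) Inr(2) by auto
  qed
next
  case (Prod \<tau> \<sigma>)
  have "chain_sup (prod_poset (AD_cpo \<tau>) (AD_cpo \<sigma>)) V v" using Prod.prems(4) by simp
  then obtain U W u w where V: "V = (\<lambda>m. VPair (U m) (W m))" "v = VPair u w"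
    "chain_sup (AD_cpo \<tau>) U u" "chain_sup (AD_cpo \<sigma>) W w" by (rule chain_sup_prod_cases)
  \<comment> \<open>The components are chosen by one formula for all \<open>m\<close> and
    \<open>y\<close>. The witnesses in the relation exist for each \<open>m\<close> separately and
    agree with these on neighbourhoods that may depend on \<open>m\<close>.\<close>
  define Y where "Y m y = (case X m y of VPair a b \<Rightarrow> a)" for m y
  define Z where "Z m y = (case X m y of VPair a b \<Rightarrow> b)" for m y
  define g where "g y = (case f y of VPair a b \<Rightarrow> a)" for y
  define h where "h y = (case f y of VPair a b \<Rightarrow> b)" for y
  have Y: "rel \<tau> (Y m) (U m)" and Z: "rel \<sigma> (Z m) (W m)" for m
  proof -
    obtain g' h' where gh: "\<forall>\<^sub>F y in F. X m y = VPair (g' y) (h' y)" "rel \<tau> g' (U m)" "rel \<sigma> h' (W m)"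
      using Prod.prems(2)[of m] V(1) by auto
    have "\<forall>\<^sub>F y in F. g' y = Y m y" using gh(1) by eventually_elim (simp add: Y_def)
    then show "rel \<tau> (Y m) (U m)" using gh(2) by (rule rel_cong)
    have "\<forall>\<^sub>F y in F. h' y = Z m y" using gh(1) by eventually_elim (simp add: Z_def)
    then show "rel \<sigma> (Z m) (W m)" using gh(3) by (rule rel_cong)
  qed
  have "\<forall>\<^sub>F y in F. f y = VPair (g y) (h y) \<and> chain_sup (cpo \<tau>) (\<lambda>m. Y m y) (g y) \<and>
      chain_sup (cpo \<sigma>) (\<lambda>m. Z m y) (h y)"
    using Prod.prems(3)
  proof eventually_elim
    case (elim y)
    then have "chain_sup (prod_poset (cpo \<tau>) (cpo \<sigma>)) (\<lambda>m. X m y) (f y)" by simp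
    then show ?case
    proof (rule chain_sup_prod_cases)
      fix Y' Z' a b assume *: "(\<lambda>m. X m y) = (\<lambda>m. VPair (Y' m) (Z' m))" "f y = VPair a b"
        "chain_sup (cpo \<tau>) Y' a" "chain_sup (cpo \<sigma>) Z' b"
      then have "(\<lambda>m. Y m y) = Y'" "(\<lambda>m. Z m y) = Z'" by (auto simp: Y_def Z_def fun_eq_iff)
      then show ?thesis using * by (simp add: g_def h_def)
    qed
  qed
  then have ev: "\<forall>\<^sub>F y in F. f y = VPair (g y) (h y)" "\<forall>\<^sub>F y in F. chain_sup (cpo \<tau>) (\<lambda>m. Y m y) (g y)"
    "\<forall>\<^sub>F y in F. chain_sup (cpo \<sigma>) (\<lambda>m. Z m y) (h y)"
    by (auto elim: eventually_mono)
  have "rel \<tau> g u" by (rule Prod.IH(1)[of Y U, OF _ Y ev(2) V(3)]) (use Prod.prems(1) in simp)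
  moreover have "rel \<sigma> h w" by (rule Prod.IH(2)[of Z W, OF _ Z ev(3) V(4)]) (use Prod.prems(1) in simp)
  ultimately show ?case using ev(1) V(2) by auto
next
  case (Fun \<tau> \<sigma>)
  then have small: "small_src N \<tau>" "small_src N \<sigma>" by (simp_all only: small_src_Fun)
  note f1 = faithful[OF Fun.prems(1)] and f2 = AD_faithful[OF Fun.prems(1)]
  note \<tau>1 = cpo_porder[OF small(1)] and \<tau>2 = AD_cpo_porder[OF small(1)]
  have fs: "\<forall>\<^sub>F y in F. f y \<in> carr (fun_poset C (cpo \<tau>) (cpo \<sigma>)) \<and>
      sup_cont (cpo \<tau>) (lift (cpo \<sigma>)) (\<lambda>m. apply_val C (X m y)) (apply_val C (f y))"
    using Fun.prems(3) by eventually_elim (simp add: chain_sup_fun[OF f1 \<tau>1 cpo[OF small(2)]])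
  have vs: "v \<in> carr (fun_poset C (AD_cpo \<tau>) (AD_cpo \<sigma>))"
      "sup_cont (AD_cpo \<tau>) (lift (AD_cpo \<sigma>)) (\<lambda>m. apply_val C (V m)) (apply_val C v)"
    using Fun.prems(4) by (simp_all add: chain_sup_fun[OF f2 \<tau>2 AD_cpo[OF small(2)]])
  \<comment> \<open>The argument germ is fixed, so at each nearby \<open>y\<close> a constant chain
    of arguments turns the supremum of functions into a supremum of values.\<close>
  have "rel_lift (rel \<sigma>) (\<lambda>y. apply_val C (f y) (a y)) (apply_val C v a')" if a: "rel \<tau> a a'" for a a'
  proof (rule rel_lift_admissible[where X = "\<lambda>m y. apply_val C (X m y) (a y)" and V = "\<lambda>m. apply_val C (V m) a'"])
    show "rel_lift (rel \<sigma>) (\<lambda>y. apply_val C (X m y) (a y)) (apply_val C (V m) a')" for m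
      using Fun.prems(2)[of m] a by simp
    show "\<forall>\<^sub>F y in F. chain_sup (lift (cpo \<sigma>)) (\<lambda>m. apply_val C (X m y) (a y)) (apply_val C (f y) (a y))"
      using fs rel_carr[OF a, THEN conjunct1]
      by eventually_elim (use sup_contD[OF _ chain_sup_const[OF \<tau>1]] in blast)
    show "chain_sup (lift (AD_cpo \<sigma>)) (\<lambda>m. apply_val C (V m) a') (apply_val C v a')"
      using rel_carr[OF a] by (intro sup_contD[OF vs(2) chain_sup_const[OF \<tau>2]]) simp
  qed (use Fun.IH(2)[OF small(2)] small(2) in blast)+
  moreover have "\<forall>\<^sub>F y in F. f y \<in> carr (fun_poset C (cpo \<tau>) (cpo \<sigma>))"
    using fs by eventually_elim simp
  ultimately show ?case using vs(1) by simp
next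
  case Vect
  then show ?case by (simp add: small_src_def)
qed

lemmas rel_lift_sup = rel_lift_admissible[OF rel_admissible]

section \<open>Related environments and the fundamental lemma\<close>

definition rel_env :: "ty list \<Rightarrow> (real list \<Rightarrow> 'f val) list \<Rightarrow> 'f val list \<Rightarrow> bool" where
  "rel_env \<Gamma> gs \<gamma>' \<longleftrightarrow> length gs = length \<Gamma> \<and> length \<gamma>' = length \<Gamma> \<and>
     (\<forall>i<length \<Gamma>. rel (\<Gamma> ! i) (gs ! i) (\<gamma>' ! i))"

abbreviation env :: "(real list \<Rightarrow> 'f val) list \<Rightarrow> real list \<Rightarrow> 'f val list" where
  "env gs y \<equiv> map (\<lambda>g. g y) gs"

lemma rel_env_Cons: "rel \<tau> g u \<Longrightarrow> rel_env \<Gamma> gs \<gamma>' \<Longrightarrow> rel_env (\<tau> # \<Gamma>) (g # gs) (u # \<gamma>')"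
  by (auto simp: rel_env_def less_Suc_eq_0_disj)

lemma rel_env_carr:
  assumes small: "list_all (small_src N) \<Gamma>" and r: "rel_env \<Gamma> gs \<gamma>'"
  shows "\<forall>\<^sub>F y in F. chain_sup_env (map cpo \<Gamma>) (\<lambda>_. env gs y) (env gs y)"
    and "chain_sup_env (map (\<lambda>\<tau>. AD_cpo \<tau>) \<Gamma>) (\<lambda>_. \<gamma>') \<gamma>'"
proof -
  have "\<forall>\<^sub>F y in F. \<forall>i\<in>{..<length \<Gamma>}. (gs ! i) y \<in> carr (cpo (\<Gamma> ! i))"
    by (rule eventually_ball_finite) (use r rel_carr in \<open>auto simp: rel_env_def\<close>)
  then show "\<forall>\<^sub>F y in F. chain_sup_env (map cpo \<Gamma>) (\<lambda>_. env gs y) (env gs y)"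
  proof eventually_elim
    case (elim y)
    then show ?case
      using r by (intro chain_sup_env_const[OF cpos[OF small]]) (auto simp: rel_env_def)
  qed
  show "chain_sup_env (map (\<lambda>\<tau>. AD_cpo \<tau>) \<Gamma>) (\<lambda>_. \<gamma>') \<gamma>'"
    using r rel_carr by (intro chain_sup_env_const[OF AD_cpos[OF small]]) (auto simp: rel_env_def)
qed

text \<open>For the arguments of a primitive: either bottom occurs at \<open>x0\<close> and on the
  dual side, or finitely many neighbourhoods intersect in one where all arguments are defined. The
  list \<open>qs\<close> pairs each argument function with its gradient.\<close>

lemma rel_real_those:
  assumes "\<forall>t\<in>set ts. rel_lift (rel Real) (\<phi> t) (\<theta> t)"
  shows "(those (map \<theta> ts) = None \<and> those (map (\<lambda>t. \<phi> t x0) ts) = None) \<or>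
    (\<exists>qs. length qs = length ts \<and> (\<forall>(g, A)\<in>set qs. deriv_at g A) \<and>
       (\<forall>\<^sub>F y in F. those (map (\<lambda>t. \<phi> t y) ts) = Some (map (\<lambda>(g, A). VReal (g y)) qs)) \<and>
       those (map \<theta> ts) = Some (map (\<lambda>(g, A). mk_dual (g x0, tangent A)) qs))"
    (is "?N ts \<or> (\<exists>qs. ?S ts qs)")
  using assms
proof (induction ts)
  case Nil
  have "?S [] []" by simp
  then show ?case by blast
next
  case (Cons t ts)
  have t: "rel_lift (rel Real) (\<phi> t) (\<theta> t)" using Cons.prems by simp
  show ?case
  proof (cases "\<theta> t")
    case None
    then have "\<phi> t x0 = None" using t by (auto simp: rel_lift_def)
    with None show ?thesis by simp
  next
    case (Some u)
    then obtain h where h: "\<forall>\<^sub>F y in F. \<phi> t y = Some (h y)" "rel Real h u"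
      using t by (auto simp: rel_lift_def)
    then obtain g A where g: "deriv_at g A" "\<forall>\<^sub>F y in F. h y = VReal (g y)" "u = mk_dual (g x0, tangent A)"
      by auto
    have h': "\<forall>\<^sub>F y in F. \<phi> t y = Some (VReal (g y))" using h(1) g(2) by eventually_elim simp
    have "?N ts \<or> (\<exists>qs. ?S ts qs)" by (rule Cons.IH) (use Cons.prems in simp)
    then show ?thesis
    proof (elim disjE exE)
      assume "?N ts"
      then show ?thesis using Some at_x0[OF h'] by simp
    next
      fix qs assume qs: "?S ts qs"
      have "\<forall>\<^sub>F y in F. those (map (\<lambda>t. \<phi> t y) (t # ts)) = Some (map (\<lambda>(g, A). VReal (g y)) ((g, A) # qs))"
        using qs[THEN conjunct2, THEN conjunct2, THEN conjunct1] h' by eventually_elim simp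
      then show ?thesis
        using qs g Some by (intro disjI2 exI[of _ "(g, A) # qs"]) simp
    qed
  qed
qed

text \<open>Forward mode meets the chain rule. The gradient of the composite is the combination of
  the argument gradients weighted by the partial derivatives of the primitive, and differentiating
  in the direction of the tangent vectors is linear in the gradient.\<close>

lemma rel_op:
  assumes qs: "length qs = arity S f" "\<And>g A. (g, A) \<in> set qs \<Longrightarrow> deriv_at g A"
  shows "rel_lift (rel Real)
    (\<lambda>y. map_option VReal (op_sem S f (map un_real (map (\<lambda>(g, A). VReal (g y) :: 'f val) qs))))
    (op_dual S f (map (\<lambda>(g, A). mk_dual (g x0, tangent A)) qs))"
proof -
  let ?gs = "map fst qs"
  let ?G = "\<lambda>y. map (\<lambda>g. g y) ?gs"
  have G: "map un_real (map (\<lambda>(g, A). VReal (g y) :: 'f val) qs) = ?G y" for y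
    by (simp add: split_beta)
  let ?vs = "map (\<lambda>(g, A). mk_dual (g x0, tangent A)) qs :: 'f val list"
  have U: "map fst (map un_dual ?vs) = ?G x0" by (simp add: split_beta)
  have d: "\<And>i. i < length ?gs \<Longrightarrow> deriv_at (?gs ! i) (snd (qs ! i))"
    using qs(2) by simp
  show ?thesis
  proof (cases "op_sem S f (?G x0)")
    case None
    then have "op_dual S f ?vs = None" unfolding op_dual_def Let_def U by simp
    then show ?thesis unfolding G using None by (simp only: rel_lift_None option.map)
  next
    case (Some z)
    let ?B = "\<lambda>l. partial_deriv (op_map S f) () 0 l (?G x0)"
    let ?A = "\<lambda>l. \<Sum>i<length ?gs. ?B i * snd (qs ! i) l"
    have len: "length (?G x0) = arity S f" using qs by simp
    note op = wf_signature_has_deriv[OF wf len Some]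
    have der: "deriv_at (\<lambda>y. the (op_sem S f (?G y))) ?A"
      by (rule has_deriv_chain[OF _ d]) (use op(2) qs(1) in simp_all)
    have "\<forall>\<^sub>F y in F. op_sem S f (?G y) \<noteq> None"
      by (rule eventually_nhds_Rn_map[OF _ d]) (use op(1) qs(1) in simp_all)
    then have ev: "\<forall>\<^sub>F y in F. map_option VReal (op_sem S f (?G y)) = Some (VReal (the (op_sem S f (?G y))) :: 'f val)"
      by eventually_elim auto
    \<comment> \<open>Exchanging two finite sums: combining the tangents of the arguments gives the
      tangent of the combined gradient.\<close>
    have "(\<Sum>i<length qs. ?B i * tangent (snd (qs ! i)) c) = tangent ?A c" for c
      by (simp add: tangent_def sum_distrib_left sum_distrib_right mult.assoc) (rule sum.swap)
    then have e: "op_dual S f ?vs = Some (mk_dual (the (op_sem S f (?G x0)), tangent ?A))"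
      unfolding op_dual_def Let_def U Some by (simp add: split_beta fun_eq_iff)
    show ?thesis unfolding G e by (rule rel_liftI[OF ev], rule rel_RealI[OF der])
  qed
qed

text \<open>Every application is bottom at \<open>x0\<close> on both sides, and nothing is asked
  nearby beyond membership in the function space. This covers the start of the recursion and also
  each step at which the body is bottom at \<open>x0\<close>.\<close>

lemma rel_fun_bot:
  assumes small: "small_src N (Fun \<tau> \<sigma>)"
    and f: "\<forall>\<^sub>F y in F. f y \<in> carr (fun_poset C (cpo \<tau>) (cpo \<sigma>))" and x0: "f x0 = VFun (enc C (\<lambda>_. None))"
  shows "rel (Fun \<tau> \<sigma>) f (VFun (enc C (\<lambda>_. None)))"
proof -
  have s: "small_src N \<tau>" "small_src N \<sigma>" using small by (simp_all only: small_src_Fun)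
  note po = cpo_porder[OF s(1)] cpo_porder[OF s(2)]
    AD_cpo_porder[OF s(1)] AD_cpo_porder[OF s(2)]
  have n: "(\<lambda>_. None) \<in> carr (kleisli_exp (cpo \<tau>) (cpo \<sigma>))"
    "(\<lambda>_. None) \<in> carr (kleisli_exp (AD_cpo \<tau>) (AD_cpo \<sigma>))"
    using bottom_exp[OF po(1,2)] bottom_exp[OF po(3,4)] by (simp_all add: bottom_def)
  show ?thesis
    using f enc_in_fun[OF n(2)] apply_val_enc[OF AD_faithful[OF small] n(2)]
    by (simp add: x0 rel_lift_None)
qed

lemma rel_SumE:
  assumes "rel (Sum \<tau> \<sigma>) f v"
  obtains (Inl) g u where "\<forall>\<^sub>F y in F. f y = VInl (g y)" "v = VInl u" "rel \<tau> g u"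
    | (Inr) g u where "\<forall>\<^sub>F y in F. f y = VInr (g y)" "v = VInr u" "rel \<sigma> g u"
  using assms by auto

lemma rel_InlI: "rel \<tau> g u \<Longrightarrow> rel (Sum \<tau> \<sigma>) (\<lambda>y. VInl (g y)) (VInl u)"
  unfolding rel.simps by (intro disjI1 exI[of _ g] exI[of _ u] conjI) simp_all

lemma rel_InrI: "rel \<sigma> g u \<Longrightarrow> rel (Sum \<tau> \<sigma>) (\<lambda>y. VInr (g y)) (VInr u)"
  unfolding rel.simps by (intro disjI2 exI[of _ g] exI[of _ u] conjI) simp_all

lemma rel_PairI: "rel \<tau> g u \<Longrightarrow> rel \<sigma> h w \<Longrightarrow> rel (Prod \<tau> \<sigma>) (\<lambda>y. VPair (g y) (h y)) (VPair u w)"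
  unfolding rel.simps by (intro exI[of _ g] exI[of _ h] exI[of _ u] exI[of _ w] conjI) simp_all

lemma rel_lift_case_sum:
  assumes "rel (Sum \<tau> \<sigma>) f v"
    and l: "\<And>g u. rel \<tau> g u \<Longrightarrow> rel_lift R (\<lambda>y. L y (g y)) (L' u)"
    and r: "\<And>g u. rel \<sigma> g u \<Longrightarrow> rel_lift R (\<lambda>y. K y (g y)) (K' u)"
  shows "rel_lift R (\<lambda>y. case f y of VInl a \<Rightarrow> L y a | VInr a \<Rightarrow> K y a | _ \<Rightarrow> None)
    (case v of VInl a \<Rightarrow> L' a | VInr a \<Rightarrow> K' a | _ \<Rightarrow> None)"
  using assms(1)
proof (cases rule: rel_SumE)
  case (Inl g u)
  have "\<forall>\<^sub>F y in F. L y (g y) = (case f y of VInl a \<Rightarrow> L y a | VInr a \<Rightarrow> K y a | _ \<Rightarrow> None)"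
    using Inl(1) by eventually_elim simp
  from rel_lift_cong[OF this l[OF Inl(3)]] show ?thesis by (simp add: Inl(2))
next
  case (Inr g u)
  have "\<forall>\<^sub>F y in F. K y (g y) = (case f y of VInl a \<Rightarrow> L y a | VInr a \<Rightarrow> K y a | _ \<Rightarrow> None)"
    using Inr(1) by eventually_elim simp
  from rel_lift_cong[OF this r[OF Inr(3)]] show ?thesis by (simp add: Inr(2))
qed

lemma rel_lift_case_pair:
  assumes "rel (Prod \<tau> \<sigma>) f v"
    and K: "\<And>g u h w. rel \<tau> g u \<Longrightarrow> rel \<sigma> h w \<Longrightarrow> rel_lift R (\<lambda>y. K y (g y) (h y)) (K' u w)"
  shows "rel_lift R (\<lambda>y. case f y of VPair a b \<Rightarrow> K y a b | _ \<Rightarrow> None)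
    (case v of VPair a b \<Rightarrow> K' a b | _ \<Rightarrow> None)"
proof -
  obtain g h u w where *: "\<forall>\<^sub>F y in F. f y = VPair (g y) (h y)" "v = VPair u w" "rel \<tau> g u" "rel \<sigma> h w"
    using assms(1) by auto
  have "\<forall>\<^sub>F y in F. K y (g y) (h y) = (case f y of VPair a b \<Rightarrow> K y a b | _ \<Rightarrow> None)"
    using *(1) by eventually_elim simp
  from rel_lift_cong[OF this K[OF *(3,4)]] show ?thesis by (simp add: *(2))
qed

text \<open>Away from 0 the argument is continuous and keeps its sign nearby, so the branch is
  locally constant. At 0, where the branch may jump, both sides are bottom and no condition
  remains.\<close>

lemma rel_lift_sign:
  assumes "rel Real f v"
  shows "rel_lift (rel (Sum One One))
    (\<lambda>y. if un_real (f y) < 0 then Some (VInl VUnit) else if un_real (f y) > 0 then Some (VInr VUnit) else None)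
    (case v of VPair a b \<Rightarrow>
       if un_real a < 0 then Some (VInl VUnit) else if un_real a > 0 then Some (VInr VUnit) else None | _ \<Rightarrow> None)"
    (is "rel_lift _ ?f _")
proof -
  obtain g A where g: "deriv_at g A" "\<forall>\<^sub>F y in F. f y = VReal (g y)" "v = mk_dual (g x0, tangent A)"
    using assms by auto
  have fx: "f x0 = VReal (g x0)" by (rule at_x0[OF g(2)])
  have One: "rel One (\<lambda>y. VUnit) VUnit" by simp
  consider "g x0 < 0" | "g x0 > 0" | "g x0 = 0" by linarith
  then show ?thesis
  proof cases
    case 1
    then have "\<forall>\<^sub>F y in F. \<bar>g y - g x0\<bar> < - g x0" by (intro has_deriv_continuous[OF _ g(1)]) simp_all
    with g(2) have "\<forall>\<^sub>F y in F. Some (VInl VUnit) = ?f y" by eventually_elim (simp add: abs_if split: if_splits)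
    from rel_lift_cong[OF this rel_lift_Some[where R = "rel (Sum One One)", OF rel_InlI[OF One]]] 1 show ?thesis by (simp add: g(3) mk_dual_eq)
  next
    case 2
    then have "\<forall>\<^sub>F y in F. \<bar>g y - g x0\<bar> < g x0" by (intro has_deriv_continuous[OF _ g(1)]) simp_all
    with g(2) have "\<forall>\<^sub>F y in F. Some (VInr VUnit) = ?f y" by eventually_elim (simp add: abs_if split: if_splits)
    from rel_lift_cong[OF this rel_lift_Some[where R = "rel (Sum One One)", OF rel_InrI[OF One]]] 2 show ?thesis by (simp add: g(3) mk_dual_eq)
  next
    case 3
    then show ?thesis by (simp add: g(3) mk_dual_eq rel_lift_None fx)
  qed
qed

text \<open>Decoding the code of a body returns the body only if the body is an element of the
  exponential. Continuity of the terms guarantees this where the environment lies in the carriers,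
  that is, for all points near \<open>x0\<close>.\<close>

lemma rel_lam:
  assumes small: "small_src N (Fun \<tau> \<sigma>)" "list_all (small_src N) \<Gamma>" and r: "rel_env \<Gamma> gs \<gamma>'"
    and b: "cont_in (map cpo (\<tau> # \<Gamma>)) (cpo \<sigma>) \<psi>"
    and b': "cont_in (map (\<lambda>\<tau>. AD_cpo \<tau>) (\<tau> # \<Gamma>)) (AD_cpo \<sigma>) \<psi>'"
    and body: "\<And>a a'. rel \<tau> a a' \<Longrightarrow> rel_lift (rel \<sigma>) (\<lambda>y. \<psi> (a y # env gs y)) (\<psi>' (a' # \<gamma>'))"
  shows "rel (Fun \<tau> \<sigma>)
    (\<lambda>y. VFun (enc C (\<lambda>a. if a \<in> carr (cpo \<tau>) then \<psi> (a # env gs y) else None)))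
    (VFun (enc C (\<lambda>a. if a \<in> carr (AD_cpo \<tau>) then \<psi>' (a # \<gamma>') else None)))"
proof -
  let ?f = "\<lambda>y a. if a \<in> carr (cpo \<tau>) then \<psi> (a # env gs y) else None"
  let ?v = "\<lambda>a. if a \<in> carr (AD_cpo \<tau>) then \<psi>' (a # \<gamma>') else None"
  have s: "small_src N \<tau>" "small_src N \<sigma>" using small by (simp_all only: small_src_Fun)
  note ec = rel_env_carr[OF small(2) r]
  have m: "\<forall>\<^sub>F y in F. ?f y \<in> carr (kleisli_exp (cpo \<tau>) (cpo \<sigma>))"
    using ec(1) by eventually_elim (rule lam_exp[OF cpo[OF s(1)] b[unfolded list.map]])
  have m': "?v \<in> carr (kleisli_exp (AD_cpo \<tau>) (AD_cpo \<sigma>))"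
    by (rule lam_exp[OF AD_cpo[OF s(1)] b'[unfolded list.map] ec(2)])
  have app: "rel_lift (rel \<sigma>) (\<lambda>y. apply_val C (VFun (enc C (?f y))) (a y)) (apply_val C (VFun (enc C ?v)) a')"
    if a: "rel \<tau> a a'" for a a'
  proof -
    have "\<forall>\<^sub>F y in F. \<psi> (a y # env gs y) = apply_val C (VFun (enc C (?f y))) (a y)"
      using m rel_carr[OF a, THEN conjunct1]
    proof eventually_elim
      case (elim y)
      show ?case using elim(2) unfolding apply_val_enc[OF faithful[OF small(1)] elim(1)] by simp
    qed
    from rel_lift_cong[OF this body[OF a]] show ?thesis
      using rel_carr[OF a] unfolding apply_val_enc[OF AD_faithful[OF small(1)] m'] by simp
  qed
  have "\<forall>\<^sub>F y in F. VFun (enc C (?f y)) \<in> carr (fun_poset C (cpo \<tau>) (cpo \<sigma>))"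
    using m by eventually_elim (rule enc_in_fun)
  then show ?thesis unfolding rel.simps using enc_in_fun[OF m'] app by blast
qed

text \<open>The \<open>m\<close>-th approximation allows at most \<open>m\<close> evaluations of the
  body. Each approximation is related on both sides, with neighbourhoods that may shrink as
  \<open>m\<close> grows, and admissibility passes to the loop itself.\<close>

lemma rel_iteration:
  assumes small: "small_src N \<sigma>" "small_src N \<tau>" "list_all (small_src N) \<Gamma>" and r: "rel_env \<Gamma> gs \<gamma>'"
    and b: "cont_in (map cpo (\<sigma> # \<Gamma>)) (cpo (Sum \<sigma> \<tau>)) \<psi>"
    and b': "cont_in (map (\<lambda>\<tau>. AD_cpo \<tau>) (\<sigma> # \<Gamma>)) (AD_cpo (Sum \<sigma> \<tau>)) \<psi>'"
    and body: "\<And>a a'. rel \<sigma> a a' \<Longrightarrow> rel_lift (rel (Sum \<sigma> \<tau>)) (\<lambda>y. \<psi> (a y # env gs y)) (\<psi>' (a' # \<gamma>'))"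
    and a: "rel \<sigma> a a'"
  shows "rel_lift (rel \<tau>) (\<lambda>y. iteration (cpo \<sigma>) (cpo \<tau>) (\<lambda>x. \<psi> (x # env gs y)) (a y))
    (iteration (AD_cpo \<sigma>) (AD_cpo \<tau>) (\<lambda>x. \<psi>' (x # \<gamma>')) a')"
proof -
  define H where "H m y = (iter_step (cpo \<sigma>) (\<lambda>x. \<psi> (x # env gs y)) ^^ m) (\<lambda>_. None)" for m y
  define H' where "H' m = (iter_step (AD_cpo \<sigma>) (\<lambda>x. \<psi>' (x # \<gamma>')) ^^ m) (\<lambda>_. None)" for m
  note ec = rel_env_carr[OF small(3) r]
  note P = cpo_porder[OF small(1)] and P' = AD_cpo_porder[OF small(1)]
  have H: "\<forall>\<^sub>F y in F. chain_sup (kleisli_exp (cpo \<sigma>) (cpo \<tau>)) (\<lambda>m. H m y)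
      (iteration (cpo \<sigma>) (cpo \<tau>) (\<lambda>x. \<psi> (x # env gs y)))"
    using ec(1)
  proof eventually_elim
    case (elim y)
    show ?case
      unfolding H_def using cont_body[OF b[unfolded list.map] elim]
      by (intro iteration_chain_sup[OF P cpo[OF small(2)]]) simp
  qed
  have H': "chain_sup (kleisli_exp (AD_cpo \<sigma>) (AD_cpo \<tau>)) H'
      (iteration (AD_cpo \<sigma>) (AD_cpo \<tau>) (\<lambda>x. \<psi>' (x # \<gamma>')))"
    unfolding H'_def using cont_body[OF b'[unfolded list.map] ec(2)]
    by (intro iteration_chain_sup[OF P' AD_cpo[OF small(2)]]) simp
  \<comment> \<open>The start germ is generalised because the next round begins with the germ that
    the body delivers.\<close>
  have step: "rel_lift (rel \<tau>) (\<lambda>y. H m y (a y)) (H' m a')" if "rel \<sigma> a a'" for m a a'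
    using that
  proof (induction m arbitrary: a a')
    case 0
    then show ?case by (simp add: H_def H'_def rel_lift_None)
  next
    case (Suc m)
    let ?c = "\<lambda>h v. case v of VInl x \<Rightarrow> h x | VInr w \<Rightarrow> Some w | _ \<Rightarrow> None"
    have HS: "H (Suc m) y = iter_step (cpo \<sigma>) (\<lambda>x. \<psi> (x # env gs y)) (H m y)" for y by (simp add: H_def)
    have HS': "H' (Suc m) = iter_step (AD_cpo \<sigma>) (\<lambda>x. \<psi>' (x # \<gamma>')) (H' m)" by (simp add: H'_def)
    have "rel_lift (rel \<tau>) (\<lambda>y. Option.bind (\<psi> (a y # env gs y)) (?c (H m y)))
        (Option.bind (\<psi>' (a' # \<gamma>')) (?c (H' m)))"
      by (rule rel_lift_bind[OF body[OF Suc.prems]]) (rule rel_lift_case_sum, assumption, rule Suc.IH, assumption, rule rel_lift_Some)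
    moreover have "\<forall>\<^sub>F y in F. Option.bind (\<psi> (a y # env gs y)) (?c (H m y)) = H (Suc m) y (a y)"
      using rel_carr[OF Suc.prems, THEN conjunct1] by eventually_elim (simp add: HS iter_step_def)
    moreover have "Option.bind (\<psi>' (a' # \<gamma>')) (?c (H' m)) = H' (Suc m) a'"
      using rel_carr[OF Suc.prems] by (simp add: HS' iter_step_def)
    ultimately show ?case using rel_lift_cong by simp
  qed
  show ?thesis
  proof (rule rel_lift_sup[OF small(2) _ _ _ small(2)])
    show "rel_lift (rel \<tau>) (\<lambda>y. H m y (a y)) (H' m a')" for m by (rule step[OF a])
    show "\<forall>\<^sub>F y in F. chain_sup (lift (cpo \<tau>)) (\<lambda>m. H m y (a y))
        (iteration (cpo \<sigma>) (cpo \<tau>) (\<lambda>x. \<psi> (x # env gs y)) (a y))"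
      using H rel_carr[OF a, THEN conjunct1]
      by eventually_elim (simp add: chain_sup_exp_pointwise[OF P cpo[OF small(2)]])
    show "chain_sup (lift (AD_cpo \<tau>)) (\<lambda>m. H' m a') (iteration (AD_cpo \<sigma>) (AD_cpo \<tau>) (\<lambda>x. \<psi>' (x # \<gamma>')) a')"
      using H' rel_carr[OF a] by (simp add: chain_sup_exp_pointwise[OF P' AD_cpo[OF small(2)]])
  qed
qed

text \<open>The Kleene approximations on both sides are related step by step, and the relation at a
  function type is admissible. Continuity of both bodies is what presents the two fixed points as
  suprema of these approximations.\<close>

lemma rel_fixpoint:
  assumes small: "small_src N (Fun \<tau> \<sigma>)" "list_all (small_src N) \<Gamma>" and r: "rel_env \<Gamma> gs \<gamma>'"
    and b: "cont_in (map cpo (Fun \<tau> \<sigma> # \<Gamma>)) (cpo (Fun \<tau> \<sigma>)) \<psi>"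
    and b': "cont_in (map (\<lambda>\<tau>. AD_cpo \<tau>) (Fun \<tau> \<sigma> # \<Gamma>)) (AD_cpo (Fun \<tau> \<sigma>)) \<psi>'"
    and body: "\<And>f f'. rel (Fun \<tau> \<sigma>) f f' \<Longrightarrow>
      rel_lift (rel (Fun \<tau> \<sigma>)) (\<lambda>y. \<psi> (f y # env gs y)) (\<psi>' (f' # \<gamma>'))"
  shows "rel (Fun \<tau> \<sigma>) (\<lambda>y. fixpoint C (cpo \<tau>) (cpo \<sigma>) (\<lambda>f. \<psi> (f # env gs y)))
    (fixpoint C (AD_cpo \<tau>) (AD_cpo \<sigma>) (\<lambda>f. \<psi>' (f # \<gamma>')))"
proof -
  let ?bot = "VFun (enc C (\<lambda>_. None))"
  define X where "X m y = (fix_step C (\<lambda>f. \<psi> (f # env gs y)) ^^ m) ?bot" for m y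
  define V where "V m = (fix_step C (\<lambda>f. \<psi>' (f # \<gamma>')) ^^ m) ?bot" for m
  have s: "small_src N \<tau>" "small_src N \<sigma>" using small by (simp_all only: small_src_Fun)
  note ec = rel_env_carr[OF small(2) r]
  have X: "\<forall>\<^sub>F y in F. chain_sup (fun_poset C (cpo \<tau>) (cpo \<sigma>)) (\<lambda>m. X m y)
      (fixpoint C (cpo \<tau>) (cpo \<sigma>) (\<lambda>f. \<psi> (f # env gs y)))"
    using ec(1)
  proof eventually_elim
    case (elim y)
    show ?case
      unfolding X_def using cont_body[OF b[unfolded list.map] elim]
      by (intro fixpoint_chain_sup[OF faithful[OF small(1)] cpo_porder[OF s(1)] cpo[OF s(2)]]) simp
  qed
  have V: "chain_sup (fun_poset C (AD_cpo \<tau>) (AD_cpo \<sigma>)) V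
      (fixpoint C (AD_cpo \<tau>) (AD_cpo \<sigma>) (\<lambda>f. \<psi>' (f # \<gamma>')))"
    unfolding V_def using cont_body[OF b'[unfolded list.map] ec(2)]
    by (intro fixpoint_chain_sup[OF AD_faithful[OF small(1)] AD_cpo_porder[OF s(1)] AD_cpo[OF s(2)]]) simp
  have X_in: "\<forall>\<^sub>F y in F. X m y \<in> carr (fun_poset C (cpo \<tau>) (cpo \<sigma>))" for m
    using X by eventually_elim (rule chain_sup_in)
  have step: "rel (Fun \<tau> \<sigma>) (X m) (V m)" for m
  proof (induction m)
    case 0
    have "rel (Fun \<tau> \<sigma>) (X 0) ?bot" by (rule rel_fun_bot[OF small(1) X_in]) (simp add: X_def)
    then show ?case by (simp only: V_def funpow_0)
  next
    case (Suc m)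
    have XS: "X (Suc m) y = (case \<psi> (X m y # env gs y) of None \<Rightarrow> ?bot | Some g \<Rightarrow> g)" for y
      by (simp add: X_def fix_step_def)
    have VS: "V (Suc m) = (case \<psi>' (V m # \<gamma>') of None \<Rightarrow> ?bot | Some g \<Rightarrow> g)"
      by (simp add: V_def fix_step_def)
    from body[OF Suc] show ?case
      unfolding rel_lift_def
    proof (elim disjE exE conjE)
      \<comment> \<open>Only at \<open>x0\<close> is the next approximation known to be the nowhere
        defined function; at nearby points the body may already be defined.\<close>
      assume *: "\<psi>' (V m # \<gamma>') = None" "\<psi> (X m x0 # env gs x0) = None"
      have "rel (Fun \<tau> \<sigma>) (X (Suc m)) ?bot"
        by (rule rel_fun_bot[OF small(1) X_in]) (simp only: XS * option.case)
      then show ?thesis by (simp only: VS * option.case)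
    next
      fix g u assume *: "\<forall>\<^sub>F y in F. \<psi> (X m y # env gs y) = Some (g y)" "\<psi>' (V m # \<gamma>') = Some u" "rel (Fun \<tau> \<sigma>) g u"
      from *(1) have "\<forall>\<^sub>F y in F. g y = X (Suc m) y" by eventually_elim (simp add: XS)
      from rel_cong[OF this *(3)] show ?thesis by (simp only: VS *(2) option.case)
    qed
  qed
  show ?thesis
    by (rule rel_admissible[where X = X and V = V, OF small(1) step]) (use X V in simp_all)
qed

text \<open>The environment is a list of germs and not of values, so the statement also applies
  below binders, where the bound variable stands for a result that depends on the point.\<close>

lemma rel_sem:
  "src_typed S N \<Gamma> t \<tau> \<Longrightarrow> rel_env \<Gamma> gs \<gamma>' \<Longrightarrow>
    rel_lift (rel \<tau>) (\<lambda>y. sem S C k t (env gs y)) (sem S C k (AD S t) \<gamma>')"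
proof (induction arbitrary: gs \<gamma>' rule: src_typed.induct)
  case (Var \<Gamma> i)
  then have "rel_lift (rel (\<Gamma> ! i)) (\<lambda>y. Some ((gs ! i) y)) (Some (\<gamma>' ! i))"
    by (intro rel_lift_Some) (simp add: rel_env_def)
  then show ?case using Var by (simp add: rel_env_def)
next
  case (Let \<Gamma> t \<sigma> s \<tau>)
  show ?case
    unfolding sem.simps AD.simps
    by (rule rel_lift_bind[OF Let.IH(1)[OF Let.prems]]) (use Let.IH(2)[OF rel_env_Cons[OF _ Let.prems]] in simp)
next
  case (Const \<Gamma> c)
  have "tangent (\<lambda>_. 0) = (\<lambda>_. 0)" by (simp add: tangent_def fun_eq_iff)
  then show ?case
    using rel_lift_Some[where R = "rel Real", OF rel_RealI[OF has_deriv_const, of c]] by (simp add: mk_dual_eq del: rel.simps)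
next
  case (Op \<Gamma> ts f)
  let ?ds = "map (AD S) ts"
  note ec = rel_env_carr[OF Op.hyps(1) Op.prems]
  have AD: "sem S C k (AD_op S f ?ds) \<gamma>' =
      Option.bind (those (map (\<lambda>d. sem S C k d \<gamma>') ?ds)) (op_dual S f)"
  proof (rule sem_AD_op[OF wf sound Op.hyps(3)])
    fix d v assume "d \<in> set ?ds" "sem S C k d \<gamma>' = Some v"
    then show "v \<in> mk_dual ` (UNIV \<times> vect_space k)"
      using cont_in_carr[OF AD_sem_cont ec(2)] Op.IH
      by (fastforce simp: carr_dual simp del: AD_ty.simps ty_cpo.simps)
  qed (use Op in simp)
  let ?f = "\<lambda>y. those (map (\<lambda>t. sem S C k t (env gs y)) ts)"
  let ?op = "\<lambda>vs :: 'f val list. map_option VReal (op_sem S f (map un_real vs))"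
  have "\<forall>t\<in>set ts. rel_lift (rel Real) (\<lambda>y. sem S C k t (env gs y)) (sem S C k (AD S t) \<gamma>')"
    using Op.IH Op.prems by blast
  from rel_real_those[OF this]
  show ?case
    unfolding AD.simps AD sem.simps map_map o_def
  proof (elim disjE exE conjE)
    fix qs assume qs: "length qs = length ts" "\<forall>(g, A)\<in>set qs. deriv_at g A"
      "\<forall>\<^sub>F y in F. ?f y = Some (map (\<lambda>(g, A). VReal (g y)) qs)"
      "those (map (\<lambda>t. sem S C k (AD S t) \<gamma>') ts) = Some (map (\<lambda>(g, A). mk_dual (g x0, tangent A)) qs)"
    have "rel_lift (rel Real) (\<lambda>y. ?op (map (\<lambda>(g, A). VReal (g y)) qs))
      (op_dual S f (map (\<lambda>(g, A). mk_dual (g x0, tangent A)) qs))"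
      by (rule rel_op) (use qs(1,2) Op.hyps(2) in auto)
    moreover have "\<forall>\<^sub>F y in F. ?op (map (\<lambda>(g, A). VReal (g y)) qs) = Option.bind (?f y) ?op"
      using qs(3) by eventually_elim (simp only: bind.bind_lunit)
    ultimately show "rel_lift (rel Real) (\<lambda>y. Option.bind (?f y) ?op)
        (Option.bind (those (map (\<lambda>t. sem S C k (AD S t) \<gamma>') ts)) (op_dual S f))"
      unfolding qs(4) bind.bind_lunit by (rule rel_lift_cong[rotated])
  next
    assume "those (map (\<lambda>t. sem S C k (AD S t) \<gamma>') ts) = None" "?f x0 = None"
    then show "rel_lift (rel Real) (\<lambda>y. Option.bind (?f y) ?op)
        (Option.bind (those (map (\<lambda>t. sem S C k (AD S t) \<gamma>') ts)) (op_dual S f))"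
      by (simp only: bind.bind_lzero rel_lift_None)
  qed
next
  case (CaseZero \<Gamma> t \<tau>)
  show ?case
    unfolding sem.simps AD.simps by (rule rel_lift_bind[OF CaseZero.IH[OF CaseZero.prems]]) simp
next
  case (Inl \<Gamma> t \<tau> \<sigma>)
  show ?case
    unfolding sem.simps AD.simps map_option_bind
    by (rule rel_lift_bind[OF Inl.IH[OF Inl.prems]]) (rule rel_lift_Some, erule rel_InlI)
next
  case (Inr \<Gamma> t \<sigma> \<tau>)
  show ?case
    unfolding sem.simps AD.simps map_option_bind
    by (rule rel_lift_bind[OF Inr.IH[OF Inr.prems]]) (rule rel_lift_Some, erule rel_InrI)
next
  case (CaseSum \<Gamma> r \<sigma> \<rho> t \<tau> s)
  show ?case
    unfolding sem.simps AD.simps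
  proof (rule rel_lift_bind[OF CaseSum.IH(1)[OF CaseSum.prems]], rule rel_lift_case_sum, assumption)
    show "rel_lift (rel \<tau>) (\<lambda>y. sem S C k t (g y # env gs y)) (sem S C k (AD S t) (u # \<gamma>'))" if "rel \<sigma> g u" for g u
      using CaseSum.IH(2)[OF rel_env_Cons[OF that CaseSum.prems]] by simp
    show "rel_lift (rel \<tau>) (\<lambda>y. sem S C k s (g y # env gs y)) (sem S C k (AD S s) (u # \<gamma>'))" if "rel \<rho> g u" for g u
      using CaseSum.IH(3)[OF rel_env_Cons[OF that CaseSum.prems]] by simp
  qed
next
  case (Unit \<Gamma>)
  have "rel_lift (rel One) (\<lambda>y. Some VUnit) (Some VUnit)" by (rule rel_lift_Some) simp
  then show ?case by simp
next
  case (Pair \<Gamma> t \<tau> s \<sigma>)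
  show ?case
    unfolding sem.simps AD.simps map_option_bind
    by (rule rel_lift_bind[OF Pair.IH(1)[OF Pair.prems]], rule rel_lift_bind[OF Pair.IH(2)[OF Pair.prems]])
      (rule rel_lift_Some, erule (1) rel_PairI)
next
  case (CasePair \<Gamma> r \<sigma> \<rho> t \<tau>)
  show ?case
    unfolding sem.simps AD.simps
  proof (rule rel_lift_bind[OF CasePair.IH(1)[OF CasePair.prems]], rule rel_lift_case_pair, assumption)
    show "rel_lift (rel \<tau>) (\<lambda>y. sem S C k t (g y # h y # env gs y)) (sem S C k (AD S t) (u # w # \<gamma>'))"
      if "rel \<sigma> g u" "rel \<rho> h w" for g u h w
      using CasePair.IH(2)[OF rel_env_Cons[OF that(1) rel_env_Cons[OF that(2) CasePair.prems]]] by simp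
  qed
next
  case (Lam \<tau> \<Gamma> t \<sigma>)
  note small = Lam.hyps(1)[THEN src_typed_small]
  have "rel (Fun \<tau> \<sigma>)
      (\<lambda>y. VFun (enc C (\<lambda>a. if a \<in> carr (cpo \<tau>) then sem S C k t (a # env gs y) else None)))
      (VFun (enc C (\<lambda>a. if a \<in> carr (AD_cpo \<tau>) then sem S C k (AD S t) (a # \<gamma>') else None)))"
    by (rule rel_lam[OF Lam.hyps(2) _ Lam.prems sem_cont[OF Lam.hyps(1)] AD_sem_cont[OF Lam.hyps(1)]])
      (use small Lam.IH[OF rel_env_Cons[OF _ Lam.prems]] in simp_all)
  then show ?case unfolding sem.simps AD.simps by (rule rel_lift_Some)
next
  case (App \<Gamma> t \<tau> \<sigma> s)
  show ?case
    unfolding sem.simps AD.simps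
    by (rule rel_lift_bind[OF App.IH(1)[OF App.prems]], rule rel_lift_bind[OF App.IH(2)[OF App.prems]]) simp
next
  case (Sign \<Gamma> t)
  have "rel_lift (rel (Sum One One)) (\<lambda>y. Option.bind (sem S C k t (env gs y))
      (\<lambda>v. if un_real v < 0 then Some (VInl VUnit) else if un_real v > 0 then Some (VInr VUnit) else None))
    (Option.bind (sem S C k (AD S t) \<gamma>') (\<lambda>v. case v of VPair a b \<Rightarrow>
       if un_real a < 0 then Some (VInl VUnit) else if un_real a > 0 then Some (VInr VUnit) else None | _ \<Rightarrow> None))"
    by (rule rel_lift_bind[OF Sign.IH[OF Sign.prems] rel_lift_sign])
  moreover have "Option.bind (sem S C k (AD S t) \<gamma>') (\<lambda>v. case v of VPair a b \<Rightarrow>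
       if un_real a < 0 then Some (VInl VUnit) else if un_real a > 0 then Some (VInr VUnit) else None | _ \<Rightarrow> None) =
     sem S C k (AD S (TSign t)) \<gamma>'"
    by (cases "sem S C k (AD S t) \<gamma>'") (auto split: val.split)
  ultimately show ?case by (simp del: rel.simps)
next
  case (Iterate \<sigma> \<Gamma> t \<tau> s)
  note small = Iterate.hyps[THEN src_typed_small]
  show ?case
    unfolding sem.simps AD.simps
  proof (rule rel_lift_bind[OF Iterate.IH(2)[OF Iterate.prems]])
    show "rel_lift (rel \<tau>) (\<lambda>y. iteration (cpo \<sigma>) (cpo \<tau>) (\<lambda>a. sem S C k t (a # env gs y)) (g y))
       (iteration (AD_cpo \<sigma>) (AD_cpo \<tau>) (\<lambda>a. sem S C k (AD S t) (a # \<gamma>')) u)" if "rel \<sigma> g u" for g u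
      by (rule rel_iteration[OF _ _ _ Iterate.prems sem_cont[OF Iterate.hyps(1)] AD_sem_cont[OF Iterate.hyps(1)] _ that])
        (use small Iterate.IH(1)[OF rel_env_Cons[OF _ Iterate.prems]] in \<open>simp_all del: rel.simps\<close>)
  qed
next
  case (Mu \<tau> \<sigma> \<Gamma> t)
  note small = Mu.hyps[THEN src_typed_small]
  have "rel (Fun \<tau> \<sigma>) (\<lambda>y. fixpoint C (cpo \<tau>) (cpo \<sigma>) (\<lambda>f. sem S C k t (f # env gs y)))
    (fixpoint C (AD_cpo \<tau>) (AD_cpo \<sigma>) (\<lambda>f. sem S C k (AD S t) (f # \<gamma>')))"
    by (rule rel_fixpoint[OF _ _ Mu.prems sem_cont[OF Mu.hyps] AD_sem_cont[OF Mu.hyps]])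
      (use small Mu.IH[OF rel_env_Cons[OF _ Mu.prems]] in \<open>simp_all del: rel.simps\<close>)
  then show ?case unfolding sem.simps AD.simps by (rule rel_lift_Some)
qed

end

section \<open>Programs between data types\<close>

context related_at
begin

text \<open>The inputs are coordinate functions: entry \<open>d\<close> has a unit vector as
  gradient, whose tangent is the vector stored in \<open>ps ! d\<close>. The offset \<open>d\<close>
  is generalised because the two factors of a product use consecutive segments of the tuple.\<close>

lemma rel_from_coprod:
  "data_ty \<tau> \<Longrightarrow> r \<in> summands \<tau> \<Longrightarrow> d + atoms r \<le> length ps \<Longrightarrow>
    rel \<tau> (\<lambda>y. from_coprod VReal r (take (atoms r) (drop d y))) (from_coprod mk_dual r (take (atoms r) (drop d ps)))"
proof (induction \<tau> arbitrary: r d)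
  case Real
  then have r: "r = SAtom" "d < length ps" by auto
  have "tangent (\<lambda>l. if l = d then 1 else 0) c = snd (ps ! d) c" for c
    using r(2) by (simp add: tangent_def if_distrib[of "\<lambda>a. a * _"] cong: if_cong)
  then have t: "tangent (\<lambda>l. if l = d then 1 else 0) = snd (ps ! d)" by (rule ext)
  have "rel Real (\<lambda>y. VReal (y ! d)) (mk_dual (x0 ! d, tangent (\<lambda>l. if l = d then 1 else 0)))"
    by (rule rel_RealI[OF has_deriv_nth[OF r(2)]])
  moreover have "\<forall>\<^sub>F y in F. VReal (y ! d) = from_coprod VReal r (take (atoms r) (drop d y))"
    using eventually_length by eventually_elim (use r in \<open>simp add: hd_drop_conv_nth\<close>)
  moreover have "mk_dual (x0 ! d, tangent (\<lambda>l. if l = d then 1 else 0)) =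
      from_coprod mk_dual r (take (atoms r) (drop d ps))"
    using r by (simp add: t hd_drop_conv_nth)
  ultimately show ?case using rel_cong by metis
next
  case (Sum \<tau> \<sigma>)
  from Sum.prems(2) consider r' where "r = SInl r'" "r' \<in> summands \<tau>" | r' where "r = SInr r'" "r' \<in> summands \<sigma>"
    by auto
  then show ?case
  proof cases
    case (1 r')
    then show ?thesis using rel_InlI[OF Sum.IH(1)[of r' d]] Sum.prems by simp
  next
    case (2 r')
    then show ?thesis using rel_InrI[OF Sum.IH(2)[of r' d]] Sum.prems by simp
  qed
next
  case (Prod \<tau> \<sigma>)
  then obtain r1 r2 where r: "r = SPair r1 r2" "r1 \<in> summands \<tau>" "r2 \<in> summands \<sigma>" by auto
  have "rel (Prod \<tau> \<sigma>)
      (\<lambda>y. VPair (from_coprod VReal r1 (take (atoms r1) (drop d y)))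
        (from_coprod VReal r2 (take (atoms r2) (drop (d + atoms r1) y))))
      (VPair (from_coprod mk_dual r1 (take (atoms r1) (drop d ps)))
        (from_coprod mk_dual r2 (take (atoms r2) (drop (d + atoms r1) ps))))"
    by (rule rel_PairI[OF Prod.IH(1) Prod.IH(2)]) (use Prod.prems r in simp_all)
  then show ?case by (simp add: r(1) drop_take add.commute del: rel.simps)
qed simp_all

text \<open>At data types the relation unfolds completely: the summand of the output is constant
  near \<open>x0\<close>, its entries are differentiable there, and the dual output carries their
  tangents.\<close>

lemma rel_to_coprod:
  "data_ty \<sigma> \<Longrightarrow> rel \<sigma> f v \<Longrightarrow> \<exists>s\<in>summands \<sigma>. \<exists>qs. length qs = atoms s \<and> (\<forall>(g, A)\<in>set qs. deriv_at g A) \<and>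
    (\<forall>\<^sub>F y in F. to_coprod un_real \<sigma> (f y) = (s, map (\<lambda>(g, A). g y) qs)) \<and>
    to_coprod un_dual \<sigma> v = (s, map (\<lambda>(g, A). (g x0, tangent A)) qs)"
proof (induction \<sigma> arbitrary: f v)
  case Real
  then obtain g A where *: "deriv_at g A" "\<forall>\<^sub>F y in F. f y = VReal (g y)" "v = mk_dual (g x0, tangent A)" by auto
  have "\<forall>\<^sub>F y in F. to_coprod un_real Real (f y) = (SAtom, map (\<lambda>(g, A). g y) [(g, A)])"
    using *(2) by eventually_elim simp
  then show ?case using *(1,3) by (intro bexI[of _ SAtom] exI[of _ "[(g, A)]"]) simp_all
next
  case One
  then show ?case by (intro bexI[of _ SUnit] exI[of _ "[]"]) simp_all
next
  case (Sum \<tau> \<sigma>)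
  from Sum.prems(2) show ?case
  proof (cases rule: rel_SumE)
    case (Inl g u)
    obtain s qs where *: "s \<in> summands \<tau>" "length qs = atoms s" "\<forall>(g, A)\<in>set qs. deriv_at g A"
      "\<forall>\<^sub>F y in F. to_coprod un_real \<tau> (g y) = (s, map (\<lambda>(g, A). g y) qs)"
      "to_coprod un_dual \<tau> u = (s, map (\<lambda>(g, A). (g x0, tangent A)) qs)"
      using Sum.IH(1)[OF _ Inl(3)] Sum.prems(1) by auto
    have "\<forall>\<^sub>F y in F. to_coprod un_real (Sum \<tau> \<sigma>) (f y) = (SInl s, map (\<lambda>(g, A). g y) qs)"
      using Inl(1) *(4) by eventually_elim simp
    then show ?thesis using * Inl(2) by (intro bexI[of _ "SInl s"] exI[of _ qs]) simp_all
  next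
    case (Inr g u)
    obtain s qs where *: "s \<in> summands \<sigma>" "length qs = atoms s" "\<forall>(g, A)\<in>set qs. deriv_at g A"
      "\<forall>\<^sub>F y in F. to_coprod un_real \<sigma> (g y) = (s, map (\<lambda>(g, A). g y) qs)"
      "to_coprod un_dual \<sigma> u = (s, map (\<lambda>(g, A). (g x0, tangent A)) qs)"
      using Sum.IH(2)[OF _ Inr(3)] Sum.prems(1) by auto
    have "\<forall>\<^sub>F y in F. to_coprod un_real (Sum \<tau> \<sigma>) (f y) = (SInr s, map (\<lambda>(g, A). g y) qs)"
      using Inr(1) *(4) by eventually_elim simp
    then show ?thesis using * Inr(2) by (intro bexI[of _ "SInr s"] exI[of _ qs]) simp_all
  qed
next
  case (Prod \<tau> \<sigma>)
  from Prod.prems(2) obtain g h u w where *: "\<forall>\<^sub>F y in F. f y = VPair (g y) (h y)" "v = VPair u w"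
    "rel \<tau> g u" "rel \<sigma> h w" by auto
  obtain s qs where s: "s \<in> summands \<tau>" "length qs = atoms s" "\<forall>(g, A)\<in>set qs. deriv_at g A"
    "\<forall>\<^sub>F y in F. to_coprod un_real \<tau> (g y) = (s, map (\<lambda>(g, A). g y) qs)"
    "to_coprod un_dual \<tau> u = (s, map (\<lambda>(g, A). (g x0, tangent A)) qs)"
    using Prod.IH(1)[OF _ *(3)] Prod.prems(1) by auto
  obtain s' qs' where s': "s' \<in> summands \<sigma>" "length qs' = atoms s'" "\<forall>(g, A)\<in>set qs'. deriv_at g A"
    "\<forall>\<^sub>F y in F. to_coprod un_real \<sigma> (h y) = (s', map (\<lambda>(g, A). g y) qs')"
    "to_coprod un_dual \<sigma> w = (s', map (\<lambda>(g, A). (g x0, tangent A)) qs')"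
    using Prod.IH(2)[OF _ *(4)] Prod.prems(1) by auto
  have "\<forall>\<^sub>F y in F. to_coprod un_real (Prod \<tau> \<sigma>) (f y) = (SPair s s', map (\<lambda>(g, A). g y) (qs @ qs'))"
    using *(1) s(4) s'(4) by eventually_elim simp
  then show ?case
    using s s' *(2) by (intro bexI[of _ "SPair s s'"] exI[of _ "qs @ qs'"]) auto
qed simp_all

lemma sem_germ:
  assumes t: "src_typed S N [\<tau>] t \<sigma>" and data: "data_ty \<tau>" "data_ty \<sigma>"
    and r: "r \<in> summands \<tau>" "length ps = atoms r"
  defines "h \<equiv> real_map \<sigma> (\<lambda>v. sem S C k t [v])" and "h' \<equiv> dual_map \<sigma> (\<lambda>v. sem S C k (AD S t) [v])"
  obtains (None) "h (r, x0) = None" "h' (r, ps) = None"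
  | (Some) s qs where "s \<in> summands \<sigma>" "length qs = atoms s" "\<And>q. q < length qs \<Longrightarrow> deriv_at (fst (qs ! q)) (snd (qs ! q))"
      "\<forall>\<^sub>F y in F. h (r, y) = Some (s, map (\<lambda>q. fst q y) qs)"
      "h' (r, ps) = Some (s, map (\<lambda>q. (fst q x0, tangent (snd q))) qs)"
proof -
  let ?in = "\<lambda>y. from_coprod VReal r (take (atoms r) (drop 0 y)) :: 'f val"
  have "rel \<tau> ?in (from_coprod mk_dual r (take (atoms r) (drop 0 ps)))"
    by (rule rel_from_coprod[OF data(1) r(1)]) (simp add: r)
  then have env: "rel_env [\<tau>] [?in] [from_coprod mk_dual r ps]" using r(2) by (simp add: rel_env_def)
  have ev: "\<forall>\<^sub>F y in F. ?in y = from_coprod VReal r y"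
    using eventually_length by eventually_elim (simp add: r(2))
  have sem: "\<forall>\<^sub>F y in F. sem S C k t (map (\<lambda>g. g y) [?in]) = sem S C k t [from_coprod VReal r y]"
    using ev by eventually_elim simp
  have "rel_lift (rel \<sigma>) (\<lambda>y. sem S C k t [from_coprod VReal r y]) (sem S C k (AD S t) [from_coprod mk_dual r ps])"
    by (rule rel_lift_cong[OF sem rel_sem[OF t env]])
  then show ?thesis
    unfolding rel_lift_def
  proof (elim disjE exE conjE)
    assume "sem S C k (AD S t) [from_coprod mk_dual r ps] = None" "sem S C k t [from_coprod VReal r x0] = None"
    then show ?thesis using None by (simp add: h_def h'_def real_map_def dual_map_def)
  next
    fix g u assume *: "\<forall>\<^sub>F y in F. sem S C k t [from_coprod VReal r y] = Some (g y)"
      "sem S C k (AD S t) [from_coprod mk_dual r ps] = Some u" "rel \<sigma> g u"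
    obtain s qs where s: "s \<in> summands \<sigma>" "length qs = atoms s" "\<forall>(g, A)\<in>set qs. deriv_at g A"
      "\<forall>\<^sub>F y in F. to_coprod un_real \<sigma> (g y) = (s, map (\<lambda>(g, A). g y) qs)"
      "to_coprod un_dual \<sigma> u = (s, map (\<lambda>(g, A). (g x0, tangent A)) qs)"
      using rel_to_coprod[OF data(2) *(3)] by blast
    show ?thesis
    proof (rule Some[OF s(1,2)])
      show "deriv_at (fst (qs ! q)) (snd (qs ! q))" if "q < length qs" for q
        using s(3) nth_mem[OF that] by (auto simp: split_beta)
      show "\<forall>\<^sub>F y in F. h (r, y) = Some (s, map (\<lambda>q. fst q y) qs)"
        using *(1) s(4) by eventually_elim (simp add: h_def real_map_def split_beta)
      show "h' (r, ps) = Some (s, map (\<lambda>q. (fst q x0, tangent (snd q))) qs)"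
        using *(2) s(5) by (simp add: h'_def dual_map_def split_beta)
    qed
  qed
qed

text \<open>The relation already expresses the dual output by tangents of certain gradients;
  uniqueness of derivatives replaces these gradients by partial derivatives of the program.\<close>

lemma dual_map_eq_dual_deriv:
  assumes "src_typed S N [\<tau>] t \<sigma>" "data_ty \<tau>" "data_ty \<sigma>" "r \<in> summands \<tau>" "length ps = atoms r"
  shows "dual_map \<sigma> (\<lambda>v. sem S C k (AD S t) [v]) (r, ps) =
    dual_deriv (real_map \<sigma> (\<lambda>v. sem S C k t [v])) (r, ps)"
  using assms
proof (cases rule: sem_germ)
  case None
  then show ?thesis by (simp add: dual_deriv_def)
next
  case (Some s qs)
  let ?h = "real_map \<sigma> (\<lambda>v. sem S C k t [v])"
  have pd: "partial_deriv ?h r q l x0 = snd (qs ! q) l" if q: "q < length qs" and l: "l < length ps" for q l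
  proof (rule has_deriv_imp_partial_deriv[OF _ Some(3)[OF q] l])
    show "\<forall>\<^sub>F y in F. snd (the (?h (r, y))) ! q = fst (qs ! q) y"
      using Some(4) by eventually_elim (simp add: q)
  qed simp
  have "?h (r, x0) = Some (s, map (\<lambda>q. fst q x0) qs)" by (rule at_x0[OF Some(4)])
  moreover have "(\<lambda>c. \<Sum>l<length ps. partial_deriv ?h r q l x0 * snd (ps ! l) c) = tangent (snd (qs ! q))"
    if "q < length qs" for q
    by (simp add: tangent_def fun_eq_iff pd[OF that])
  ultimately have "dual_deriv ?h (r, ps) = Some (s, map (\<lambda>q. (fst q x0, tangent (snd q))) qs)"
    by (auto simp: dual_deriv_def Let_def intro!: nth_equalityI)
  then show ?thesis using Some(5) by simp
qed

end

text \<open>The germ description at every point of the domain gives both claims: the domain of each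
  summand is a neighbourhood of each of its points, and the gradients of the entries form the
  derivative matrix.\<close>

lemma (in sound_AD) differentiable_sem:
  assumes t: "src_typed S N [\<tau>] t \<sigma>" and data: "data_ty \<tau>" "data_ty \<sigma>"
  shows "differentiable_map (summands \<tau>) atoms (summands \<sigma>) atoms (real_map \<sigma> (\<lambda>v. sem S C k t [v]))"
proof -
  let ?h = "real_map \<sigma> (\<lambda>v. sem S C k t [v])"
  have germ: "?h (r, x) = None \<or> (\<exists>s\<in>summands \<sigma>. \<exists>qs. length qs = atoms s \<and>
      (\<forall>q<length qs. has_deriv (atoms r) x (fst (qs ! q)) (snd (qs ! q))) \<and>
      (\<forall>\<^sub>F y in nhds_Rn (atoms r) x. ?h (r, y) = Some (s, map (\<lambda>q. fst q y) qs)))"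
    if r: "r \<in> summands \<tau>" "length x = atoms r" for r x
  proof -
    \<comment> \<open>Differentiability involves no tangent vectors, so the point is equipped with
      zero vectors, which belong to \<open>vect_space k\<close> for every \<open>k\<close>.\<close>
    let ?ps = "map (\<lambda>a. (a, \<lambda>_. 0)) x :: (real \<times> (nat \<Rightarrow> real)) list"
    have x: "map fst ?ps = x" by (simp add: o_def)
    interpret related_at C N k S ?ps
      by unfold_locales (auto simp: vect_space_def)
    have l: "length ?ps = atoms r" using r by simp
    show ?thesis
      using t data r(1) l
    proof (cases rule: sem_germ)
      case None
      then show ?thesis unfolding x by simp
    next
      case (Some s qs)
      then show ?thesis unfolding x l by blast
    qed
  qed
  show ?thesis
    unfolding differentiable_map_def Let_def
  proof (intro conjI ballI)
    show "?h ` coprod (summands \<tau>) atoms UNIV \<subseteq> insert None (Some ` coprod (summands \<sigma>) atoms UNIV)"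
    proof (intro image_subsetI)
      fix p assume "p \<in> coprod (summands \<tau>) atoms (UNIV :: real set)"
      then obtain r x where p: "p = (r, x)" "r \<in> summands \<tau>" "length x = atoms r" by (auto simp: coprod_def)
      from germ[OF p(2,3)] show "?h p \<in> insert None (Some ` coprod (summands \<sigma>) atoms UNIV)"
        unfolding p(1) by (auto simp: coprod_def dest: eventually_nhds_Rn_self[OF p(3)])
    qed
    fix i j assume i: "i \<in> summands \<tau>" and j: "j \<in> summands \<sigma>"
    let ?W = "{x. length x = atoms i \<and> (\<exists>y. ?h (i, x) = Some (j, y))}"
    have gW: "\<exists>qs. length qs = atoms j \<and>
        (\<forall>q<length qs. has_deriv (atoms i) x (fst (qs ! q)) (snd (qs ! q))) \<and>
        (\<forall>\<^sub>F y in nhds_Rn (atoms i) x. ?h (i, y) = Some (j, map (\<lambda>q. fst q y) qs))" if x: "x \<in> ?W" for x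
    proof -
      have l: "length x = atoms i" using x by simp
      from germ[OF i l] x obtain s qs where *: "length qs = atoms s"
        "\<forall>q<length qs. has_deriv (atoms i) x (fst (qs ! q)) (snd (qs ! q))"
        "\<forall>\<^sub>F y in nhds_Rn (atoms i) x. ?h (i, y) = Some (s, map (\<lambda>q. fst q y) qs)" by auto
      \<comment> \<open>The eventual description holds at \<open>x\<close> itself, which identifies
        the summand.\<close>
      have "s = j" using eventually_nhds_Rn_self[OF l *(3)] x by auto
      then show ?thesis using * by blast
    qed
    show "open_Rn (atoms i) ?W"
      unfolding open_Rn_def
    proof (intro conjI ballI)
      fix x assume x: "x \<in> ?W"
      from gW[OF x] obtain qs :: "((real list \<Rightarrow> real) \<times> (nat \<Rightarrow> real)) list"
        where "\<forall>\<^sub>F y in nhds_Rn (atoms i) x. ?h (i, y) = Some (j, map (\<lambda>q. fst q y) qs)"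
        by (elim exE conjE)
      then show "\<exists>e>0. \<forall>y. length y = atoms i \<and> eucl_dist x y < e \<longrightarrow> y \<in> ?W"
        unfolding eventually_nhds_Rn by blast
    qed auto
    show "differentiable_Rn (atoms i) (atoms j) ?W (\<lambda>x. snd (the (?h (i, x))))"
      unfolding differentiable_Rn_def
    proof (intro ballI)
      fix x assume x: "x \<in> ?W"
      then have lx: "length x = atoms i" by simp
      let ?n = "atoms i" and ?m = "atoms j" and ?f = "\<lambda>x. snd (the (?h (i, x)))"
      obtain qs where qs: "length qs = ?m" "\<And>q. q < ?m \<Longrightarrow> has_deriv ?n x (fst (qs ! q)) (snd (qs ! q))"
        "\<forall>\<^sub>F y in nhds_Rn ?n x. ?h (i, y) = Some (j, map (\<lambda>q. fst q y) qs)"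
        using gW[OF x] by auto
      have fq: "?f y ! q = fst (qs ! q) y" if "?h (i, y) = Some (j, map (\<lambda>q. fst q y) qs)" "q < ?m" for y q
        using that qs(1) by simp
      let ?e = "\<lambda>y q. ?f y ! q - ?f x ! q - (\<Sum>l<?n. snd (qs ! q) l * (y ! l - x ! l))"
      show "\<exists>A :: nat \<Rightarrow> nat \<Rightarrow> real. \<forall>e>0. \<exists>d>0. \<forall>y\<in>?W. eucl_dist x y < d \<longrightarrow>
          L2_set (\<lambda>q. ?f y ! q - ?f x ! q - (\<Sum>l<?n. A q l * (y ! l - x ! l))) {..<?m} \<le> e * eucl_dist x y"
      proof (intro exI[of _ "\<lambda>q. snd (qs ! q)"] allI impI)
        fix e :: real assume e: "e > 0"
        \<comment> \<open>The norm of the error is bounded by the sum of its \<open>?m\<close>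
          entries; adding 1 in the denominator avoids division by zero when the output has no real
          entries.\<close>
        define e' where "e' = e / (real ?m + 1)"
        have e': "e' > 0" "real ?m * e' \<le> e"
          using e by (simp_all add: e'_def field_simps)
        have "\<forall>\<^sub>F y in nhds_Rn ?n x. \<forall>q\<in>{..<?m}.
            \<bar>fst (qs ! q) y - fst (qs ! q) x - (\<Sum>l<?n. snd (qs ! q) l * (y ! l - x ! l))\<bar> \<le> e' * eucl_dist x y"
          by (rule eventually_ball_finite) (auto intro: has_derivD[OF qs(2) e'(1)])
        with qs(3) have "\<forall>\<^sub>F y in nhds_Rn ?n x. L2_set (?e y) {..<?m} \<le> e * eucl_dist x y"
        proof eventually_elim
          case (elim y)
          have "L2_set (?e y) {..<?m} \<le> (\<Sum>q<?m. \<bar>?e y q\<bar>)" by (rule L2_set_le_sum_abs)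
          also have "\<dots> \<le> (\<Sum>q<?m. e' * eucl_dist x y)"
          proof (rule sum_mono)
            fix q assume "q \<in> {..<?m}"
            then show "\<bar>?e y q\<bar> \<le> e' * eucl_dist x y"
              using elim(2) fq[OF elim(1)] fq[OF eventually_nhds_Rn_self[OF lx qs(3)]] by simp
          qed
          also have "\<dots> = real ?m * e' * eucl_dist x y" by simp
          also have "\<dots> \<le> e * eucl_dist x y" by (rule mult_right_mono[OF e'(2)]) simp
          finally show ?case .
        qed
        then show "\<exists>d>0. \<forall>y\<in>?W. eucl_dist x y < d \<longrightarrow> L2_set (?e y) {..<?m} \<le> e * eucl_dist x y"
          unfolding eventually_nhds_Rn by blast
      qed
    qed
  qed
qed

lemma data_ty_small_src: "data_ty \<tau> \<Longrightarrow> small_src N \<tau>"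
  by (induction \<tau>) simp_all

theorem theorem8p1:
  fixes S :: "'op signature" and C :: "'f coding" and N :: nat
    and k :: enat and \<tau> \<sigma> :: ty and t :: "'op tm"
  assumes "wf_signature S"
    and "codes N C"
    and "sound_for_primitives S C N"
    and "data_ty \<tau>" and "data_ty \<sigma>"
    and "src_tm t" and "has_type S [\<tau>] t \<sigma>"
    and "tm_depth (AD S t) \<le> N"
  shows "differentiable_map (summands \<tau>) atoms (summands \<sigma>) atoms
           (real_map \<sigma> (\<lambda>v. sem S C k t [v]))
       \<and> (\<forall>p\<in>coprod (summands \<tau>) atoms (UNIV \<times> vect_space k).
            dual_map \<sigma> (\<lambda>v. sem S C k (AD S t) [v]) p
            = dual_deriv (real_map \<sigma> (\<lambda>v. sem S C k t [v])) p)"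
proof -
  interpret sound_AD C N k S using assms(1-3) by unfold_locales
  have t: "src_typed S N [\<tau>] t \<sigma>"
    by (rule has_type_src_typed[OF assms(7,6,8)]) (simp add: data_ty_small_src[OF assms(4)])
  have "dual_map \<sigma> (\<lambda>v. sem S C k (AD S t) [v]) p = dual_deriv (real_map \<sigma> (\<lambda>v. sem S C k t [v])) p"
    if p: "p \<in> coprod (summands \<tau>) atoms (UNIV \<times> vect_space k)" for p
  proof -
    obtain r ps where "p = (r, ps)" and r: "r \<in> summands \<tau>" "length ps = atoms r" "set ps \<subseteq> UNIV \<times> vect_space k"
      using p by (auto simp: coprod_def)
    \<comment> \<open>Each argument of the transformed program has its own relation, whose base
      point and tangent vectors are read off from it.\<close>
    interpret related_at C N k S ps by unfold_locales (rule r(3))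
    show ?thesis unfolding \<open>p = (r, ps)\<close> by (rule dual_map_eq_dual_deriv[OF t assms(4,5) r(1,2)])
  qed
  then show ?thesis using differentiable_sem[OF t assms(4,5)] by blast
qed

end
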